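(* Let $x_U\in N(U)$. Assume that $N$ is a restricted tensor product $\otimes'_v N_v$ with respect to classes $x_{U_v}\in N_v(U_v)$, and that $x_U=\otimes'_v x_{U_v}$. Suppose that for each $v\in I$ and each $1\le i\le r_v$ there exists $x_{v,i}\in N_v(V_{v,i})$ such that $$\mathfrak h_{v,i,*}(x_{U_v})=\mathrm{pr}_{V_{v,i},H_{v,i},*}(x_{v,i})\quad\text{in } N_v(H_{v,i}).$$ Then there exist classes $y_\nu\in M(K[\nu])$ for all $\nu\in\mathcal N$ such that $y_\varnothing=\iota_{*}(x_U)\in M(K)$ and $$\mathfrak H_{\mu\setminus\nu,*}(y_\nu)=\mathrm{pr}_{\mu,\nu,*}(y_\mu)$$ for all $\nu,\mu\in\mathcal N$ with $\nu\subset\mu$.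
   Context: **RIC functors.** Let $G$ be a locally profinite group and $\Upsilon$ a non-empty collection of compact open subgroups such that (T1) $\Upsilon$ is stable under $G$-conjugation; (T2) for $K,L\in\Upsilon$ there is $K'\in\Upsilon$ with $K'\triangleleft K$, $K'\subset L$; (T3) $\Upsilon$ is closed under pairwise intersection. $\mathcal P(G,\Upsilon)$ is the category with objects $\Upsilon$, $\mathrm{Hom}(L,K)=\{g\in G: g^{-1}Lg\subset K\}$ and composition $(L\xrightarrow{g}K)\circ(L'\xrightarrow{h}L)=(L'\xrightarrow{hg}K)$. An $R$-module valued RIC functor $M$ on $(G,\Upsilon)$ is a pair of functors $M^*:\mathcal P(G,\Upsilon)^{op}\to R\text{-Mod}$, $M_*:\mathcal P(G,\Upsilon)\to R\text{-Mod}$ agreeing on objects (common value $M(K)$); write $[g]^*_{L,K}:M(K)\to M(L)$ and $[g]_{L,K,*}:M(L)\to M(K)$ for the induced maps and $\mathrm{pr}_{L,K}$ for $g=e$; it is required that $[g]^*_{L,K}=[g^{-1}]_{K,L,*}$ if $g^{-1}Lg=K$ and that $[\gamma]_{K,K,*}=\mathrm{id}$ for $\gamma\in K$. $M$ is *cohomological* if $\mathrm{pr}_{L,K,*}\circ\mathrm{pr}_{L,K}^*=[K:L]$ for $L\subset K$; *Mackey* if for $L,L'\subset K$ one has $\mathrm{pr}_{L,K}^*\circ\mathrm{pr}_{L',K,*}=\sum_{\gamma\in L\backslash K/L'}\mathrm{pr}_{L_\gamma,L,*}\circ[\gamma]^*_{L_\gamma,L'}$ with $L_\gamma=L\cap\gamma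 L'\gamma^{-1}$; *CoMack* if both. **Pushforwards.** For a closed subgroup $H\subset G$ and $\Upsilon_H\supset\{K\cap H:K\in\Upsilon_G\}$, a pushforward $\iota_*:N\to M$ from a RIC functor $N$ on $(H,\Upsilon_H)$ to $M$ on $(G,\Upsilon_G)$ is a family $\iota_{V,K',*}:N(V)\to M(K')$ for $V\in\Upsilon_H$, $K'\in\Upsilon_G$, $V\subset K'$, commuting with $[h]_*$ on both sides for $h\in H$ (whenever $h^{-1}V'h\subset V$, $h^{-1}L'h\subset K'$, $V'\subset L'$). It is *Mackey* if for $V,L\subset K'$: $\mathrm{pr}^*_{L,K'}\circ\iota_{V,K',*}=\sum_{\gamma\in V\backslash K'/L}[\gamma]_{\gamma L\gamma^{-1},L,*}\circ\iota_{V_\gamma,\gamma L\gamma^{-1},*}\circ\mathrm{pr}^*_{V_\gamma,V}$ with $V_\gamma=V\cap\gamma L\gamma^{-1}$. **Hecke correspondences.** $[K'\sigma K]:M(K)\to M(K')$ is $\mathrm{pr}_{K'\cap\sigma K\sigma^{-1},K',*}\circ[\sigma]^*\circ \mathrm{pr}^*_{K\cap\sigma^{-1}K'\sigma,K}$, and $[K'\sigma K]_*:=[K\sigma^{-1}K']:M(K')\to M(K)$. Extended linearly to linear combinations $\sum c_j\,\mathrm{ch}(K'\sigma_jK)$ of characteristic functions. **Setting.** $I$ is an index set; for $v\in I$, $H_v\subset G_v$ is a closed subgroup, both unimodular locally profinite; $K_v\subset G_v$ compact open, $U_v=H_v\cap K_v$, $L_v\triangleleft K_v$ compact open normal. $G=\prod'_vG_v$,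 $H=\prod'_vH_v$ are restricted products with respect to $K_v$, $U_v$; $K=\prod K_v$, $U=\prod U_v$. $\mathcal N$ is the set of finite subsets of $I$; for $\nu\in\mathcal N$, subscript $\nu$ denotes the product over $v\in\nu$ and superscript $\nu$ the part away from $\nu$; $K[\nu]=K^\nu L_\nu$. $\Upsilon_G$ satisfies (T1)-(T3) and contains $K$ and all $K[\nu]$; $\Upsilon_H$ satisfies (T1)-(T3) and contains $\{K'\cap H:K'\in\Upsilon_G\}$. $\Upsilon_{G_v}$ is the collection of finite intersections of $G_v$-conjugates of $K_v$ and $L_v$, and $\Upsilon_{H_v}=\{K'\cap H_v:K'\in\Upsilon_{G_v}\}$. $N$ on $(H,\Upsilon_H)$ and $M$ on $(G,\Upsilon_G)$ are $\mathbb Z_p$-module valued CoMack functors and $\iota_*:N\to M$ is a Mackey pushforward. For $\nu\subset\mu$, $\mathrm{pr}_{\mu,\nu,*}:M(K[\mu])\to M(K[\nu])$ is the induction map $\mathrm{pr}_{K[\mu],K[\nu],*}$; $\iota_*(x_U)$ means $\iota_{U,K,*}(x_U)$. For each $v$, $\mathfrak H_v$ is a finite $\mathbb Z_p$-linear combination of characteristic functions of double cosets in $K_v\backslash G_v/K_v$. For disjoint $\mu,\nu\in\mathcal N$, $\mathfrak H_{\mu,*}:M(K[\nu])\to M(K[\nu])$ is the composition over $v\in\mu$ of the (commuting) operators $\sum_\sigma c_\sigma[K[\nu]\sigma K[\nu]]_*$ where $\mathfrak H_v=\sum_\sigma c_\sigma\mathrm{ch}(K_v\sigma K_v)$ and $\sigma\in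 G_v\subset G$. Elements $g_{v,1},\dots,g_{v,r_v}\in G_v$ form a fixed set of representatives of $H_v\backslash H_v\cdot\mathrm{supp}(\mathfrak H_v)/K_v$; $H_{v,i}=H_v\cap g_{v,i}K_vg_{v,i}^{-1}$, $V_{v,i}=H_v\cap g_{v,i}L_vg_{v,i}^{-1}\subset H_{v,i}$. The function $\mathfrak h_{v,i}:H_v\to\mathbb Z_p$, $h\mapsto\mathfrak H_v(hg_{v,i})$ is a finite combination of characteristic functions $\mathrm{ch}(U_vhH_{v,i})$, and $\mathfrak h_{v,i,*}:N_v(U_v)\to N_v(H_{v,i})$ is the corresponding combination of the maps $[U_vhH_{v,i}]_*=[H_{v,i}h^{-1}U_v]$. **Restricted tensor product.** $N=\otimes'_vN_v$ means: for each $v$ there is a CoMack functor $N_v$ on $(H_v,\Upsilon_{H_v})$ with values in $\mathbb Z_p$-modules and an element $x_{U_v}\in N_v(U_v)$, such that for every $W=\prod_vW_v\in\Upsilon_H$ with $W_v\in\Upsilon_{H_v}$ and $W_v=U_v$ for almost all $v$, $N(W)$ is (compatibly with all the structure maps) the restricted tensor product $\otimes'_vN_v(W_v)$ over $\mathbb Z_p$ with respect to the $x_{U_v}$, i.e. $\varinjlim_\mu\bigotimes_{v\in\mu}N_v(W_v)$ over finite $\mu\subset I$ (containing the places where $W_v\ne U_v$), with transition maps $x\mapsto x\otimes\bigotimes x_{U_v}$. *)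

theory Defs
  imports
    "HOL-Analysis.Analysis"
    "HOL-Computational_Algebra.Primes"
    "HOL-Algebra.AbelCoset"
    "HOL-Algebra.Module"
begin

section \<open>The ring of p-adic integers\<close>

text \<open>The inverse limit of the rings of integers modulo \<open>p ^ n\<close>: coherent sequences of
  least non-negative residues.\<close>

definition Zp :: "nat \<Rightarrow> (nat \<Rightarrow> int) ring" where
  "Zp p = \<lparr>carrier = {x. \<forall>n. x n \<in> {0..<int p ^ n} \<and> x (Suc n) mod int p ^ n = x n},
     mult = (\<lambda>x y n. x n * y n mod int p ^ n),
     one = (\<lambda>n. 1 mod int p ^ n),
     zero = (\<lambda>n. 0),
     add = (\<lambda>x y n. (x n + y n) mod int p ^ n)\<rparr>"

lemma cring_Zp:
  assumes "p > 0"
  shows "cring (Zp p)"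
proof -
  have pos: "int p ^ n > 0" for n
    using assms by simp
  have coh: "a mod int p ^ Suc n mod int p ^ n = a mod int p ^ n" for a n
    by (rule mod_mod_cancel) simp
  have add_closed: "(\<lambda>n. (x n + y n) mod int p ^ n) \<in> carrier (Zp p)"
    if "x \<in> carrier (Zp p)" "y \<in> carrier (Zp p)" for x y
  proof -
    have "(x (Suc n) + y (Suc n)) mod int p ^ Suc n mod int p ^ n = (x n + y n) mod int p ^ n" for n
      using that unfolding coh by (simp add: Zp_def) (metis mod_add_eq)
    then show ?thesis
      using pos by (simp add: Zp_def del: power_Suc)
  qed
  have mult_closed: "(\<lambda>n. (x n * y n) mod int p ^ n) \<in> carrier (Zp p)"
    if "x \<in> carrier (Zp p)" "y \<in> carrier (Zp p)" for x y
  proof -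
    have "(x (Suc n) * y (Suc n)) mod int p ^ Suc n mod int p ^ n = (x n * y n) mod int p ^ n" for n
      using that unfolding coh by (simp add: Zp_def) (metis mod_mult_eq)
    then show ?thesis
      using pos by (simp add: Zp_def del: power_Suc)
  qed
  have one_closed: "(\<lambda>n. 1 mod int p ^ n) \<in> carrier (Zp p)"
    using pos coh by (simp add: Zp_def del: power_Suc)
  have neg: "(\<lambda>n. (- x n) mod int p ^ n) \<in> carrier (Zp p)" if "x \<in> carrier (Zp p)" for x
  proof -
    have "(- x (Suc n)) mod int p ^ Suc n mod int p ^ n = (- x n) mod int p ^ n" for n
      using that unfolding coh by (simp add: Zp_def) (metis mod_minus_eq)
    then show ?thesis
      using pos by (simp add: Zp_def del: power_Suc)
  qed
  show ?thesis
  proof (rule cringI)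
    show "abelian_group (Zp p)"
    proof (rule abelian_groupI)
      fix x y assume "x \<in> carrier (Zp p)" "y \<in> carrier (Zp p)"
      then show "x \<oplus>\<^bsub>Zp p\<^esub> y \<in> carrier (Zp p)"
        using add_closed[of x y] by (simp add: Zp_def)
    next
      show "\<zero>\<^bsub>Zp p\<^esub> \<in> carrier (Zp p)"
        using pos by (simp add: Zp_def)
    next
      fix x assume "x \<in> carrier (Zp p)"
      then show "\<exists>y\<in>carrier (Zp p). y \<oplus>\<^bsub>Zp p\<^esub> x = \<zero>\<^bsub>Zp p\<^esub>"
        using neg[of x] by (intro bexI[of _ "\<lambda>n. (- x n) mod int p ^ n"])
          (auto simp: Zp_def mod_simps)
    qed (auto simp: Zp_def mod_simps ac_simps fun_eq_iff)
    show "Group.comm_monoid (Zp p)"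
    proof (rule comm_monoidI)
      fix x y assume "x \<in> carrier (Zp p)" "y \<in> carrier (Zp p)"
      then show "x \<otimes>\<^bsub>Zp p\<^esub> y \<in> carrier (Zp p)"
        using mult_closed[of x y] by (simp add: Zp_def)
    next
      show "\<one>\<^bsub>Zp p\<^esub> \<in> carrier (Zp p)"
        using one_closed by (simp add: Zp_def)
    qed (auto simp: Zp_def mod_simps ac_simps fun_eq_iff)
  qed (auto simp: Zp_def mod_simps distrib_right fun_eq_iff)
qed


section \<open>Modules: homomorphisms, quotients, tensor products, direct limits\<close>

definition mod_hom :: "('r, 'c) ring_scheme \<Rightarrow> ('r, 'm) module \<Rightarrow> ('r, 'n) module \<Rightarrow> ('m \<Rightarrow> 'n) set" where
  "mod_hom R M N = {f \<in> carrier M \<rightarrow> carrier N.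
     (\<forall>x\<in>carrier M. \<forall>y\<in>carrier M. f (x \<oplus>\<^bsub>M\<^esub> y) = f x \<oplus>\<^bsub>N\<^esub> f y) \<and>
     (\<forall>a\<in>carrier R. \<forall>x\<in>carrier M. f (a \<odot>\<^bsub>M\<^esub> x) = a \<odot>\<^bsub>N\<^esub> f x)}"

definition mod_iso :: "('r, 'c) ring_scheme \<Rightarrow> ('r, 'm) module \<Rightarrow> ('r, 'n) module \<Rightarrow> ('m \<Rightarrow> 'n) set" where
  "mod_iso R M N = {f \<in> mod_hom R M N. bij_betw f (carrier M) (carrier N)}"

definition submod_gen :: "('r, 'c) ring_scheme \<Rightarrow> ('r, 'm) module \<Rightarrow> 'm set \<Rightarrow> 'm set" where
  "submod_gen R M X = \<Inter>{S. submodule S R M \<and> X \<subseteq> S}"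

text \<open>The record type of modules extends that of rings; the ring multiplication and unit are
  not used by the module axioms and are left unspecified below.\<close>

definition quot_mod :: "('r, 'm) module \<Rightarrow> 'm set \<Rightarrow> ('r, 'm set) module" where
  "quot_mod M S = \<lparr>carrier = a_rcosets\<^bsub>M\<^esub> S, mult = undefined, one = undefined,
     zero = S,
     add = (\<lambda>C D. C <+>\<^bsub>M\<^esub> D),
     smult = (\<lambda>a C. \<Union>c\<in>C. S +>\<^bsub>M\<^esub> (a \<odot>\<^bsub>M\<^esub> c))\<rparr>"

definition free_mod :: "('r, 'c) ring_scheme \<Rightarrow> 's set \<Rightarrow> ('r, 's \<Rightarrow> 'r) module" where
  "free_mod R S = \<lparr>carrier = {f \<in> S \<rightarrow>\<^sub>E carrier R. finite {s\<in>S. f s \<noteq> \<zero>\<^bsub>R\<^esub>}},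
     mult = undefined, one = undefined,
     zero = (\<lambda>s\<in>S. \<zero>\<^bsub>R\<^esub>),
     add = (\<lambda>f h. \<lambda>s\<in>S. f s \<oplus>\<^bsub>R\<^esub> h s),
     smult = (\<lambda>a f. \<lambda>s\<in>S. a \<otimes>\<^bsub>R\<^esub> f s)\<rparr>"

definition free_basis :: "('r, 'c) ring_scheme \<Rightarrow> 's set \<Rightarrow> 's \<Rightarrow> 's \<Rightarrow> 'r" where
  "free_basis R S x = (\<lambda>s\<in>S. if s = x then \<one>\<^bsub>R\<^esub> else \<zero>\<^bsub>R\<^esub>)"

abbreviation fam :: "'v set \<Rightarrow> ('v \<Rightarrow> ('r, 'a) module) \<Rightarrow> ('v \<Rightarrow> 'a) set" where
  "fam \<mu> A \<equiv> (\<Pi>\<^sub>E v\<in>\<mu>. carrier (A v))"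

text \<open>The tensor product over \<open>R\<close> of a family of modules \<open>A v\<close>, \<open>v \<in> \<mu>\<close>: the free module on the
  product of the carriers modulo the relations of linearity in each variable.\<close>

definition tensor_rels ::
  "('r, 'c) ring_scheme \<Rightarrow> 'v set \<Rightarrow> ('v \<Rightarrow> ('r, 'a) module) \<Rightarrow> (('v \<Rightarrow> 'a) \<Rightarrow> 'r) set" where
  "tensor_rels R \<mu> A =
     (let S = fam \<mu> A; F = free_mod R S; b = free_basis R S in
       submod_gen R F
        ({b (x(v := c \<oplus>\<^bsub>A v\<^esub> d)) \<ominus>\<^bsub>F\<^esub> (b (x(v := c)) \<oplus>\<^bsub>F\<^esub> b (x(v := d))) | x v c d.
            x \<in> S \<and> v \<in> \<mu> \<and> c \<in> carrier (A v) \<and> d \<in> carrier (A v)} \<union>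
         {b (x(v := a \<odot>\<^bsub>A v\<^esub> c)) \<ominus>\<^bsub>F\<^esub> (a \<odot>\<^bsub>F\<^esub> b (x(v := c))) | x v a c.
            x \<in> S \<and> v \<in> \<mu> \<and> a \<in> carrier R \<and> c \<in> carrier (A v)}))"

definition tensor ::
  "('r, 'c) ring_scheme \<Rightarrow> 'v set \<Rightarrow> ('v \<Rightarrow> ('r, 'a) module) \<Rightarrow> ('r, (('v \<Rightarrow> 'a) \<Rightarrow> 'r) set) module" where
  "tensor R \<mu> A = quot_mod (free_mod R (fam \<mu> A)) (tensor_rels R \<mu> A)"

definition tensor_pure ::
  "('r, 'c) ring_scheme \<Rightarrow> 'v set \<Rightarrow> ('v \<Rightarrow> ('r, 'a) module) \<Rightarrow> ('v \<Rightarrow> 'a) \<Rightarrow> (('v \<Rightarrow> 'a) \<Rightarrow> 'r) set" where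
  "tensor_pure R \<mu> A x = tensor_rels R \<mu> A +>\<^bsub>free_mod R (fam \<mu> A)\<^esub> free_basis R (fam \<mu> A) x"

text \<open>For \<open>\<mu> \<subseteq> \<mu>'\<close>, the map between tensor products that tensors with the vectors \<open>e v\<close>,
  \<open>v \<in> \<mu>' - \<mu>\<close>. It is induced by the map of free modules sending the basis vector of a family \<open>x\<close>
  on \<open>\<mu>\<close> to that of its extension by \<open>e\<close> to \<open>\<mu>'\<close>; the latter map is extension by zero along an
  injection of bases, which is the formula used here.\<close>

definition tensor_ext ::
  "('r, 'c) ring_scheme \<Rightarrow> ('v \<Rightarrow> ('r, 'a) module) \<Rightarrow> ('v \<Rightarrow> 'a) \<Rightarrow> 'v set \<Rightarrow> 'v set \<Rightarrow>
     (('v \<Rightarrow> 'a) \<Rightarrow> 'r) set \<Rightarrow> (('v \<Rightarrow> 'a) \<Rightarrow> 'r) set" where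
  "tensor_ext R A e \<mu> \<mu>' C =
     (\<Union>f\<in>C. tensor_rels R \<mu>' A +>\<^bsub>free_mod R (fam \<mu>' A)\<^esub>
        (\<lambda>s \<in> fam \<mu>' A. if \<forall>v\<in>\<mu>' - \<mu>. s v = e v then f (restrict s \<mu>) else \<zero>\<^bsub>R\<^esub>))"

text \<open>The direct limit of a directed system: the disjoint union modulo eventual equality.\<close>

definition dirlim_class ::
  "('i::order) set \<Rightarrow> ('i \<Rightarrow> ('r, 'a) module) \<Rightarrow> ('i \<Rightarrow> 'i \<Rightarrow> 'a \<Rightarrow> 'a) \<Rightarrow> 'i \<Rightarrow> 'a \<Rightarrow> ('i \<times> 'a) set" where
  "dirlim_class D A \<phi> i a =
     {(j, b). j \<in> D \<and> b \<in> carrier (A j) \<and> (\<exists>k\<in>D. i \<le> k \<and> j \<le> k \<and> \<phi> i k a = \<phi> j k b)}"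

definition dirlim ::
  "('i::order) set \<Rightarrow> ('i \<Rightarrow> ('r, 'a) module) \<Rightarrow> ('i \<Rightarrow> 'i \<Rightarrow> 'a \<Rightarrow> 'a) \<Rightarrow> ('r, ('i \<times> 'a) set) module" where
  "dirlim D A \<phi> = \<lparr>carrier = {dirlim_class D A \<phi> i a | i a. i \<in> D \<and> a \<in> carrier (A i)},
     mult = undefined, one = undefined,
     zero = {(j, b). j \<in> D \<and> b \<in> carrier (A j) \<and> (\<exists>k\<in>D. j \<le> k \<and> \<phi> j k b = \<zero>\<^bsub>A k\<^esub>)},
     add = (\<lambda>X Y. \<Union>(i, a)\<in>X. \<Union>(j, b)\<in>Y. \<Union>k\<in>{k\<in>D. i \<le> k \<and> j \<le> k}.
              dirlim_class D A \<phi> k (\<phi> i k a \<oplus>\<^bsub>A k\<^esub> \<phi> j k b)),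
     smult = (\<lambda>r X. \<Union>(i, a)\<in>X. dirlim_class D A \<phi> i (r \<odot>\<^bsub>A i\<^esub> a))\<rparr>"

text \<open>The restricted tensor product of the \<open>A v\<close>, \<open>v \<in> I\<close>, with respect to vectors \<open>e v \<in> A v\<close> which
  need only be given for \<open>v\<close> outside the finite set \<open>B\<close>.\<close>

definition fin_above :: "'v set \<Rightarrow> 'v set \<Rightarrow> 'v set set" where
  "fin_above I B = {\<mu>. finite \<mu> \<and> B \<subseteq> \<mu> \<and> \<mu> \<subseteq> I}"

definition rtensor ::
  "('r, 'c) ring_scheme \<Rightarrow> 'v set \<Rightarrow> 'v set \<Rightarrow> ('v \<Rightarrow> ('r, 'a) module) \<Rightarrow> ('v \<Rightarrow> 'a) \<Rightarrow>
     ('r, ('v set \<times> (('v \<Rightarrow> 'a) \<Rightarrow> 'r) set) set) module" where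
  "rtensor R I B A e = dirlim (fin_above I B) (\<lambda>\<mu>. tensor R \<mu> A) (tensor_ext R A e)"

definition rfam :: "'v set \<Rightarrow> ('v \<Rightarrow> ('r, 'a) module) \<Rightarrow> ('v \<Rightarrow> 'a) \<Rightarrow> ('v \<Rightarrow> 'a) set" where
  "rfam I A e = {x \<in> fam I A. finite {v\<in>I. x v \<noteq> e v}}"

text \<open>The class of the pure tensor of a family \<open>x\<close> which equals \<open>e\<close> almost everywhere.\<close>

definition rtensor_pure ::
  "('r, 'c) ring_scheme \<Rightarrow> 'v set \<Rightarrow> 'v set \<Rightarrow> ('v \<Rightarrow> ('r, 'a) module) \<Rightarrow> ('v \<Rightarrow> 'a) \<Rightarrow> ('v \<Rightarrow> 'a) \<Rightarrow>
     ('v set \<times> (('v \<Rightarrow> 'a) \<Rightarrow> 'r) set) set" where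
  "rtensor_pure R I B A e x =
     (let \<mu> = B \<union> {v\<in>I. x v \<noteq> e v} in
       dirlim_class (fin_above I B) (\<lambda>\<mu>. tensor R \<mu> A) (tensor_ext R A e) \<mu>
         (tensor_pure R \<mu> A (restrict x \<mu>)))"


section \<open>Locally profinite groups\<close>

locale topological_group = Group.group G for G :: "('g, 'b) monoid_scheme" (structure) +
  fixes T :: "'g topology"
  assumes topspace_eq: "topspace T = carrier G"
    and continuous_mult: "continuous_map (prod_topology T T) T (\<lambda>(x, y). x \<otimes> y)"
    and continuous_inv: "continuous_map T T (\<lambda>x. inv x)"

definition compact_open_subgroup :: "('g, 'b) monoid_scheme \<Rightarrow> 'g topology \<Rightarrow> 'g set \<Rightarrow> bool" where
  "compact_open_subgroup G T K \<longleftrightarrow> subgroup K G \<and> openin T K \<and> compactin T K"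

locale locally_profinite = topological_group +
  assumes Hausdorff: "Hausdorff_space T"
    and small_subgroups:
      "openin T V \<Longrightarrow> \<one> \<in> V \<Longrightarrow> \<exists>K\<subseteq>V. compact_open_subgroup G T K"

definition left_Haar_measure :: "('g, 'b) monoid_scheme \<Rightarrow> 'g topology \<Rightarrow> 'g measure \<Rightarrow> bool" where
  "left_Haar_measure G T \<mu> \<longleftrightarrow>
     space \<mu> = carrier G \<and> sets \<mu> = sigma_sets (carrier G) {V. openin T V} \<and>
     emeasure \<mu> (carrier G) \<noteq> 0 \<and>
     (\<forall>C. compactin T C \<longrightarrow> emeasure \<mu> C < \<infinity>) \<and>
     (\<forall>A\<in>sets \<mu>. emeasure \<mu> A = (INF V\<in>{V. openin T V \<and> A \<subseteq> V}. emeasure \<mu> V)) \<and>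
     (\<forall>V. openin T V \<longrightarrow> emeasure \<mu> V = (SUP C\<in>{C. compactin T C \<and> C \<subseteq> V}. emeasure \<mu> C)) \<and>
     (\<forall>g\<in>carrier G. \<forall>A\<in>sets \<mu>. emeasure \<mu> (g <#\<^bsub>G\<^esub> A) = emeasure \<mu> A)"

definition unimodular :: "('g, 'b) monoid_scheme \<Rightarrow> 'g topology \<Rightarrow> bool" where
  "unimodular G T \<longleftrightarrow> (\<exists>\<mu>. left_Haar_measure G T \<mu> \<and>
     (\<forall>g\<in>carrier G. \<forall>A\<in>sets \<mu>. emeasure \<mu> (A #>\<^bsub>G\<^esub> g) = emeasure \<mu> A))"

definition conj_by :: "('g, 'b) monoid_scheme \<Rightarrow> 'g \<Rightarrow> 'g set \<Rightarrow> 'g set" where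
  "conj_by G g A = g <#\<^bsub>G\<^esub> A #>\<^bsub>G\<^esub> inv\<^bsub>G\<^esub> g"

definition dcoset :: "('g, 'b) monoid_scheme \<Rightarrow> 'g set \<Rightarrow> 'g \<Rightarrow> 'g set \<Rightarrow> 'g set" where
  "dcoset G A g B = A <#>\<^bsub>G\<^esub> {g} <#>\<^bsub>G\<^esub> B"

text \<open>\<open>S\<close> is a set of representatives of \<open>A \ X / B\<close>, where \<open>X\<close> is a union of double cosets.\<close>

definition dcoset_reps ::
  "('g, 'b) monoid_scheme \<Rightarrow> 'g set \<Rightarrow> 'g set \<Rightarrow> 'g set \<Rightarrow> 'g set \<Rightarrow> bool" where
  "dcoset_reps G A X B S \<longleftrightarrow> S \<subseteq> X \<and> (\<forall>x\<in>X. \<exists>!s. s \<in> S \<and> x \<in> dcoset G A s B)"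


section \<open>RIC functors\<close>

text \<open>The morphisms from \<open>L\<close> to \<open>K\<close> in the category \<open>P(G, \<Upsilon>)\<close>.\<close>

definition Hom_P :: "('g, 'b) monoid_scheme \<Rightarrow> 'g set \<Rightarrow> 'g set \<Rightarrow> 'g set" where
  "Hom_P G L K = {g \<in> carrier G. conj_by G (inv\<^bsub>G\<^esub> g) L \<subseteq> K}"

locale level_structure = Group.group G for G :: "('g, 'b) monoid_scheme" (structure) +
  fixes T :: "'g topology" and \<Upsilon> :: "'g set set"
  assumes nonempty: "\<Upsilon> \<noteq> {}"
    and compact_open: "K \<in> \<Upsilon> \<Longrightarrow> compact_open_subgroup G T K"
    and T1: "K \<in> \<Upsilon> \<Longrightarrow> g \<in> carrier G \<Longrightarrow> conj_by G g K \<in> \<Upsilon>"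
    and T2: "K \<in> \<Upsilon> \<Longrightarrow> L \<in> \<Upsilon> \<Longrightarrow> \<exists>K'\<in>\<Upsilon>. K' \<lhd> G\<lparr>carrier := K\<rparr> \<and> K' \<subseteq> L"
    and T3: "K \<in> \<Upsilon> \<Longrightarrow> L \<in> \<Upsilon> \<Longrightarrow> K \<inter> L \<in> \<Upsilon>"

text \<open>\<open>push M L K g\<close> is \<open>[g]\<^sub>*\<close> from \<open>M(L)\<close> to \<open>M(K)\<close> and \<open>pull M L K g\<close> is \<open>[g]\<^sup>*\<close> from \<open>M(K)\<close>
  to \<open>M(L)\<close>, for \<open>g\<close> a morphism from \<open>L\<close> to \<open>K\<close>.\<close>

record ('g, 'r, 'm) ric_data =
  obj :: "'g set \<Rightarrow> ('r, 'm) module"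
  push :: "'g set \<Rightarrow> 'g set \<Rightarrow> 'g \<Rightarrow> 'm \<Rightarrow> 'm"
  pull :: "'g set \<Rightarrow> 'g set \<Rightarrow> 'g \<Rightarrow> 'm \<Rightarrow> 'm"

locale ric_functor = level_structure +
  fixes R :: "('r, 'c) ring_scheme" and M :: "('a, 'r, 'm) ric_data"
  assumes module_obj: "K \<in> \<Upsilon> \<Longrightarrow> Module.module R (obj M K)"
    and push_hom: "L \<in> \<Upsilon> \<Longrightarrow> K \<in> \<Upsilon> \<Longrightarrow> g \<in> Hom_P G L K \<Longrightarrow>
      push M L K g \<in> mod_hom R (obj M L) (obj M K)"
    and pull_hom: "L \<in> \<Upsilon> \<Longrightarrow> K \<in> \<Upsilon> \<Longrightarrow> g \<in> Hom_P G L K \<Longrightarrow>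
      pull M L K g \<in> mod_hom R (obj M K) (obj M L)"
    and push_one: "K \<in> \<Upsilon> \<Longrightarrow> x \<in> carrier (obj M K) \<Longrightarrow> push M K K \<one> x = x"
    and pull_one: "K \<in> \<Upsilon> \<Longrightarrow> x \<in> carrier (obj M K) \<Longrightarrow> pull M K K \<one> x = x"
    and push_comp: "L' \<in> \<Upsilon> \<Longrightarrow> L \<in> \<Upsilon> \<Longrightarrow> K \<in> \<Upsilon> \<Longrightarrow> h \<in> Hom_P G L' L \<Longrightarrow> g \<in> Hom_P G L K \<Longrightarrow>
      x \<in> carrier (obj M L') \<Longrightarrow> push M L' K (h \<otimes> g) x = push M L K g (push M L' L h x)"
    and pull_comp: "L' \<in> \<Upsilon> \<Longrightarrow> L \<in> \<Upsilon> \<Longrightarrow> K \<in> \<Upsilon> \<Longrightarrow> h \<in> Hom_P G L' L \<Longrightarrow> g \<in> Hom_P G L K \<Longrightarrow>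
      x \<in> carrier (obj M K) \<Longrightarrow> pull M L' K (h \<otimes> g) x = pull M L' L h (pull M L K g x)"
    and pull_eq_push_inv: "L \<in> \<Upsilon> \<Longrightarrow> K \<in> \<Upsilon> \<Longrightarrow> g \<in> carrier G \<Longrightarrow> conj_by G (inv g) L = K \<Longrightarrow>
      x \<in> carrier (obj M K) \<Longrightarrow> pull M L K g x = push M K L (inv g) x"
    and push_inner: "K \<in> \<Upsilon> \<Longrightarrow> \<gamma> \<in> K \<Longrightarrow> x \<in> carrier (obj M K) \<Longrightarrow> push M K K \<gamma> x = x"

text \<open>In the Mackey relations the summands do not depend on the choice of the representatives
  \<open>\<Gamma>\<close>, which are finite in number because the subgroups are compact and open.\<close>

locale comack_functor = ric_functor +
  assumes cohomological: "L \<in> \<Upsilon> \<Longrightarrow> K \<in> \<Upsilon> \<Longrightarrow> L \<subseteq> K \<Longrightarrow> x \<in> carrier (obj M K) \<Longrightarrow>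
      push M L K \<one> (pull M L K \<one> x) = [card (rcosets\<^bsub>G\<lparr>carrier := K\<rparr>\<^esub> L)] \<cdot>\<^bsub>obj M K\<^esub> x"
    and mackey: "L \<in> \<Upsilon> \<Longrightarrow> L' \<in> \<Upsilon> \<Longrightarrow> K \<in> \<Upsilon> \<Longrightarrow> L \<subseteq> K \<Longrightarrow> L' \<subseteq> K \<Longrightarrow>
      dcoset_reps G L K L' \<Gamma> \<Longrightarrow> x \<in> carrier (obj M L') \<Longrightarrow>
      pull M L K \<one> (push M L' K \<one> x) =
        (\<Oplus>\<^bsub>obj M L\<^esub> \<gamma>\<in>\<Gamma>. push M (L \<inter> conj_by G \<gamma> L') L \<one> (pull M (L \<inter> conj_by G \<gamma> L') L' \<gamma> x))"

text \<open>\<open>H\<close> is the underlying set of a closed subgroup of \<open>G\<close>, and \<open>\<iota> V K\<close> is the map from \<open>N(V)\<close> to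
  \<open>M(K)\<close>.\<close>

locale mackey_pushforward = Group.group G for G :: "('g, 'b) monoid_scheme" (structure) +
  fixes T :: "'g topology" and \<Upsilon>\<^sub>G :: "'g set set" and H :: "'g set" and \<Upsilon>\<^sub>H :: "'g set set"
    and R :: "('r, 'c) ring_scheme"
    and N :: "('g, 'r, 'n) ric_data" and M :: "('g, 'r, 'm) ric_data"
    and \<iota> :: "'g set \<Rightarrow> 'g set \<Rightarrow> 'n \<Rightarrow> 'm"
  assumes subgroup_H: "subgroup H G" and closed_H: "closedin T H"
    and levels: "(\<lambda>K. K \<inter> H) ` \<Upsilon>\<^sub>G \<subseteq> \<Upsilon>\<^sub>H"
    and hom: "V \<in> \<Upsilon>\<^sub>H \<Longrightarrow> K \<in> \<Upsilon>\<^sub>G \<Longrightarrow> V \<subseteq> K \<Longrightarrow> \<iota> V K \<in> mod_hom R (obj N V) (obj M K)"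
    and push: "V \<in> \<Upsilon>\<^sub>H \<Longrightarrow> V' \<in> \<Upsilon>\<^sub>H \<Longrightarrow> K \<in> \<Upsilon>\<^sub>G \<Longrightarrow> L' \<in> \<Upsilon>\<^sub>G \<Longrightarrow> V \<subseteq> K \<Longrightarrow> V' \<subseteq> L' \<Longrightarrow> h \<in> H \<Longrightarrow>
      conj_by G (inv h) V' \<subseteq> V \<Longrightarrow> conj_by G (inv h) L' \<subseteq> K \<Longrightarrow> x \<in> carrier (obj N V') \<Longrightarrow>
      \<iota> V K (push N V' V h x) = push M L' K h (\<iota> V' L' x)"
    and mackey: "V \<in> \<Upsilon>\<^sub>H \<Longrightarrow> K \<in> \<Upsilon>\<^sub>G \<Longrightarrow> L \<in> \<Upsilon>\<^sub>G \<Longrightarrow> V \<subseteq> K \<Longrightarrow> L \<subseteq> K \<Longrightarrow>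
      dcoset_reps G V K L \<Gamma> \<Longrightarrow> x \<in> carrier (obj N V) \<Longrightarrow>
      pull M L K \<one> (\<iota> V K x) =
        (\<Oplus>\<^bsub>obj M L\<^esub> \<gamma>\<in>\<Gamma>. push M (conj_by G \<gamma> L) L \<gamma>
           (\<iota> (V \<inter> conj_by G \<gamma> L) (conj_by G \<gamma> L) (pull N (V \<inter> conj_by G \<gamma> L) V \<one> x)))"


section \<open>Hecke correspondences\<close>

text \<open>\<open>hecke G M K' \<sigma> K\<close> is \<open>[K'\<sigma>K]\<close> from \<open>M(K)\<close> to \<open>M(K')\<close>, and \<open>hecke_push G M K' \<sigma> K\<close> is
  \<open>[K'\<sigma>K]\<^sub>*\<close> from \<open>M(K')\<close> to \<open>M(K)\<close>.\<close>

definition hecke ::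
  "('g, 'b) monoid_scheme \<Rightarrow> ('g, 'r, 'm) ric_data \<Rightarrow> 'g set \<Rightarrow> 'g \<Rightarrow> 'g set \<Rightarrow> 'm \<Rightarrow> 'm" where
  "hecke G M K' \<sigma> K x =
     push M (K' \<inter> conj_by G \<sigma> K) K' \<one>\<^bsub>G\<^esub>
       (pull M (K' \<inter> conj_by G \<sigma> K) (K \<inter> conj_by G (inv\<^bsub>G\<^esub> \<sigma>) K') \<sigma>
         (pull M (K \<inter> conj_by G (inv\<^bsub>G\<^esub> \<sigma>) K') K \<one>\<^bsub>G\<^esub> x))"

definition hecke_push ::
  "('g, 'b) monoid_scheme \<Rightarrow> ('g, 'r, 'm) ric_data \<Rightarrow> 'g set \<Rightarrow> 'g \<Rightarrow> 'g set \<Rightarrow> 'm \<Rightarrow> 'm" where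
  "hecke_push G M K' \<sigma> K = hecke G M K (inv\<^bsub>G\<^esub> \<sigma>) K'"

definition supp :: "('g, 'b) monoid_scheme \<Rightarrow> ('r, 'c) ring_scheme \<Rightarrow> ('g \<Rightarrow> 'r) \<Rightarrow> 'g set" where
  "supp G R f = {g \<in> carrier G. f g \<noteq> \<zero>\<^bsub>R\<^esub>}"

text \<open>Finite \<open>R\<close>-linear combinations of characteristic functions of double cosets \<open>A\<sigma>B\<close>.\<close>

definition hecke_fun ::
  "('g, 'b) monoid_scheme \<Rightarrow> ('r, 'c) ring_scheme \<Rightarrow> 'g set \<Rightarrow> 'g set \<Rightarrow> ('g \<Rightarrow> 'r) \<Rightarrow> bool" where
  "hecke_fun G R A B f \<longleftrightarrow>
     (\<exists>S c. finite S \<and> S \<subseteq> carrier G \<and> c \<in> S \<rightarrow> carrier R \<and>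
       (\<forall>g\<in>carrier G. f g = (\<Oplus>\<^bsub>R\<^esub> \<sigma>\<in>S. if g \<in> dcoset G A \<sigma> B then c \<sigma> else \<zero>\<^bsub>R\<^esub>)))"

text \<open>With \<open>S = hecke_reps G R A B f\<close>, such an \<open>f\<close> is the sum of \<open>f \<sigma>\<close> times the characteristic
  function of \<open>A\<sigma>B\<close> over \<open>\<sigma> \<in> S\<close>. The operators attached to \<open>f\<close> through this expansion do not depend
  on the choice of representatives, as \<open>[A\<sigma>B]\<^sub>*\<close> depends only on \<open>A\<sigma>B\<close>.\<close>

definition hecke_reps ::
  "('g, 'b) monoid_scheme \<Rightarrow> ('r, 'c) ring_scheme \<Rightarrow> 'g set \<Rightarrow> 'g set \<Rightarrow> ('g \<Rightarrow> 'r) \<Rightarrow> 'g set" where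
  "hecke_reps G R A B f = (SOME S. dcoset_reps G A (supp G R f) B S)"

definition hecke_fun_push ::
  "('g, 'b) monoid_scheme \<Rightarrow> ('r, 'c) ring_scheme \<Rightarrow> ('g, 'r, 'm) ric_data \<Rightarrow>
     'g set \<Rightarrow> 'g set \<Rightarrow> ('g \<Rightarrow> 'r) \<Rightarrow> 'm \<Rightarrow> 'm" where
  "hecke_fun_push G R M A B f x =
     (\<Oplus>\<^bsub>obj M B\<^esub> \<sigma>\<in>hecke_reps G R A B f. f \<sigma> \<odot>\<^bsub>obj M B\<^esub> hecke_push G M A \<sigma> B x)"


section \<open>Restricted products\<close>

definition rprod :: "'v set \<Rightarrow> ('v \<Rightarrow> 'g monoid) \<Rightarrow> ('v \<Rightarrow> 'g set) \<Rightarrow> ('v \<Rightarrow> 'g) monoid" where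
  "rprod I G K = \<lparr>carrier = {x \<in> (\<Pi>\<^sub>E v\<in>I. carrier (G v)). finite {v\<in>I. x v \<notin> K v}},
     mult = (\<lambda>x y. \<lambda>v\<in>I. x v \<otimes>\<^bsub>G v\<^esub> y v),
     one = (\<lambda>v\<in>I. \<one>\<^bsub>G v\<^esub>)\<rparr>"

definition rprod_topology ::
  "'v set \<Rightarrow> ('v \<Rightarrow> 'g topology) \<Rightarrow> ('v \<Rightarrow> 'g set) \<Rightarrow> ('v \<Rightarrow> 'g) topology" where
  "rprod_topology I T K = topology_generated_by
     {\<Pi>\<^sub>E v\<in>I. V v | V. (\<forall>v\<in>I. openin (T v) (V v)) \<and> finite {v\<in>I. V v \<noteq> K v}}"

definition place_incl :: "'v set \<Rightarrow> ('v \<Rightarrow> 'g monoid) \<Rightarrow> 'v \<Rightarrow> 'g \<Rightarrow> 'v \<Rightarrow> 'g" where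
  "place_incl I G v \<sigma> = (\<lambda>w\<in>I. if w = v then \<sigma> else \<one>\<^bsub>G w\<^esub>)"

text \<open>The level \<open>K[\<nu>]\<close>.\<close>

definition level :: "'v set \<Rightarrow> ('v \<Rightarrow> 'g set) \<Rightarrow> ('v \<Rightarrow> 'g set) \<Rightarrow> 'v set \<Rightarrow> ('v \<Rightarrow> 'g) set" where
  "level I K L \<nu> = (\<Pi>\<^sub>E v\<in>I. if v \<in> \<nu> then L v else K v)"

definition local_levels :: "'g monoid \<Rightarrow> 'g set \<Rightarrow> 'g set \<Rightarrow> 'g set set" where
  "local_levels G K L = {\<Inter>F | F. finite F \<and> F \<noteq> {} \<and>
     F \<subseteq> {conj_by G g A | g A. g \<in> carrier G \<and> A \<in> {K, L}}}"

text \<open>The operator on \<open>M(K')\<close> attached to a function \<open>f\<close> on \<open>G v\<close>, for a level \<open>K'\<close> whose component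
  at \<open>v\<close> is \<open>K v\<close>.\<close>

definition hecke_place ::
  "'v set \<Rightarrow> ('v \<Rightarrow> 'g monoid) \<Rightarrow> ('v \<Rightarrow> 'g set) \<Rightarrow> ('r, 'c) ring_scheme \<Rightarrow>
     ('v \<Rightarrow> 'g, 'r, 'm) ric_data \<Rightarrow> ('v \<Rightarrow> 'g) set \<Rightarrow> 'v \<Rightarrow> ('g \<Rightarrow> 'r) \<Rightarrow> 'm \<Rightarrow> 'm" where
  "hecke_place I G K R M K' v f y =
     (\<Oplus>\<^bsub>obj M K'\<^esub> \<sigma>\<in>hecke_reps (G v) R (K v) (K v) f.
        f \<sigma> \<odot>\<^bsub>obj M K'\<^esub> hecke_push (rprod I G K) M K' (place_incl I G v \<sigma>) K' y)"


section \<open>Restricted tensor products of functors\<close>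

text \<open>Families of local levels whose product is a level of the restricted product.\<close>

definition product_levels ::
  "'v set \<Rightarrow> ('v \<Rightarrow> 'g set) \<Rightarrow> ('v \<Rightarrow> 'g set set) \<Rightarrow> ('v \<Rightarrow> 'g) set set \<Rightarrow> ('v \<Rightarrow> 'g set) set" where
  "product_levels I U \<Upsilon>\<^sub>l\<^sub>o\<^sub>c \<Upsilon> =
     {W \<in> (\<Pi>\<^sub>E v\<in>I. \<Upsilon>\<^sub>l\<^sub>o\<^sub>c v). finite {v\<in>I. W v \<noteq> U v} \<and> (\<Pi>\<^sub>E v\<in>I. W v) \<in> \<Upsilon>}"

abbreviation functor_tensor ::
  "('r, 'c) ring_scheme \<Rightarrow> 'v set \<Rightarrow> ('v \<Rightarrow> 'g set) \<Rightarrow> ('v \<Rightarrow> ('g, 'r, 'a) ric_data) \<Rightarrow> ('v \<Rightarrow> 'a) \<Rightarrow>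
     ('v \<Rightarrow> 'g set) \<Rightarrow> ('r, ('v set \<times> (('v \<Rightarrow> 'a) \<Rightarrow> 'r) set) set) module" where
  "functor_tensor R I U N\<^sub>l\<^sub>o\<^sub>c e W \<equiv> rtensor R I {v\<in>I. W v \<noteq> U v} (\<lambda>v. obj (N\<^sub>l\<^sub>o\<^sub>c v) (W v)) e"

abbreviation functor_tensor_pure ::
  "('r, 'c) ring_scheme \<Rightarrow> 'v set \<Rightarrow> ('v \<Rightarrow> 'g set) \<Rightarrow> ('v \<Rightarrow> ('g, 'r, 'a) ric_data) \<Rightarrow> ('v \<Rightarrow> 'a) \<Rightarrow>
     ('v \<Rightarrow> 'g set) \<Rightarrow> ('v \<Rightarrow> 'a) \<Rightarrow> ('v set \<times> (('v \<Rightarrow> 'a) \<Rightarrow> 'r) set) set" where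
  "functor_tensor_pure R I U N\<^sub>l\<^sub>o\<^sub>c e W x \<equiv>
     rtensor_pure R I {v\<in>I. W v \<noteq> U v} (\<lambda>v. obj (N\<^sub>l\<^sub>o\<^sub>c v) (W v)) e x"

text \<open>The isomorphisms \<open>\<Theta> W\<close> identify the restricted tensor product of the modules \<open>N\<^sub>l\<^sub>o\<^sub>c v (W v)\<close>
  with \<open>N(W)\<close>, compatibly with the structure maps. Pure tensors generate, so it suffices to
  state the compatibility for them.\<close>

locale restricted_tensor_functor =
  fixes R :: "('r, 'c) ring_scheme" and I :: "'v set" and H :: "'v \<Rightarrow> 'g monoid"
    and U :: "'v \<Rightarrow> 'g set" and \<Upsilon>\<^sub>l\<^sub>o\<^sub>c :: "'v \<Rightarrow> 'g set set" and \<Upsilon> :: "('v \<Rightarrow> 'g) set set"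
    and N\<^sub>l\<^sub>o\<^sub>c :: "'v \<Rightarrow> ('g, 'r, 'a) ric_data" and e :: "'v \<Rightarrow> 'a"
    and N :: "('v \<Rightarrow> 'g, 'r, 'n) ric_data"
    and \<Theta> :: "('v \<Rightarrow> 'g set) \<Rightarrow> ('v set \<times> (('v \<Rightarrow> 'a) \<Rightarrow> 'r) set) set \<Rightarrow> 'n"
  assumes vectors: "v \<in> I \<Longrightarrow> e v \<in> carrier (obj (N\<^sub>l\<^sub>o\<^sub>c v) (U v))"
    and iso: "W \<in> product_levels I U \<Upsilon>\<^sub>l\<^sub>o\<^sub>c \<Upsilon> \<Longrightarrow>
      \<Theta> W \<in> mod_iso R (functor_tensor R I U N\<^sub>l\<^sub>o\<^sub>c e W) (obj N (\<Pi>\<^sub>E v\<in>I. W v))"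
    and push_pure:
      "W \<in> product_levels I U \<Upsilon>\<^sub>l\<^sub>o\<^sub>c \<Upsilon> \<Longrightarrow> W' \<in> product_levels I U \<Upsilon>\<^sub>l\<^sub>o\<^sub>c \<Upsilon> \<Longrightarrow>
       h \<in> Hom_P (rprod I H U) (\<Pi>\<^sub>E v\<in>I. W v) (\<Pi>\<^sub>E v\<in>I. W' v) \<Longrightarrow>
       x \<in> rfam I (\<lambda>v. obj (N\<^sub>l\<^sub>o\<^sub>c v) (W v)) e \<Longrightarrow>
       push N (\<Pi>\<^sub>E v\<in>I. W v) (\<Pi>\<^sub>E v\<in>I. W' v) h (\<Theta> W (functor_tensor_pure R I U N\<^sub>l\<^sub>o\<^sub>c e W x)) =
       \<Theta> W' (functor_tensor_pure R I U N\<^sub>l\<^sub>o\<^sub>c e W'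
         (\<lambda>v\<in>I. push (N\<^sub>l\<^sub>o\<^sub>c v) (W v) (W' v) (h v) (x v)))"
    and pull_pure:
      "W \<in> product_levels I U \<Upsilon>\<^sub>l\<^sub>o\<^sub>c \<Upsilon> \<Longrightarrow> W' \<in> product_levels I U \<Upsilon>\<^sub>l\<^sub>o\<^sub>c \<Upsilon> \<Longrightarrow>
       h \<in> Hom_P (rprod I H U) (\<Pi>\<^sub>E v\<in>I. W v) (\<Pi>\<^sub>E v\<in>I. W' v) \<Longrightarrow>
       x \<in> rfam I (\<lambda>v. obj (N\<^sub>l\<^sub>o\<^sub>c v) (W' v)) e \<Longrightarrow>
       pull N (\<Pi>\<^sub>E v\<in>I. W v) (\<Pi>\<^sub>E v\<in>I. W' v) h (\<Theta> W' (functor_tensor_pure R I U N\<^sub>l\<^sub>o\<^sub>c e W' x)) =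
       \<Theta> W (functor_tensor_pure R I U N\<^sub>l\<^sub>o\<^sub>c e W
         (\<lambda>v\<in>I. pull (N\<^sub>l\<^sub>o\<^sub>c v) (W v) (W' v) (h v) (x v)))"

end

theory Submission
  imports Defs
begin

text \<open>
  For \<open>V \<subseteq> K'\<close> and \<open>x \<in> N(V)\<close> put \<open>\<Phi>(d) = [d]\<^sub>* \<iota>\<^sub>* pr\<^sup>*(x)\<close>, where \<open>pr\<^sup>*\<close> restricts to \<open>V \<inter> d K' d\<inverse>\<close> and
  \<open>\<iota>\<^sub>*\<close> maps into \<open>M(d K' d\<inverse>)\<close>. The Mackey property of \<open>\<iota>\<^sub>*\<close> expresses \<open>[K' \<sigma> K']\<^sub>* \<iota>\<^sub>*(x)\<close> as the sum of
  \<open>\<Phi>\<close> over representatives of \<open>V \ K' \<sigma> K' / K'\<close>, and for \<open>h \<in> H\<close> the class \<open>\<Phi>(h g)\<close> is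
  \<open>[g]\<^sub>* \<iota>\<^sub>* [V h V']\<^sub>* (x)\<close> with \<open>V' = H \<inter> g K' g\<inverse>\<close>. Grouping representatives of \<open>U\<^sub>v \ supp(\<HH>\<^sub>v) / K\<^sub>v\<close>
  by their classes modulo \<open>H\<^sub>v\<close> on the left therefore gives
  \<open>\<HH>\<^sub>v\<^sub>* \<iota>\<^sub>*(x) = \<Sum>\<^sub>i [g\<^sub>v\<^sub>i]\<^sub>* \<iota>\<^sub>* (\<hh>\<^sub>v\<^sub>i\<^sub>* x)\<close>, and on a pure tensor \<open>\<hh>\<^sub>v\<^sub>i\<^sub>*\<close> only changes the factor at \<open>v\<close>.
  Let \<open>y\<^sub>\<nu>\<close> be the sum over all families of indices \<open>i\<^sub>v\<close>, \<open>v \<in> \<nu>\<close>, of \<open>[g\<^sub>i]\<^sub>* \<iota>\<^sub>*\<close> of the pure tensor with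
  factors \<open>x\<^sub>v\<^sub>i\<close> for \<open>v \<in> \<nu>\<close> and \<open>x\<^sub>U\<^sub>v\<close> elsewhere. Then both sides of the norm relation are the analogous
  sum over families indexed by \<open>\<mu>\<close>, with factor \<open>pr\<^sub>*(x\<^sub>v\<^sub>i)\<close> at the places \<open>v \<in> \<mu> - \<nu>\<close>.
\<close>

section \<open>Finite sums in modules\<close>

text \<open>The hypothesis concerns the single vector x_U_v at one place, whereas a Hecke operator
  meets classes already modified at other places. Two facts decouple the places. A translate t with
  trivial component at v commutes with the factor \<open>G v\<close>, so the operator at v passes
  through [t]_* and acts at the level t K[\<nu>] t^-1. Since v is not in \<nu>, the component of
  that level at v is still \<open>K v\<close>, and the factor of the tensor at v is still x_U_v, so
  the local hypothesis applies unchanged. Each operator adds one place to the set of treated places,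
  and the outcome depends on that set only, which covers every order of composition. The operators
  on M and on N are defined through unrelated choices of representatives. They are compared on a
  common refinement, the double cosets of \<open>U v\<close> and \<open>K v\<close> in the support.
  A sum over an infinite set is zero by convention, so this refinement must be shown to be finite;
  this is where the compactness of \<open>K v\<close> enters.\<close>

lemma (in abelian_monoid) finsum_image_disjoint:
  assumes "finite A" and "\<And>a. a \<in> A \<Longrightarrow> finite (B a)"
    and inj: "\<And>a b a' b'. a \<in> A \<Longrightarrow> b \<in> B a \<Longrightarrow> a' \<in> A \<Longrightarrow> b' \<in> B a' \<Longrightarrow>
      h a b = h a' b' \<Longrightarrow> a = a' \<and> b = b'"
    and "\<And>a b. a \<in> A \<Longrightarrow> b \<in> B a \<Longrightarrow> f (h a b) \<in> carrier G"
  shows "(\<Oplus>x\<in>(\<Union>a\<in>A. h a ` B a). f x) = (\<Oplus>a\<in>A. \<Oplus>b\<in>B a. f (h a b))"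
proof -
  have "(\<Oplus>x\<in>(\<Union>a\<in>A. h a ` B a). f x) = (\<Oplus>a\<in>A. \<Oplus>x\<in>h a ` B a. f x)"
  proof (rule add.finprod_UN_disjoint)
    show "pairwise (\<lambda>a b. disjnt (h a ` B a) (h b ` B b)) A"
      using inj by (fastforce simp: pairwise_def disjnt_def)
  qed (use assms in auto)
  also have "\<dots> = (\<Oplus>a\<in>A. \<Oplus>b\<in>B a. f (h a b))"
  proof (rule finsum_cong')
    fix a assume a: "a \<in> A"
    show "(\<Oplus>x\<in>h a ` B a. f x) = (\<Oplus>b\<in>B a. f (h a b))"
      using a assms(4) inj by (intro finsum_reindex) (auto simp: inj_on_def)
  qed (use assms in \<open>auto intro!: finsum_closed\<close>)
  finally show ?thesis .
qed

section \<open>Homomorphisms of modules\<close>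

lemma mod_homD:
  assumes "f \<in> mod_hom R M N"
  shows "\<And>x. x \<in> carrier M \<Longrightarrow> f x \<in> carrier N"
    and "\<And>x y. x \<in> carrier M \<Longrightarrow> y \<in> carrier M \<Longrightarrow> f (x \<oplus>\<^bsub>M\<^esub> y) = f x \<oplus>\<^bsub>N\<^esub> f y"
    and "\<And>a x. a \<in> carrier R \<Longrightarrow> x \<in> carrier M \<Longrightarrow> f (a \<odot>\<^bsub>M\<^esub> x) = a \<odot>\<^bsub>N\<^esub> f x"
  using assms by (auto simp: mod_hom_def)

lemma mod_hom_zero:
  assumes "Module.module R M" "Module.module R N" "f \<in> mod_hom R M N"
  shows "f \<zero>\<^bsub>M\<^esub> = \<zero>\<^bsub>N\<^esub>"
proof -
  interpret M: Module.module R M by fact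
  interpret N: Module.module R N by fact
  have "f (\<zero>\<^bsub>R\<^esub> \<odot>\<^bsub>M\<^esub> \<zero>\<^bsub>M\<^esub>) = \<zero>\<^bsub>R\<^esub> \<odot>\<^bsub>N\<^esub> f \<zero>\<^bsub>M\<^esub>"
    by (intro mod_homD[OF assms(3)]) auto
  then show ?thesis
    using mod_homD(1)[OF assms(3) M.zero_closed] by simp
qed

lemma mod_hom_finsum:
  assumes "Module.module R M" "Module.module R N" "f \<in> mod_hom R M N"
    and "\<And>a. a \<in> A \<Longrightarrow> u a \<in> carrier M"
  shows "f (\<Oplus>\<^bsub>M\<^esub>a\<in>A. u a) = (\<Oplus>\<^bsub>N\<^esub>a\<in>A. f (u a))"
proof -
  interpret M: Module.module R M by fact
  interpret N: Module.module R N by fact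
  note f = mod_homD[OF assms(3)]
  show ?thesis
  proof (cases "finite A")
    case True
    then show ?thesis
      using assms(4)
      by induction (auto simp: mod_hom_zero[OF assms(1-3)] f Pi_iff)
  \<comment> \<open>Over an infinite index set both sums are zero by convention.\<close>
  qed (simp add: mod_hom_zero[OF assms(1-3)])
qed

lemma mod_hom_minus:
  assumes M: "Module.module R M" "Module.module R N" "f \<in> mod_hom R M N"
    and x: "x \<in> carrier M" "y \<in> carrier M"
  shows "f (x \<ominus>\<^bsub>M\<^esub> y) = f x \<ominus>\<^bsub>N\<^esub> f y"
proof -
  interpret M: Module.module R M by fact
  interpret N: Module.module R N by fact
  note f = mod_homD[OF M(3)]
  \<comment> \<open>Homomorphisms are only required to respect sums and scalars, so negation is
    written as multiplication by -1.\<close>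
  have one: "\<ominus>\<^bsub>R\<^esub> \<one>\<^bsub>R\<^esub> \<in> carrier R" by simp
  have "f (\<ominus>\<^bsub>M\<^esub> y) = f ((\<ominus>\<^bsub>R\<^esub> \<one>\<^bsub>R\<^esub>) \<odot>\<^bsub>M\<^esub> y)"
    using x by (simp add: M.smult_l_minus)
  also have "\<dots> = (\<ominus>\<^bsub>R\<^esub> \<one>\<^bsub>R\<^esub>) \<odot>\<^bsub>N\<^esub> f y"
    using f(3)[OF one x(2)] .
  also have "\<dots> = \<ominus>\<^bsub>N\<^esub> f y"
    using f(1)[OF x(2)] by (simp add: N.smult_l_minus)
  finally show ?thesis
    using x f by (simp add: a_minus_def)
qed

text \<open>With \<open>submod_gen_least\<close> this reduces the claim that a homomorphism carries
  one submodule of relations into another to a check on generators.\<close>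

lemma submodule_preimage:
  assumes M: "Module.module R M" "Module.module R N" "f \<in> mod_hom R M N" and S: "submodule S R N"
  shows "submodule {x \<in> carrier M. f x \<in> S} R M"
proof -
  interpret M: Module.module R M by fact
  interpret N: Module.module R N by fact
  note f = mod_homD[OF M(3)] and SE = N.submoduleE[OF S]
  have zero: "f \<zero>\<^bsub>M\<^esub> = \<zero>\<^bsub>N\<^esub>" by (rule mod_hom_zero[OF M])
  have inv: "f (\<ominus>\<^bsub>M\<^esub> a) = \<ominus>\<^bsub>N\<^esub> f a" if "a \<in> carrier M" for a
    using mod_hom_minus[OF M M.M.zero_closed that] that f(1) by (simp add: a_minus_def zero)
  show ?thesis
  proof (rule M.submoduleI)
    show "\<zero>\<^bsub>M\<^esub> \<in> {x \<in> carrier M. f x \<in> S}"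
      using zero subgroup.one_closed[OF submodule.axioms(1)[OF S]] by simp
  qed (use f SE inv in auto)
qed

section \<open>Double cosets\<close>

lemma mem_conj_by: "x \<in> conj_by G g A \<longleftrightarrow> (\<exists>a\<in>A. x = g \<otimes>\<^bsub>G\<^esub> a \<otimes>\<^bsub>G\<^esub> inv\<^bsub>G\<^esub> g)"
  by (auto simp: conj_by_def l_coset_def r_coset_def)

lemma mem_dcoset: "x \<in> dcoset G A g B \<longleftrightarrow> (\<exists>a\<in>A. \<exists>b\<in>B. x = a \<otimes>\<^bsub>G\<^esub> g \<otimes>\<^bsub>G\<^esub> b)"
  by (auto simp: dcoset_def set_mult_def)

lemma dcosetI: "a \<in> A \<Longrightarrow> b \<in> B \<Longrightarrow> x = a \<otimes>\<^bsub>G\<^esub> g \<otimes>\<^bsub>G\<^esub> b \<Longrightarrow> x \<in> dcoset G A g B"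
  by (auto simp: mem_dcoset)

lemma dcoset_carrier_update: "dcoset (G\<lparr>carrier := H\<rparr>) A g B = dcoset G A g B"
  by (simp add: dcoset_def set_mult_def)

section \<open>Conjugates of subgroups, double cosets and their representatives\<close>

context Group.group
begin

text \<open>Membership becomes a condition on the point itself, with no element to exhibit; the
  identities for composed and intersected conjugates compare such conditions.\<close>

lemma conj_by_iff:
  assumes "g \<in> carrier G" "A \<subseteq> carrier G"
  shows "x \<in> conj_by G g A \<longleftrightarrow> x \<in> carrier G \<and> inv g \<otimes> x \<otimes> g \<in> A"
proof
  assume "x \<in> conj_by G g A"
  then obtain a where "a \<in> A" "x = g \<otimes> a \<otimes> inv g"
    by (auto simp: mem_conj_by)
  moreover have "inv g \<otimes> (g \<otimes> a \<otimes> inv g) \<otimes> g = a"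
    using assms \<open>a \<in> A\<close> by (simp add: m_assoc subset_iff) (simp add: m_assoc[symmetric] subset_iff)
  ultimately show "x \<in> carrier G \<and> inv g \<otimes> x \<otimes> g \<in> A"
    using assms by auto
next
  assume x: "x \<in> carrier G \<and> inv g \<otimes> x \<otimes> g \<in> A"
  then have "x = g \<otimes> (inv g \<otimes> x \<otimes> g) \<otimes> inv g"
    using assms by (simp add: m_assoc) (simp add: m_assoc[symmetric])
  with x show "x \<in> conj_by G g A"
    by (auto simp: mem_conj_by)
qed

lemma conj_by_carrier: "g \<in> carrier G \<Longrightarrow> A \<subseteq> carrier G \<Longrightarrow> conj_by G g A \<subseteq> carrier G"
  by (auto simp: conj_by_iff)

lemma conj_by_conj_by:
  assumes "g \<in> carrier G" "h \<in> carrier G" "A \<subseteq> carrier G"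
  shows "conj_by G g (conj_by G h A) = conj_by G (g \<otimes> h) A"
proof -
  have "inv h \<otimes> (inv g \<otimes> x \<otimes> g) \<otimes> h = inv (g \<otimes> h) \<otimes> x \<otimes> (g \<otimes> h)" if "x \<in> carrier G" for x
    using assms that by (simp add: inv_mult_group m_assoc)
  with assms have "x \<in> conj_by G g (conj_by G h A) \<longleftrightarrow> x \<in> conj_by G (g \<otimes> h) A" for x
    by (simp add: conj_by_iff conj_by_carrier cong: conj_cong)
  then show ?thesis
    by (rule Set.set_eqI)
qed

lemma conj_by_one: "A \<subseteq> carrier G \<Longrightarrow> conj_by G \<one> A = A"
  by (auto simp: conj_by_iff subset_iff)

lemma conj_by_Int:
  assumes "g \<in> carrier G" "A \<subseteq> carrier G" "B \<subseteq> carrier G"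
  shows "conj_by G g (A \<inter> B) = conj_by G g A \<inter> conj_by G g B"
proof (rule Set.set_eqI)
  show "x \<in> conj_by G g (A \<inter> B) \<longleftrightarrow> x \<in> conj_by G g A \<inter> conj_by G g B" for x
    using assms by (simp add: conj_by_iff le_infI1) argo
qed

lemma conj_by_subgroup:
  assumes "subgroup A G" "g \<in> A"
  shows "conj_by G g A = A"
proof -
  interpret A: subgroup A G by fact
  have "inv g \<otimes> x \<otimes> g \<in> A \<Longrightarrow> x \<in> A" if "x \<in> carrier G" for x
  proof -
    assume "inv g \<otimes> x \<otimes> g \<in> A"
    then have "g \<otimes> (inv g \<otimes> x \<otimes> g) \<otimes> inv g \<in> A"
      using assms(2) by (metis A.m_closed A.m_inv_closed)
    moreover have "g \<otimes> (inv g \<otimes> x \<otimes> g) \<otimes> inv g = x"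
      using assms that by (simp add: m_assoc A.mem_carrier) (simp add: m_assoc[symmetric] A.mem_carrier)
    ultimately show ?thesis by simp
  qed
  moreover have "inv g \<otimes> x \<otimes> g \<in> A" if "x \<in> A" for x
    using assms(2) that by (intro A.m_closed A.m_inv_closed)
  ultimately have "x \<in> conj_by G g A \<longleftrightarrow> x \<in> A" for x
    using assms(2) by (metis A.mem_carrier A.subset conj_by_iff)
  then show ?thesis
    by (rule Set.set_eqI)
qed

lemma subgroup_conj_by:
  assumes "subgroup A G" "g \<in> carrier G"
  shows "subgroup (conj_by G g A) G"
proof (rule subgroupI)
  interpret A: subgroup A G by fact
  show "conj_by G g A \<subseteq> carrier G"
    by (simp add: assms conj_by_carrier A.subset)
  show "conj_by G g A \<noteq> {}"
    using A.one_closed mem_conj_by by (metis empty_iff)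
  fix x y assume x: "x \<in> conj_by G g A" and y: "y \<in> conj_by G g A"
  then obtain a b where a: "a \<in> A" "x = g \<otimes> a \<otimes> inv g" and b: "b \<in> A" "y = g \<otimes> b \<otimes> inv g"
    by (auto simp: mem_conj_by)
  have "x \<otimes> y = g \<otimes> (a \<otimes> b) \<otimes> inv g"
    using a b assms(2) by (simp add: m_assoc) (simp add: m_assoc[symmetric])
  with a b show "x \<otimes> y \<in> conj_by G g A"
    by (auto simp: mem_conj_by)
  have "inv x = g \<otimes> inv a \<otimes> inv g"
    using a assms(2) by (simp add: inv_mult_group m_assoc)
  with a show "inv x \<in> conj_by G g A"
    by (auto simp: mem_conj_by)
qed

lemma mem_dcoset_self:
  assumes "subgroup A G" "subgroup B G" "x \<in> carrier G"
  shows "x \<in> dcoset G A x B"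
  unfolding mem_dcoset using assms
  by (intro bexI[of _ \<one>]) (simp_all add: subgroup.one_closed)

lemma dcoset_carrier:
  assumes "A \<subseteq> carrier G" "B \<subseteq> carrier G" "x \<in> carrier G"
  shows "dcoset G A x B \<subseteq> carrier G"
  using assms by (intro subsetI) (auto simp: mem_dcoset dest!: subsetD)

lemma dcoset_sym:
  assumes "subgroup A G" "subgroup B G" "x \<in> carrier G" "y \<in> dcoset G A x B"
  shows "x \<in> dcoset G A y B"
proof -
  interpret A: subgroup A G by fact
  interpret B: subgroup B G by fact
  obtain a b where ab: "a \<in> A" "b \<in> B" "y = a \<otimes> x \<otimes> b"
    using assms by (auto simp: mem_dcoset)
  then have "x = inv a \<otimes> y \<otimes> inv b"
    using assms(3) by (simp add: m_assoc) (simp add: m_assoc[symmetric])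
  with ab show ?thesis
    by (auto simp: mem_dcoset)
qed

lemma dcoset_trans:
  assumes "subgroup A G" "subgroup B G" "x \<in> carrier G" "y \<in> dcoset G A x B" "z \<in> dcoset G A y B"
  shows "z \<in> dcoset G A x B"
proof -
  interpret A: subgroup A G by fact
  interpret B: subgroup B G by fact
  obtain a b a' b' where ab: "a \<in> A" "b \<in> B" "y = a \<otimes> x \<otimes> b" "a' \<in> A" "b' \<in> B" "z = a' \<otimes> y \<otimes> b'"
    using assms by (auto simp: mem_dcoset)
  then have "z = (a' \<otimes> a) \<otimes> x \<otimes> (b \<otimes> b')"
    using assms(3) by (simp add: m_assoc)
  with ab show ?thesis
    by (force simp: mem_dcoset)
qed

lemma dcoset_reps_uniq:
  assumes "dcoset_reps G A X B S" "subgroup A G" "subgroup B G" "X \<subseteq> carrier G"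
    and "s \<in> S" "t \<in> S" "s \<in> dcoset G A t B"
  shows "s = t"
proof -
  have "s \<in> X" using assms(1,5) by (auto simp: dcoset_reps_def)
  then have "\<exists>!r. r \<in> S \<and> s \<in> dcoset G A r B"
    using assms(1) by (simp add: dcoset_reps_def)
  moreover have "s \<in> dcoset G A s B"
    using mem_dcoset_self assms(2-4) \<open>s \<in> X\<close> by blast
  ultimately show ?thesis
    using assms(5-7) by blast
qed

text \<open>\<open>hecke_reps\<close> is an unspecified choice of representatives, about which
  nothing is known until some system is shown to exist.\<close>

lemma dcoset_reps_ex:
  assumes A: "subgroup A G" and B: "subgroup B G" and X: "X \<subseteq> carrier G"
    and XX: "\<And>x. x \<in> X \<Longrightarrow> dcoset G A x B \<subseteq> X"
  shows "\<exists>S. dcoset_reps G A X B S"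
proof -
  \<comment> \<open>The choice depends on the double coset as a set, so all its members select the
    same element; uniqueness rests on this.\<close>
  define \<rho> where "\<rho> C = (SOME x. x \<in> C)" for C :: "'a set"
  have \<rho>: "\<rho> (dcoset G A x B) \<in> dcoset G A x B" if "x \<in> X" for x
    unfolding \<rho>_def using mem_dcoset_self[OF A B] that X by (metis someI subsetD)
  have eq: "dcoset G A x B = dcoset G A y B" if "x \<in> X" "y \<in> dcoset G A x B" for x y
  proof -
    have "x \<in> carrier G" "y \<in> carrier G" using that X XX by blast+
    then show ?thesis
      using that(2) dcoset_trans[OF A B] dcoset_sym[OF A B] by (meson subsetI subset_antisym)
  qed
  show ?thesis
  proof (intro exI, unfold dcoset_reps_def, intro conjI ballI)
    show "(\<lambda>x. \<rho> (dcoset G A x B)) ` X \<subseteq> X"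
      using \<rho> XX by blast
    fix x assume x: "x \<in> X"
    show "\<exists>!s. s \<in> (\<lambda>x. \<rho> (dcoset G A x B)) ` X \<and> x \<in> dcoset G A s B"
    proof (rule ex1I)
      show "\<rho> (dcoset G A x B) \<in> (\<lambda>x. \<rho> (dcoset G A x B)) ` X \<and> x \<in> dcoset G A (\<rho> (dcoset G A x B)) B"
        using x \<rho>[OF x] X dcoset_sym[OF A B] by blast
      fix s assume s: "s \<in> (\<lambda>x. \<rho> (dcoset G A x B)) ` X \<and> x \<in> dcoset G A s B"
      then obtain y where y: "y \<in> X" "s = \<rho> (dcoset G A y B)"
        by blast
      have "s \<in> dcoset G A y B" using y \<rho> by simp
      then have "dcoset G A s B = dcoset G A y B" "s \<in> X" using eq[of y s] y XX by auto
      moreover have "dcoset G A x B = dcoset G A s B" using eq[of s x] s \<open>s \<in> X\<close> by simp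
      ultimately show "s = \<rho> (dcoset G A x B)" using y by simp
    qed
  qed
qed

text \<open>The map \<gamma> -> \<gamma> \<sigma> identifies the double cosets of \<open>A\<close>
  and K \<inter> \<sigma> K \<sigma>^-1 in \<open>K\<close> with those of \<open>A\<close> and
  \<open>K\<close> in K \<sigma> K. The Mackey formula sums over the former, while Hecke functions
  are given on the latter. A prescribed representative d equals \<gamma>(d) \<sigma> only up to a
  right factor from \<open>K\<close>, hence the \<open>k\<close> in the conclusion.\<close>

lemma dcoset_reps_transfer:
  assumes A: "subgroup A G" and K: "subgroup K G" and "A \<subseteq> K" and \<sigma>: "\<sigma> \<in> carrier G"
    and D: "dcoset_reps G A (dcoset G K \<sigma> K) K D"
  obtains \<gamma> where "inj_on \<gamma> D" "dcoset_reps G A K (K \<inter> conj_by G \<sigma> K) (\<gamma> ` D)"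
    "\<And>d. d \<in> D \<Longrightarrow> \<gamma> d \<in> K \<and> (\<exists>k\<in>K. d = \<gamma> d \<otimes> \<sigma> \<otimes> k)"
proof -
  interpret K: subgroup K G by fact
  interpret A: subgroup A G by fact
  have "\<forall>d\<in>D. \<exists>c. c \<in> K \<and> (\<exists>k\<in>K. d = c \<otimes> \<sigma> \<otimes> k)"
    using D unfolding dcoset_reps_def subset_iff mem_dcoset by blast
  then obtain \<gamma> where \<gamma>: "\<And>d. d \<in> D \<Longrightarrow> \<gamma> d \<in> K \<and> (\<exists>k\<in>K. d = \<gamma> d \<otimes> \<sigma> \<otimes> k)"
    by metis
  have DK: "dcoset G K \<sigma> K \<subseteq> carrier G"
    by (simp add: \<sigma> dcoset_carrier K.subset)
  have iff: "k \<in> dcoset G A (\<gamma> d) (K \<inter> conj_by G \<sigma> K) \<longleftrightarrow> k \<otimes> \<sigma> \<in> dcoset G A d K"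
    if "d \<in> D" "k \<in> K" for d k
  proof -
    obtain c where c: "c \<in> K" "d = \<gamma> d \<otimes> \<sigma> \<otimes> c" and gd: "\<gamma> d \<in> K"
      using \<gamma> \<open>d \<in> D\<close> by blast
    show ?thesis
    proof
      assume "k \<in> dcoset G A (\<gamma> d) (K \<inter> conj_by G \<sigma> K)"
      then obtain a b where ab: "a \<in> A" "b \<in> K" "k = a \<otimes> \<gamma> d \<otimes> (\<sigma> \<otimes> b \<otimes> inv \<sigma>)"
        by (auto simp: mem_dcoset mem_conj_by)
      have "k \<otimes> \<sigma> = a \<otimes> d \<otimes> (inv c \<otimes> b)"
        apply (subst c(2))
        using ab(1,2) gd c(1) \<sigma> unfolding ab(3)
        by (simp add: m_assoc) (simp add: m_assoc[symmetric])
      with ab c show "k \<otimes> \<sigma> \<in> dcoset G A d K"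
        by (auto simp: mem_dcoset)
    next
      assume "k \<otimes> \<sigma> \<in> dcoset G A d K"
      then obtain a b where ab: "a \<in> A" "b \<in> K" "k \<otimes> \<sigma> = a \<otimes> d \<otimes> b"
        by (auto simp: mem_dcoset)
      have d: "d \<in> carrier G" using D DK \<open>d \<in> D\<close> by (auto simp: dcoset_reps_def)
      have k: "k = a \<otimes> \<gamma> d \<otimes> (\<sigma> \<otimes> (c \<otimes> b) \<otimes> inv \<sigma>)"
      proof -
        have "k = (k \<otimes> \<sigma>) \<otimes> inv \<sigma>" using that \<sigma> by (simp add: m_assoc)
        also have "\<dots> = a \<otimes> (\<gamma> d \<otimes> \<sigma> \<otimes> c) \<otimes> b \<otimes> inv \<sigma>" using ab(3) c(2) by simp
        also have "\<dots> = a \<otimes> \<gamma> d \<otimes> (\<sigma> \<otimes> (c \<otimes> b) \<otimes> inv \<sigma>)"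
          using ab(1,2) c(1) gd \<sigma> by (simp add: m_assoc)
        finally show ?thesis .
      qed
      \<comment> \<open>By its form \<open>?w\<close> lies in \<sigma> K \<sigma>^-1; it lies in
        \<open>K\<close> as well, being the quotient of k by a \<gamma>(d), both elements of
        \<open>K\<close>.\<close>
      let ?w = "\<sigma> \<otimes> (c \<otimes> b) \<otimes> inv \<sigma>"
      have w: "?w \<in> carrier G" using ab c \<sigma> by simp
      have "?w = inv (a \<otimes> \<gamma> d) \<otimes> k"
        using k ab(1) gd w \<open>k \<in> K\<close> by (intro iffD2[OF inv_solve_left]) (auto simp del: m_assoc)
      moreover have "a \<otimes> \<gamma> d \<in> K" using ab gd \<open>A \<subseteq> K\<close> by auto
      ultimately have "?w \<in> K" using \<open>k \<in> K\<close> by simp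
      moreover have "?w \<in> conj_by G \<sigma> K" using ab c by (auto simp: mem_conj_by)
      ultimately show "k \<in> dcoset G A (\<gamma> d) (K \<inter> conj_by G \<sigma> K)"
        using k ab(1) unfolding mem_dcoset by blast
    qed
  qed
  have inj: "inj_on \<gamma> D"
  proof (rule inj_onI)
    fix d e assume de: "d \<in> D" "e \<in> D" "\<gamma> d = \<gamma> e"
    \<comment> \<open>Equal values of \<gamma> make d and e differ by a right factor from
      \<open>K\<close>, so they represent the same double coset.\<close>
    then obtain b c where bc: "b \<in> K" "c \<in> K" "d = \<gamma> e \<otimes> \<sigma> \<otimes> b" "e = \<gamma> e \<otimes> \<sigma> \<otimes> c"
      using \<gamma> by metis
    define s where "s = \<gamma> e \<otimes> \<sigma>"
    have s: "s \<in> carrier G" "d = s \<otimes> b" "e = s \<otimes> c"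
      using bc(3,4) \<gamma>[OF de(2), THEN conjunct1] \<sigma> by (simp_all add: s_def)
    have "d = \<one> \<otimes> e \<otimes> (inv c \<otimes> b)"
      unfolding s(2,3) using s(1) bc(1,2) by (simp add: m_assoc) (simp add: m_assoc[symmetric])
    then have "d \<in> dcoset G A e K"
      unfolding mem_dcoset using bc(1,2)
      by (intro bexI[of _ "\<one>"] bexI[of _ "inv c \<otimes> b"] K.m_closed K.m_inv_closed A.one_closed)
    then show "d = e"
      using dcoset_reps_uniq[OF D A K DK de(1,2)] by simp
  qed
  have "dcoset_reps G A K (K \<inter> conj_by G \<sigma> K) (\<gamma> ` D)"
    unfolding dcoset_reps_def
  proof (intro conjI ballI)
    show "\<gamma> ` D \<subseteq> K" using \<gamma> by blast
    fix k assume k: "k \<in> K"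
    then have "k \<otimes> \<sigma> \<in> dcoset G K \<sigma> K"
      unfolding mem_dcoset using \<sigma> K.one_closed by (metis K.mem_carrier m_closed r_one)
    then have "\<exists>!d. d \<in> D \<and> k \<otimes> \<sigma> \<in> dcoset G A d K"
      using D by (simp add: dcoset_reps_def)
    then obtain d where d: "d \<in> D" "k \<otimes> \<sigma> \<in> dcoset G A d K"
      "\<And>e. e \<in> D \<Longrightarrow> k \<otimes> \<sigma> \<in> dcoset G A e K \<Longrightarrow> e = d"
      by blast
    show "\<exists>!s. s \<in> \<gamma> ` D \<and> k \<in> dcoset G A s (K \<inter> conj_by G \<sigma> K)"
    proof (rule ex1I[of _ "\<gamma> d"])
      show "\<gamma> d \<in> \<gamma> ` D \<and> k \<in> dcoset G A (\<gamma> d) (K \<inter> conj_by G \<sigma> K)"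
        using d(1,2) k iff by blast
      fix s assume "s \<in> \<gamma> ` D \<and> k \<in> dcoset G A s (K \<inter> conj_by G \<sigma> K)"
      then show "s = \<gamma> d" using d(3) k iff by blast
    qed
  qed
  from that[OF inj this \<gamma>] show thesis .
qed

text \<open>A double coset that meets \<open>Y\<close> lies in \<open>Y\<close>, so the
  representative of a point of \<open>Y\<close> belongs to \<open>Y\<close>.\<close>

lemma dcoset_reps_restrict:
  assumes D: "dcoset_reps G A X B D" and "Y \<subseteq> X" and YY: "\<And>y. y \<in> Y \<Longrightarrow> dcoset G A y B \<subseteq> Y"
    and A: "subgroup A G" and B: "subgroup B G" and X: "X \<subseteq> carrier G"
  shows "dcoset_reps G A Y B (D \<inter> Y)"
  unfolding dcoset_reps_def
proof (intro conjI ballI)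
  fix y assume y: "y \<in> Y"
  then obtain s where s: "s \<in> D" "y \<in> dcoset G A s B"
    and u: "\<And>t. t \<in> D \<Longrightarrow> y \<in> dcoset G A t B \<Longrightarrow> t = s"
    using D \<open>Y \<subseteq> X\<close> unfolding dcoset_reps_def by (meson subsetD)
  have "s \<in> carrier G" using s(1) D X by (auto simp: dcoset_reps_def)
  then have "s \<in> Y" using dcoset_sym[OF A B _ s(2)] YY[OF y] by auto
  show "\<exists>!s. s \<in> D \<inter> Y \<and> y \<in> dcoset G A s B"
    by (rule ex1I[of _ s]) (simp_all add: s \<open>s \<in> Y\<close> u)
qed simp

text \<open>Serves to sort a finer system \<open>D\<close>, formed with a smaller group on the left,
  according to the coarser system \<open>S\<close>.\<close>

lemma dcoset_reps_disjoint_union: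
  assumes "dcoset_reps G A X B S" "D \<subseteq> X"
  shows "D = (\<Union>s\<in>S. D \<inter> dcoset G A s B)"
    and "\<And>s t d. s \<in> S \<Longrightarrow> t \<in> S \<Longrightarrow> d \<in> D \<inter> dcoset G A s B \<Longrightarrow> d \<in> D \<inter> dcoset G A t B \<Longrightarrow> s = t"
proof -
  note S = assms(1)[unfolded dcoset_reps_def]
  show "D = (\<Union>s\<in>S. D \<inter> dcoset G A s B)"
    using S assms(2) by (intro equalityI subsetI) (meson IntI UN_I subsetD, blast)
  show "s = t" if "s \<in> S" "t \<in> S" "d \<in> D \<inter> dcoset G A s B" "d \<in> D \<inter> dcoset G A t B" for s t d
  proof -
    have "d \<in> X" using that(3) assms(2) by blast
    then have "\<exists>!s. s \<in> S \<and> d \<in> dcoset G A s B" using S by simp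
    then show ?thesis using that by blast
  qed
qed

text \<open>Right multiplication of h by g k g^-1 changes h g into h g k, and left multiplication by
  \<open>A\<close> stays inside \<open>H\<close>; so the stability of \<open>X\<close> passes to the
  fibre.\<close>

lemma dcoset_fibre_stable:
  assumes H: "subgroup H G" and A: "subgroup A G" and K: "subgroup K G" and "A \<subseteq> H"
    and X: "X \<subseteq> carrier G" and XX: "\<And>x. x \<in> X \<Longrightarrow> dcoset G A x K \<subseteq> X"
    and g: "g \<in> carrier G" and h: "h \<in> {h \<in> H. h \<otimes> g \<in> X}"
  shows "dcoset G A h (H \<inter> conj_by G g K) \<subseteq> {h \<in> H. h \<otimes> g \<in> X}"
proof
  interpret H: subgroup H G by fact
  interpret A: subgroup A G by fact
  interpret K: subgroup K G by fact
  fix y assume "y \<in> dcoset G A h (H \<inter> conj_by G g K)"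
  then obtain a k where ak: "a \<in> A" "k \<in> K" "g \<otimes> k \<otimes> inv g \<in> H" "y = a \<otimes> h \<otimes> (g \<otimes> k \<otimes> inv g)"
    unfolding mem_dcoset by (auto simp: mem_conj_by)
  have h': "h \<in> H" "h \<otimes> g \<in> X" using h by auto
  have "a \<in> H" using ak \<open>A \<subseteq> H\<close> by blast
  then have "y \<in> H" using ak(3,4) h'(1) by simp
  moreover have "y \<otimes> g = a \<otimes> (h \<otimes> g) \<otimes> k"
    unfolding ak(4) using ak(1,2) h'(1) g by (simp add: m_assoc)
  then have "y \<otimes> g \<in> dcoset G A (h \<otimes> g) K" by (rule dcosetI[OF ak(1,2)])
  then have "y \<otimes> g \<in> X" using XX[OF h'(2)] by blast
  ultimately show "y \<in> {h \<in> H. h \<otimes> g \<in> X}" by simp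
qed

text \<open>Taking classes modulo \<open>H\<close> on the left fibres the double cosets of
  \<open>A\<close> and \<open>K\<close> in \<open>X\<close> over \<open>R\<close>. The fibre over g
  consists of the points h g up to \<open>A\<close> and \<open>K\<close>: a relation h g = a h' g k
  with a, h, h' in \<open>H\<close> forces g k g^-1 to lie in \<open>H\<close>, which is why the
  right group on the fibre is H \<inter> g K g^-1.\<close>

lemma dcoset_reps_fibre:
  assumes H: "subgroup H G" and A: "subgroup A G" and K: "subgroup K G" and "A \<subseteq> H"
    and X: "X \<subseteq> carrier G" and XX: "\<And>x. x \<in> X \<Longrightarrow> dcoset G A x K \<subseteq> X"
    and R: "dcoset_reps G H (H <#> X) K R"
    and S: "\<And>g. g \<in> R \<Longrightarrow> dcoset_reps G A {h \<in> H. h \<otimes> g \<in> X} (H \<inter> conj_by G g K) (S g)"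
  shows "dcoset_reps G A X K (\<Union>g\<in>R. (\<lambda>h. h \<otimes> g) ` S g)"
    and "\<And>g h g' h'. g \<in> R \<Longrightarrow> h \<in> S g \<Longrightarrow> g' \<in> R \<Longrightarrow> h' \<in> S g' \<Longrightarrow> h \<otimes> g = h' \<otimes> g' \<Longrightarrow> g = g' \<and> h = h'"
proof -
  interpret H: subgroup H G by fact
  interpret A: subgroup A G by fact
  interpret K: subgroup K G by fact
  have HX: "H <#> X \<subseteq> carrier G" using X by (auto simp: set_mult_def)
  have Rc: "g \<in> carrier G" if "g \<in> R" for g
    using that R HX by (auto simp: dcoset_reps_def)
  have Sh: "h \<in> H \<and> h \<otimes> g \<in> X" if "g \<in> R" "h \<in> S g" for g h
    using S[OF that(1)] that(2) by (auto simp: dcoset_reps_def)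
  \<comment> \<open>Points of two fibres can agree up to \<open>K\<close> only if the fibres
    coincide, since \<open>R\<close> has one element in each class.\<close>
  have same: "g = g'"
    if "g \<in> R" "g' \<in> R" "h \<in> H" "h' \<in> H" "k \<in> K" "h \<otimes> g = h' \<otimes> g' \<otimes> k" for g g' h h' k
  proof -
    have "g = inv h \<otimes> (h \<otimes> g)" using that(1,3) Rc by (simp add: m_assoc[symmetric])
    also have "\<dots> = (inv h \<otimes> h') \<otimes> g' \<otimes> k" unfolding that(6) using that(2-5) Rc by (simp add: m_assoc)
    finally have "g \<in> dcoset G H g' K" by (rule dcosetI[rotated 2]) (use that in simp_all)
    then show ?thesis by (rule dcoset_reps_uniq[OF R H K HX that(1,2)])
  qed
  show inj: "g = g' \<and> h = h'" if "g \<in> R" "h \<in> S g" "g' \<in> R" "h' \<in> S g'" "h \<otimes> g = h' \<otimes> g'" for g h g' h'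
  proof -
    have h: "h \<in> H" "h' \<in> H" using that Sh by blast+
    moreover have "h \<otimes> g = h' \<otimes> g' \<otimes> \<one>" using that(3,5) Rc h(2) by simp
    ultimately have "g = g'" using same[OF that(1,3)] K.one_closed by metis
    then show ?thesis using that(3,5) Rc h by simp
  qed
  show "dcoset_reps G A X K (\<Union>g\<in>R. (\<lambda>h. h \<otimes> g) ` S g)"
    unfolding dcoset_reps_def
  proof (intro conjI ballI)
    show "(\<Union>g\<in>R. (\<lambda>h. h \<otimes> g) ` S g) \<subseteq> X" using Sh by blast
    fix x assume x: "x \<in> X"
    then have xc: "x \<in> carrier G" using X by blast
    have "\<one> \<otimes> x \<in> H <#> X" unfolding set_mult_def by (rule UN_I[OF H.one_closed], rule UN_I[OF x]) simp
    then have "x \<in> H <#> X" using xc by simp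
    then obtain g where g: "g \<in> R" "x \<in> dcoset G H g K"
      using R unfolding dcoset_reps_def by meson
    obtain h k where hk: "h \<in> H" "k \<in> K" "x = h \<otimes> g \<otimes> k"
      using g unfolding mem_dcoset by blast
    have hg: "h \<otimes> g = \<one> \<otimes> x \<otimes> inv k"
      using hk Rc[OF g(1)] by (simp add: m_assoc)
    have "\<one> \<otimes> x \<otimes> inv k \<in> dcoset G A x K"
      using hk(2) by (intro dcosetI[OF A.one_closed _ refl]) simp
    then have "h \<otimes> g \<in> X" using XX[OF x] hg by auto
    then obtain s where s: "s \<in> S g" "h \<in> dcoset G A s (H \<inter> conj_by G g K)"
      and su: "\<And>t. t \<in> S g \<Longrightarrow> h \<in> dcoset G A t (H \<inter> conj_by G g K) \<Longrightarrow> t = s"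
      using S[OF g(1)] hk(1) unfolding dcoset_reps_def by blast
    obtain a b where ab: "a \<in> A" "b \<in> K" "h = a \<otimes> s \<otimes> (g \<otimes> b \<otimes> inv g)"
      using s(2) unfolding mem_dcoset by (auto simp: mem_conj_by)
    have sH: "s \<in> H" using Sh[OF g(1) s(1)] by blast
    have "x = a \<otimes> (s \<otimes> g) \<otimes> (b \<otimes> k)"
      unfolding hk(3) ab(3) using ab(1,2) hk(2) sH Rc[OF g(1)] by (simp add: m_assoc)
    then have xs: "x \<in> dcoset G A (s \<otimes> g) K"
      by (rule dcosetI[OF ab(1), rotated]) (use ab hk in simp)
    show "\<exists>!r. r \<in> (\<Union>g\<in>R. (\<lambda>h. h \<otimes> g) ` S g) \<and> x \<in> dcoset G A r K"
    proof (rule ex1I[of _ "s \<otimes> g"])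
      show "s \<otimes> g \<in> (\<Union>g\<in>R. (\<lambda>h. h \<otimes> g) ` S g) \<and> x \<in> dcoset G A (s \<otimes> g) K"
        using xs g s by blast
      fix r assume "r \<in> (\<Union>g\<in>R. (\<lambda>h. h \<otimes> g) ` S g) \<and> x \<in> dcoset G A r K"
      then obtain g' s' where r: "g' \<in> R" "s' \<in> S g'" "r = s' \<otimes> g'" "x \<in> dcoset G A (s' \<otimes> g') K"
        by blast
      have s'H: "s' \<in> H" using Sh[OF r(1,2)] by blast
      obtain a' k' where ak: "a' \<in> A" "k' \<in> K" "x = a' \<otimes> (s' \<otimes> g') \<otimes> k'"
        using r(4) unfolding mem_dcoset by blast
      have a'H: "a' \<in> H" using ak \<open>A \<subseteq> H\<close> by blast
      have eq: "h \<otimes> g = (a' \<otimes> s') \<otimes> g' \<otimes> (k' \<otimes> inv k)"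
      proof -
        have "h \<otimes> g = x \<otimes> inv k" using hg xc by simp
        then show ?thesis unfolding ak(3) using ak(1,2) hk(2) s'H Rc[OF r(1)] by (simp add: m_assoc)
      qed
      have gg: "g = g'"
        using same[OF g(1) r(1) hk(1) _ _ eq] a'H s'H ak hk by simp
      have h_eq: "h = a' \<otimes> s' \<otimes> (g \<otimes> (k' \<otimes> inv k) \<otimes> inv g)"
      proof -
        have "h = (h \<otimes> g) \<otimes> inv g" using hk(1) Rc[OF g(1)] by (simp add: m_assoc)
        also have "\<dots> = a' \<otimes> s' \<otimes> (g \<otimes> (k' \<otimes> inv k) \<otimes> inv g)"
          unfolding eq gg[symmetric] using ak(1,2) hk(2) s'H Rc[OF g(1)] by (simp add: m_assoc)
        finally show ?thesis .
      qed
      moreover have w: "g \<otimes> (k' \<otimes> inv k) \<otimes> inv g \<in> conj_by G g K"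
        unfolding mem_conj_by by (rule bexI[of _ "k' \<otimes> inv k"]) (use ak hk in simp_all)
      \<comment> \<open>The conjugated factor is the quotient of h by a' s', both elements of
        \<open>H\<close>.\<close>
      moreover have "g \<otimes> (k' \<otimes> inv k) \<otimes> inv g \<in> H"
      proof -
        have c: "g \<otimes> (k' \<otimes> inv k) \<otimes> inv g \<in> carrier G" using ak hk Rc[OF g(1)] by simp
        have "g \<otimes> (k' \<otimes> inv k) \<otimes> inv g = inv (a' \<otimes> s') \<otimes> h"
          by (rule iffD2[OF inv_solve_left]) (use c a'H s'H hk(1) h_eq in simp_all)
        then show ?thesis using a'H s'H hk(1) by simp
      qed
      ultimately have "h \<in> dcoset G A s' (H \<inter> conj_by G g K)"
        by (intro dcosetI[OF ak(1), rotated]) simp_all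
      then have "s' = s" using su r(2) gg by simp
      then show "r = s \<otimes> g" using r(3) gg by simp
    qed
  qed
qed

end

section \<open>Finiteness of double cosets from compactness\<close>

context topological_group
begin

lemma openin_translate:
  assumes "openin T P" "x \<in> carrier G"
  shows "openin T ((\<lambda>p. x \<otimes> p) ` P)"
proof -
  have P: "P \<subseteq> carrier G" using openin_subset[OF assms(1)] topspace_eq by simp
  have pair: "continuous_map T (prod_topology T T) (\<lambda>y. (inv x, y))"
    using assms(2) topspace_eq by (intro continuous_map_pairedI) auto
  have "continuous_map T T (\<lambda>y. inv x \<otimes> y)"
    using continuous_map_compose[OF pair continuous_mult] by (simp add: comp_def)
  then have "openin T {y \<in> topspace T. inv x \<otimes> y \<in> P}"
    using assms(1) by (rule openin_continuous_map_preimage)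
  moreover have "{y \<in> topspace T. inv x \<otimes> y \<in> P} = (\<lambda>p. x \<otimes> p) ` P"
  proof (intro equalityI subsetI)
    fix y assume "y \<in> {y \<in> topspace T. inv x \<otimes> y \<in> P}"
    moreover then have "y = x \<otimes> (inv x \<otimes> y)"
      using assms(2) topspace_eq by (simp add: m_assoc[symmetric])
    ultimately show "y \<in> (\<lambda>p. x \<otimes> p) ` P" by blast
  next
    fix y assume "y \<in> (\<lambda>p. x \<otimes> p) ` P"
    then obtain p where p: "p \<in> P" "y = x \<otimes> p" by blast
    then have "p \<in> carrier G" using P by blast
    then have "inv x \<otimes> y = p" using p assms(2) by (simp add: m_assoc[symmetric])
    with p \<open>p \<in> carrier G\<close> assms(2) show "y \<in> {y \<in> topspace T. inv x \<otimes> y \<in> P}"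
      by (simp add: topspace_eq)
  qed
  ultimately show ?thesis by simp
qed

lemma openin_conj_by:
  assumes "openin T P" "x \<in> carrier G"
  shows "openin T (conj_by G x P)"
proof -
  have P: "P \<subseteq> carrier G" using openin_subset[OF assms(1)] topspace_eq by simp
  have "continuous_map T (prod_topology T T) (\<lambda>y. (inv x, y))"
    using assms(2) topspace_eq by (intro continuous_map_pairedI) auto
  from continuous_map_compose[OF this continuous_mult]
  have "continuous_map T T (\<lambda>y. inv x \<otimes> y)" by (simp add: comp_def)
  then have "continuous_map T (prod_topology T T) (\<lambda>y. (inv x \<otimes> y, x))"
    using assms(2) topspace_eq by (intro continuous_map_pairedI) auto
  from continuous_map_compose[OF this continuous_mult]
  have "continuous_map T T (\<lambda>y. inv x \<otimes> y \<otimes> x)" by (simp add: comp_def)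
  then have "openin T {y \<in> topspace T. inv x \<otimes> y \<otimes> x \<in> P}"
    using assms(1) by (rule openin_continuous_map_preimage)
  moreover have "{y \<in> topspace T. inv x \<otimes> y \<otimes> x \<in> P} = conj_by G x P"
    unfolding topspace_eq using conj_by_iff[OF assms(2) P] by blast
  ultimately show ?thesis by simp
qed

text \<open>The translates x P with x in \<open>K\<close> are open and cover the compact set
  \<open>K\<close>. Two representatives in the same translate differ by a right factor from
  \<open>P\<close> and are therefore equal, so a finite subcover bounds their number.\<close>

lemma finite_dcoset_reps:
  assumes K: "compactin T K" and A: "subgroup A G" and P: "subgroup P G" "openin T P"
    and S: "dcoset_reps G A K P S"
  shows "finite S"
proof -
  interpret P: subgroup P G by fact
  interpret A: subgroup A G by fact
  have Kc: "K \<subseteq> carrier G" using compactin_subset_topspace[OF K] topspace_eq by simp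
  let ?U = "(\<lambda>x. (\<lambda>p. x \<otimes> p) ` P) ` K"
  have "K \<subseteq> \<Union>?U"
  proof
    fix x assume x: "x \<in> K"
    then have "x = x \<otimes> \<one>" using Kc by auto
    with x show "x \<in> \<Union>?U" using P.one_closed by blast
  qed
  moreover have "\<And>u. u \<in> ?U \<Longrightarrow> openin T u"
    using openin_translate P Kc by blast
  ultimately obtain F where F: "finite F" "F \<subseteq> ?U" "K \<subseteq> \<Union>F"
    using K unfolding compactin_def by meson
  have SK: "S \<subseteq> K" using S by (simp add: dcoset_reps_def)
  have "\<forall>s\<in>S. \<exists>u\<in>F. s \<in> u" using SK F by blast
  then obtain \<phi> where \<phi>: "\<And>s. s \<in> S \<Longrightarrow> \<phi> s \<in> F \<and> s \<in> \<phi> s" by metis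
  have "inj_on \<phi> S"
  proof (rule inj_onI)
    fix s t assume st: "s \<in> S" "t \<in> S" "\<phi> s = \<phi> t"
    obtain x where x: "x \<in> K" "\<phi> s = (\<lambda>p. x \<otimes> p) ` P" using \<phi>[OF st(1)] F by blast
    obtain p q where pq: "p \<in> P" "q \<in> P" "s = x \<otimes> p" "t = x \<otimes> q"
      using \<phi>[OF st(1)] \<phi>[OF st(2)] unfolding st(3)[symmetric] x(2) by blast
    have "x \<in> carrier G" using x Kc by blast
    then have "s = \<one> \<otimes> t \<otimes> (inv q \<otimes> p)"
      unfolding pq(3,4) using pq(1,2) by (simp add: m_assoc) (simp add: m_assoc[symmetric])
    then have "s \<in> dcoset G A t P"
      by (rule dcosetI[OF A.one_closed, rotated]) (use pq(1,2) in simp)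
    then show "s = t" using dcoset_reps_uniq[OF S A P(1) Kc st(1,2)] by simp
  qed
  moreover have "\<phi> ` S \<subseteq> F" using \<phi> by blast
  ultimately show ?thesis using F(1) by (meson finite_subset finite_imageD)
qed

end

section \<open>Hecke operators and pushforwards\<close>

lemma conj_by_mono: "A \<subseteq> B \<Longrightarrow> conj_by G g A \<subseteq> conj_by G g B"
  unfolding subset_iff mem_conj_by by blast

text \<open>Stated with inclusions into g K g^-1 because the levels below arise as intersections
  with such conjugates.\<close>

lemma (in Group.group) Hom_P_iff:
  assumes "L \<subseteq> carrier G" "K \<subseteq> carrier G"
  shows "g \<in> Hom_P G L K \<longleftrightarrow> g \<in> carrier G \<and> L \<subseteq> conj_by G g K"
proof -
  have "conj_by G (inv g) L \<subseteq> K \<longleftrightarrow> L \<subseteq> conj_by G g K" if g: "g \<in> carrier G"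
  proof
    assume "conj_by G (inv g) L \<subseteq> K"
    then have "conj_by G g (conj_by G (inv g) L) \<subseteq> conj_by G g K"
      by (rule conj_by_mono)
    then show "L \<subseteq> conj_by G g K"
      using g assms by (simp add: conj_by_conj_by conj_by_one)
  next
    assume "L \<subseteq> conj_by G g K"
    then have "conj_by G (inv g) L \<subseteq> conj_by G (inv g) (conj_by G g K)"
      by (rule conj_by_mono)
    then show "conj_by G (inv g) L \<subseteq> K"
      using g assms by (simp add: conj_by_conj_by conj_by_one)
  qed
  then show ?thesis
    unfolding Hom_P_def by blast
qed

section \<open>Functions constant on double cosets\<close>

context Group.group
begin

text \<open>Two points of one double coset lie in exactly the same double cosets of the expansion,
  so the sums agree term by term.\<close>

lemma hecke_fun_invariant:
  assumes "cring R" and f: "hecke_fun G R A B f" and A: "subgroup A G" and B: "subgroup B G"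
    and g: "g \<in> carrier G" and g': "g' \<in> dcoset G A g B"
  shows "f g' = f g"
proof -
  interpret R: cring R by fact
  obtain S c where S: "S \<subseteq> carrier G" "c \<in> S \<rightarrow> carrier R"
    and f: "\<And>g. g \<in> carrier G \<Longrightarrow> f g = (\<Oplus>\<^bsub>R\<^esub> \<sigma>\<in>S. if g \<in> dcoset G A \<sigma> B then c \<sigma> else \<zero>\<^bsub>R\<^esub>)"
    using f unfolding hecke_fun_def by blast
  have gc: "g' \<in> carrier G"
    using dcoset_carrier[OF subgroup.subset[OF A] subgroup.subset[OF B] g] g' by blast
  have "g' \<in> dcoset G A \<sigma> B \<longleftrightarrow> g \<in> dcoset G A \<sigma> B" if "\<sigma> \<in> S" for \<sigma>
    using dcoset_trans[OF A B _ _ g'] dcoset_trans[OF A B _ _ dcoset_sym[OF A B g g']] S that by blast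
  then show ?thesis
    unfolding f[OF g] f[OF gc] using S(2) by (intro R.finsum_cong') auto
qed

lemma hecke_fun_closed:
  assumes "cring R" "hecke_fun G R A B f" "g \<in> carrier G"
  shows "f g \<in> carrier R"
proof -
  interpret R: cring R by fact
  obtain S c where S: "S \<subseteq> carrier G" "c \<in> S \<rightarrow> carrier R"
    and f: "\<And>g. g \<in> carrier G \<Longrightarrow> f g = (\<Oplus>\<^bsub>R\<^esub> \<sigma>\<in>S. if g \<in> dcoset G A \<sigma> B then c \<sigma> else \<zero>\<^bsub>R\<^esub>)"
    using assms(2) unfolding hecke_fun_def by blast
  show ?thesis
    unfolding f[OF assms(3)] using S by (intro R.finsum_closed) auto
qed

lemma supp_dcoset:
  assumes "cring R" and f: "hecke_fun G R A B f" and A: "subgroup A G" and B: "subgroup B G" and x: "x \<in> supp G R f"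
  shows "dcoset G A x B \<subseteq> supp G R f"
proof
  fix y assume y: "y \<in> dcoset G A x B"
  have xc: "x \<in> carrier G" using x by (simp add: supp_def)
  then have "y \<in> carrier G" "f y = f x"
    using dcoset_carrier[OF subgroup.subset[OF A] subgroup.subset[OF B]] y hecke_fun_invariant[OF assms(1) f A B _ y] by blast+
  then show "y \<in> supp G R f" using x by (simp add: supp_def)
qed

text \<open>At a point outside all double cosets listed in the expansion every term vanishes, so
  each representative lies in a listed one. The list may name a double coset twice; an injection of
  \<open>D\<close> into it is all that is needed.\<close>

lemma finite_supp_reps:
  assumes "cring R" and f: "hecke_fun G R A B f" and A: "subgroup A G" and B: "subgroup B G"
    and D: "dcoset_reps G A (supp G R f) B D"
  shows "finite D"
proof -
  interpret R: cring R by fact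
  obtain S c where S: "finite S" "S \<subseteq> carrier G"
    and f: "\<And>g. g \<in> carrier G \<Longrightarrow> f g = (\<Oplus>\<^bsub>R\<^esub> \<sigma>\<in>S. if g \<in> dcoset G A \<sigma> B then c \<sigma> else \<zero>\<^bsub>R\<^esub>)"
    using f unfolding hecke_fun_def by blast
  have sc: "supp G R f \<subseteq> carrier G" by (auto simp: supp_def)
  have "\<forall>d\<in>D. \<exists>\<sigma>\<in>S. d \<in> dcoset G A \<sigma> B"
  proof (rule ccontr)
    assume "\<not> ?thesis"
    then obtain d where d: "d \<in> D" "\<And>\<sigma>. \<sigma> \<in> S \<Longrightarrow> d \<notin> dcoset G A \<sigma> B" by blast
    have ds: "d \<in> supp G R f" using D d by (auto simp: dcoset_reps_def)
    then have "f d = (\<Oplus>\<^bsub>R\<^esub> \<sigma>\<in>S. if d \<in> dcoset G A \<sigma> B then c \<sigma> else \<zero>\<^bsub>R\<^esub>)"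
      using f[of d] by (simp add: supp_def)
    also have "\<dots> = (\<Oplus>\<^bsub>R\<^esub> \<sigma>\<in>S. \<zero>\<^bsub>R\<^esub>)"
      using d(2) by (intro R.finsum_cong') auto
    finally show False using ds by (simp add: supp_def)
  qed
  then obtain \<phi> where \<phi>: "\<And>d. d \<in> D \<Longrightarrow> \<phi> d \<in> S \<and> d \<in> dcoset G A (\<phi> d) B" by metis
  have "inj_on \<phi> D"
  proof (rule inj_onI)
    fix d e assume de: "d \<in> D" "e \<in> D" "\<phi> d = \<phi> e"
    have "\<phi> e \<in> carrier G" using \<phi>[OF de(2)] S by blast
    then have "\<phi> e \<in> dcoset G A e B" using dcoset_sym[OF A B] \<phi>[OF de(2)] by blast
    moreover have "e \<in> carrier G" using D de sc by (auto simp: dcoset_reps_def)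
    ultimately have "d \<in> dcoset G A e B" using dcoset_trans[OF A B] \<phi>[OF de(1)] de(3) by metis
    then show "d = e" using dcoset_reps_uniq[OF D A B sc de(1,2)] by simp
  qed
  moreover have "\<phi> ` D \<subseteq> S" using \<phi> by blast
  ultimately show ?thesis using S(1) by (meson finite_subset finite_imageD)
qed

end

section \<open>Levels, and Hecke correspondences on one functor\<close>

context level_structure
begin

lemma level_subgroup: "K \<in> \<Upsilon> \<Longrightarrow> subgroup K G"
  using compact_open by (simp add: compact_open_subgroup_def)

lemma level_subset: "K \<in> \<Upsilon> \<Longrightarrow> K \<subseteq> carrier G"
  using level_subgroup subgroup.subset by blast

lemma level_Hom_P_iff:
  "L \<in> \<Upsilon> \<Longrightarrow> K \<in> \<Upsilon> \<Longrightarrow> g \<in> Hom_P G L K \<longleftrightarrow> g \<in> carrier G \<and> L \<subseteq> conj_by G g K"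
  by (simp add: Hom_P_iff level_subset)

lemma level_Hom_P_one: "L \<in> \<Upsilon> \<Longrightarrow> K \<in> \<Upsilon> \<Longrightarrow> L \<subseteq> K \<Longrightarrow> \<one> \<in> Hom_P G L K"
  by (simp add: level_Hom_P_iff conj_by_one level_subset)

lemma level_conj_inv:
  "K \<in> \<Upsilon> \<Longrightarrow> g \<in> carrier G \<Longrightarrow> conj_by G (inv g) (conj_by G g K) = K"
  "K \<in> \<Upsilon> \<Longrightarrow> g \<in> carrier G \<Longrightarrow> conj_by G g (conj_by G (inv g) K) = K"
  by (simp_all add: conj_by_conj_by level_subset conj_by_one)

end

context ric_functor
begin

lemma push_closed:
  "L \<in> \<Upsilon> \<Longrightarrow> K \<in> \<Upsilon> \<Longrightarrow> g \<in> Hom_P G L K \<Longrightarrow> x \<in> carrier (obj M L) \<Longrightarrow>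
    push M L K g x \<in> carrier (obj M K)"
  using mod_homD(1)[OF push_hom] .

lemma pull_closed:
  "L \<in> \<Upsilon> \<Longrightarrow> K \<in> \<Upsilon> \<Longrightarrow> g \<in> Hom_P G L K \<Longrightarrow> x \<in> carrier (obj M K) \<Longrightarrow>
    pull M L K g x \<in> carrier (obj M L)"
  using mod_homD(1)[OF pull_hom] .

lemma push_eq_pull:
  assumes "K \<in> \<Upsilon>" "g \<in> carrier G" "x \<in> carrier (obj M (conj_by G g K))"
  shows "push M (conj_by G g K) K g x = pull M K (conj_by G g K) (inv g) x"
  using pull_eq_push_inv[of K "conj_by G g K" "inv g" x] assms T1 by simp

text \<open>The middle map of the correspondence is a pullback along an isomorphism, hence a push by
  \<sigma>, and it merges with the final projection. Everything below uses this form with one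
  pullback and one push.\<close>

lemma hecke_push_eq:
  assumes K: "K' \<in> \<Upsilon>" "K \<in> \<Upsilon>" and \<sigma>: "\<sigma> \<in> carrier G" and x: "x \<in> carrier (obj M K')"
  shows "hecke_push G M K' \<sigma> K x =
    push M (K' \<inter> conj_by G \<sigma> K) K \<sigma> (pull M (K' \<inter> conj_by G \<sigma> K) K' \<one> x)"
proof -
  define P where "P = K' \<inter> conj_by G \<sigma> K"
  define Q where "Q = K \<inter> conj_by G (inv \<sigma>) K'"
  have PQ: "P \<in> \<Upsilon>" "Q \<in> \<Upsilon>" "P \<subseteq> K'" "Q \<subseteq> K"
    using K \<sigma> T1 T3 by (auto simp: P_def Q_def)
  have conj: "conj_by G \<sigma> Q = P"
    using K \<sigma> unfolding P_def Q_def
    by (subst conj_by_Int) (auto simp: level_conj_inv level_subset conj_by_carrier)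
  define z where "z = pull M P K' \<one> x"
  have z: "z \<in> carrier (obj M P)"
    unfolding z_def using PQ K x by (intro pull_closed level_Hom_P_one)
  have s: "\<sigma> \<in> Hom_P G P Q" "\<one> \<in> Hom_P G Q K"
    using conj PQ K \<sigma> by (simp_all add: level_Hom_P_iff conj_by_one level_subset)
  have "hecke_push G M K' \<sigma> K x = push M Q K \<one> (pull M Q P (inv \<sigma>) z)"
    using \<sigma> by (simp add: hecke_push_def hecke_def P_def Q_def z_def)
  also have "pull M Q P (inv \<sigma>) z = push M P Q \<sigma> z"
    using pull_eq_push_inv[of Q P "inv \<sigma>" z] PQ conj \<sigma> z by simp
  also have "push M Q K \<one> (push M P Q \<sigma> z) = push M P K \<sigma> z"
    using push_comp[OF PQ(1,2) K(2) s z] \<sigma> by simp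
  finally show ?thesis by (simp add: P_def z_def)
qed

lemma hecke_push_closed:
  assumes "K' \<in> \<Upsilon>" "K \<in> \<Upsilon>" "\<sigma> \<in> carrier G" "x \<in> carrier (obj M K')"
  shows "hecke_push G M K' \<sigma> K x \<in> carrier (obj M K)"
  unfolding hecke_push_eq[OF assms]
  using assms T1 T3 by (intro push_closed pull_closed level_Hom_P_one) (auto simp: level_Hom_P_iff)

lemma hecke_push_mod_hom:
  assumes "K' \<in> \<Upsilon>" "K \<in> \<Upsilon>" "\<sigma> \<in> carrier G"
  shows "hecke_push G M K' \<sigma> K \<in> mod_hom R (obj M K') (obj M K)"
proof -
  define P where "P = K' \<inter> conj_by G \<sigma> K"
  have P: "P \<in> \<Upsilon>" "P \<subseteq> K'" "\<sigma> \<in> Hom_P G P K"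
    using assms T1 T3 by (auto simp: P_def level_Hom_P_iff)
  note push = mod_homD[OF push_hom[OF P(1) assms(2) P(3)]]
    and pull = mod_homD[OF pull_hom[OF P(1) assms(1) level_Hom_P_one[OF P(1) assms(1) P(2)]]]
  interpret K': Module.module R "obj M K'" by (rule module_obj) fact
  show ?thesis
    by (simp add: mod_hom_def hecke_push_eq[OF assms] P_def[symmetric] push pull)
qed

text \<open>Since g and \<sigma> commute, conjugation by g maps K \<inter> \<sigma> K \<sigma>^-1 to
  the same intersection formed from g K g^-1.\<close>

lemma hecke_push_push_commute:
  assumes K: "K \<in> \<Upsilon>" and \<sigma>: "\<sigma> \<in> carrier G" and g: "g \<in> carrier G" and comm: "\<sigma> \<otimes> g = g \<otimes> \<sigma>"
    and x: "x \<in> carrier (obj M (conj_by G g K))"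
  shows "hecke_push G M K \<sigma> K (push M (conj_by G g K) K g x) =
    push M (conj_by G g K) K g (hecke_push G M (conj_by G g K) \<sigma> (conj_by G g K) x)"
proof -
  define K1 where "K1 = conj_by G g K"
  define P where "P = K \<inter> conj_by G \<sigma> K"
  define P1 where "P1 = K1 \<inter> conj_by G \<sigma> K1"
  have L: "K1 \<in> \<Upsilon>" "P \<in> \<Upsilon>" "P1 \<in> \<Upsilon>" "P \<subseteq> K" "P1 \<subseteq> K1"
    "P \<subseteq> conj_by G \<sigma> K" "P1 \<subseteq> conj_by G \<sigma> K1"
    using K \<sigma> g T1 T3 by (auto simp: K1_def P_def P1_def)
  have conj: "P1 = conj_by G g P"
    using K \<sigma> g comm unfolding P_def P1_def K1_def
    by (subst conj_by_Int) (simp_all add: conj_by_conj_by level_subset conj_by_carrier)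
  define z where "z = pull M P1 K1 \<one> x"
  have z: "z \<in> carrier (obj M P1)"
    unfolding z_def using L x by (intro pull_closed level_Hom_P_one) (simp_all add: K1_def)
  have homs: "\<one> \<in> Hom_P G P K" "\<one> \<in> Hom_P G P1 K1" "g \<in> Hom_P G P1 P" "\<sigma> \<in> Hom_P G P K"
    "\<sigma> \<in> Hom_P G P1 K1" "g \<in> Hom_P G K1 K"
    using L K \<sigma> g equalityD1[OF conj]
    by (simp_all add: level_Hom_P_iff conj_by_one level_subset) (simp_all add: K1_def)
  have homs': "inv g \<in> Hom_P G K K1" "inv g \<in> Hom_P G P P1"
    using L K g by (auto simp: level_Hom_P_iff conj K1_def level_conj_inv)
  have xc: "push M K1 K g x \<in> carrier (obj M K)"
    using L K homs x by (intro push_closed) (simp_all add: K1_def)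
  have x1: "x \<in> carrier (obj M K1)" using x by (simp add: K1_def)
  \<comment> \<open>As [g]_* belongs to an isomorphism it is also a pullback, and pullbacks compose;
    once exchanged with the projection it is turned back into a push.\<close>
  have "pull M P K \<one> (push M K1 K g x) = pull M P K \<one> (pull M K K1 (inv g) x)"
    using push_eq_pull[OF K g x] by (simp add: K1_def)
  also have "\<dots> = pull M P K1 (inv g) x"
    using pull_comp[OF L(2) K L(1) homs(1) homs'(1) x1] g by simp
  also have "\<dots> = pull M P P1 (inv g) z"
    using pull_comp[OF L(2,3,1) homs'(2) homs(2) x1] g by (simp add: z_def)
  also have "\<dots> = push M P1 P g z"
    using push_eq_pull[OF L(2) g] z by (simp add: conj)
  finally have *: "pull M P K \<one> (push M K1 K g x) = push M P1 P g z" .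
  have "hecke_push G M K \<sigma> K (push M K1 K g x) = push M P K \<sigma> (push M P1 P g z)"
    using hecke_push_eq[OF K K \<sigma> xc] * by (simp add: P_def)
  also have "\<dots> = push M P1 K (\<sigma> \<otimes> g) z"
    using push_comp[OF L(3,2) K homs(3,4) z] comm by simp
  also have "\<dots> = push M K1 K g (push M P1 K1 \<sigma> z)"
    using push_comp[OF L(3,1) K homs(5,6) z] .
  also have "push M P1 K1 \<sigma> z = hecke_push G M K1 \<sigma> K1 x"
    using hecke_push_eq[OF L(1,1) \<sigma> x1] by (simp add: P1_def z_def)
  finally show ?thesis by (simp add: K1_def)
qed

end

section \<open>Mackey pushforwards followed by Hecke correspondences\<close>

locale functor_pushforward =
  mackey_pushforward G T \<Upsilon>\<^sub>G H \<Upsilon>\<^sub>H R N M \<iota> +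
  M: ric_functor G T \<Upsilon>\<^sub>G R M + N: ric_functor "G\<lparr>carrier := H\<rparr>" TH \<Upsilon>\<^sub>H R N
  for G :: "('g, 'b) monoid_scheme" (structure) and T \<Upsilon>\<^sub>G H \<Upsilon>\<^sub>H R N M \<iota> TH
begin

lemma H_subset: "H \<subseteq> carrier G"
  using subgroup_H subgroup.subset by blast

lemma conj_by_H: "h \<in> H \<Longrightarrow> conj_by (G\<lparr>carrier := H\<rparr>) h A = conj_by G h A"
  by (simp add: conj_by_def l_coset_def r_coset_def m_inv_consistent subgroup_H)

lemma inv_H: "h \<in> H \<Longrightarrow> inv h \<in> H"
  using subgroup_H by (rule subgroup.m_inv_closed)

lemma Hom_P_H:
  "V \<in> \<Upsilon>\<^sub>H \<Longrightarrow> W \<in> \<Upsilon>\<^sub>H \<Longrightarrow> h \<in> Hom_P (G\<lparr>carrier := H\<rparr>) V W \<longleftrightarrow> h \<in> H \<and> V \<subseteq> conj_by G h W"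
  by (subst N.level_Hom_P_iff) (auto simp: conj_by_H)

lemma level_H_subset: "V \<in> \<Upsilon>\<^sub>H \<Longrightarrow> V \<subseteq> H"
  using N.level_subset by auto

lemma level_Int_H: "K \<in> \<Upsilon>\<^sub>G \<Longrightarrow> K \<inter> H \<in> \<Upsilon>\<^sub>H"
  using levels by blast

lemma level_Int: "V \<in> \<Upsilon>\<^sub>H \<Longrightarrow> K \<in> \<Upsilon>\<^sub>G \<Longrightarrow> V \<inter> K \<in> \<Upsilon>\<^sub>H"
proof -
  assume V: "V \<in> \<Upsilon>\<^sub>H" "K \<in> \<Upsilon>\<^sub>G"
  then have "V \<inter> (K \<inter> H) \<in> \<Upsilon>\<^sub>H" using level_Int_H N.T3 by blast
  moreover have "V \<inter> (K \<inter> H) = V \<inter> K" using level_H_subset V by blast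
  ultimately show ?thesis by simp
qed

lemma \<iota>_closed:
  "V \<in> \<Upsilon>\<^sub>H \<Longrightarrow> K \<in> \<Upsilon>\<^sub>G \<Longrightarrow> V \<subseteq> K \<Longrightarrow> x \<in> carrier (obj N V) \<Longrightarrow> \<iota> V K x \<in> carrier (obj M K)"
  using mod_homD(1)[OF hom] .

lemma \<iota>_push:
  assumes V: "V \<in> \<Upsilon>\<^sub>H" "V' \<in> \<Upsilon>\<^sub>H" and K: "K \<in> \<Upsilon>\<^sub>G" "L' \<in> \<Upsilon>\<^sub>G" and VK: "V \<subseteq> K" "V' \<subseteq> L'" and h: "h \<in> H"
    and sub: "V' \<subseteq> conj_by G h V" "L' \<subseteq> conj_by G h K" and x: "x \<in> carrier (obj N V')"
  shows "\<iota> V K (push N V' V h x) = push M L' K h (\<iota> V' L' x)"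
proof (rule push[OF V K VK h _ _ x])
  have hc: "h \<in> carrier G" using h H_subset by blast
  have "h \<in> Hom_P (G\<lparr>carrier := H\<rparr>) V' V"
    using Hom_P_H V sub h by blast
  then show "conj_by G (inv h) V' \<subseteq> V"
    using h by (simp add: Hom_P_def conj_by_H inv_H m_inv_consistent subgroup_H)
  have "h \<in> Hom_P G L' K"
    using M.level_Hom_P_iff K sub hc by blast
  then show "conj_by G (inv h) L' \<subseteq> K"
    by (simp add: Hom_P_def)
qed

text \<open>This is \<open>\<Phi>(d)\<close> in the notation of the introduction.\<close>

definition dcoset_term :: "'g set \<Rightarrow> 'g set \<Rightarrow> 'd \<Rightarrow> 'g \<Rightarrow> 'e" where
  "dcoset_term V K x d = push M (conj_by G d K) K d
     (\<iota> (V \<inter> conj_by G d K) (conj_by G d K) (pull N (V \<inter> conj_by G d K) V \<one> x))"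

context
  fixes V K x
  assumes V: "V \<in> \<Upsilon>\<^sub>H" and K: "K \<in> \<Upsilon>\<^sub>G" and VK: "V \<subseteq> K" and x: "x \<in> carrier (obj N V)"
begin

lemma dcoset_term_levels:
  assumes "d \<in> carrier G"
  shows "conj_by G d K \<in> \<Upsilon>\<^sub>G" "V \<inter> conj_by G d K \<in> \<Upsilon>\<^sub>H" "d \<in> Hom_P G (conj_by G d K) K"
    "pull N (V \<inter> conj_by G d K) V \<one> x \<in> carrier (obj N (V \<inter> conj_by G d K))"
    "\<iota> (V \<inter> conj_by G d K) (conj_by G d K) (pull N (V \<inter> conj_by G d K) V \<one> x)
      \<in> carrier (obj M (conj_by G d K))"
proof -
  show 1: "conj_by G d K \<in> \<Upsilon>\<^sub>G" using M.T1 K assms by blast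
  show 2: "V \<inter> conj_by G d K \<in> \<Upsilon>\<^sub>H" using level_Int V 1 by blast
  show "d \<in> Hom_P G (conj_by G d K) K" using M.level_Hom_P_iff 1 K assms by blast
  show 3: "pull N (V \<inter> conj_by G d K) V \<one> x \<in> carrier (obj N (V \<inter> conj_by G d K))"
    using N.pull_closed[OF 2 V _ x] N.level_Hom_P_one[OF 2 V] by simp
  show "\<iota> (V \<inter> conj_by G d K) (conj_by G d K) (pull N (V \<inter> conj_by G d K) V \<one> x)
      \<in> carrier (obj M (conj_by G d K))"
    using \<iota>_closed[OF 2 1 _ 3] by simp
qed

lemma dcoset_term_closed: "d \<in> carrier G \<Longrightarrow> dcoset_term V K x d \<in> carrier (obj M K)"
  unfolding dcoset_term_def using dcoset_term_levels K by (intro M.push_closed)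

text \<open>d K d^-1 does not change when d is multiplied by k on the right, and [k]_* is the
  identity of M(K). Hence \<Phi> may be evaluated at any element of d K.\<close>

lemma dcoset_term_right:
  assumes d: "d \<in> carrier G" and k: "k \<in> K"
  shows "dcoset_term V K x (d \<otimes> k) = dcoset_term V K x d"
proof -
  have kc: "k \<in> carrier G" using k K M.level_subset by blast
  have eq: "conj_by G (d \<otimes> k) K = conj_by G d K"
    using conj_by_conj_by[OF d kc M.level_subset[OF K]] conj_by_subgroup[OF M.level_subgroup[OF K] k]
    by simp
  note lev = dcoset_term_levels[OF d]
  have "k \<in> Hom_P G K K"
    using M.level_Hom_P_iff[OF K K] kc conj_by_subgroup[OF M.level_subgroup[OF K] k] by simp
  then have "push M (conj_by G d K) K (d \<otimes> k) y = push M K K k (push M (conj_by G d K) K d y)"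
    if "y \<in> carrier (obj M (conj_by G d K))" for y
    using M.push_comp[OF lev(1) K K lev(3) _ that] by simp
  moreover have "push M K K k (push M (conj_by G d K) K d y) = push M (conj_by G d K) K d y"
    if "y \<in> carrier (obj M (conj_by G d K))" for y
    using M.push_inner[OF K k] M.push_closed[OF lev(1) K lev(3) that] by simp
  ultimately show ?thesis
    unfolding dcoset_term_def eq using lev(5) by simp
qed

text \<open>[h g]_* is [h]_* followed by [g]_*, and \<iota> commutes with [h]_* because h lies in
  \<open>H\<close>. What is left inside \<iota>, a restriction followed by [h]_*, is the
  correspondence of h for the group \<open>H\<close>.\<close>

lemma dcoset_term_mult:
  assumes h: "h \<in> H" and g: "g \<in> carrier G"
  defines "K1 \<equiv> conj_by G g K"
  shows "dcoset_term V K x (h \<otimes> g) =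
    push M K1 K g (\<iota> (H \<inter> K1) K1 (hecke_push (G\<lparr>carrier := H\<rparr>) N V h (H \<inter> K1) x))"
proof -
  define D where "D = conj_by G (h \<otimes> g) K"
  have hc: "h \<in> carrier G" using h H_subset by blast
  have K1: "K1 \<in> \<Upsilon>\<^sub>G" using M.T1 K g by (simp add: K1_def)
  have HK1: "H \<inter> K1 \<in> \<Upsilon>\<^sub>H" using level_Int_H[OF K1] by (simp add: Int_commute)
  note lev = dcoset_term_levels[OF m_closed[OF hc g], folded D_def]
  have D: "D = conj_by G h K1"
    using conj_by_conj_by[OF hc g M.level_subset[OF K]] by (simp add: D_def K1_def)
  \<comment> \<open>Conjugation by h preserves \<open>H\<close>, and \<open>V\<close> is contained
    in \<open>H\<close>, so intersecting with \<open>H\<close> changes nothing.\<close>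
  have VD: "V \<inter> conj_by G h (H \<inter> K1) = V \<inter> D"
    using conj_by_Int[OF hc H_subset M.level_subset[OF K1]] conj_by_subgroup[OF subgroup_H h]
      level_H_subset[OF V] D by blast
  have hh: "h \<in> Hom_P G D K1" "g \<in> Hom_P G K1 K"
    using M.level_Hom_P_iff[OF lev(1) K1] hc D M.level_Hom_P_iff[OF K1 K] g by (auto simp: K1_def)
  define z where "z = pull N (V \<inter> D) V \<one> x"
  have z: "z \<in> carrier (obj N (V \<inter> D))" using lev(4) by (simp add: z_def)
  have z1: "\<iota> (V \<inter> D) D z \<in> carrier (obj M D)" using lev(5) by (simp add: z_def)
  have "hecke_push (G\<lparr>carrier := H\<rparr>) N V h (H \<inter> K1) x = push N (V \<inter> D) (H \<inter> K1) h z"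
    using N.hecke_push_eq[OF V HK1 _ x, of h] h by (simp add: conj_by_H VD z_def)
  also have "\<iota> (H \<inter> K1) K1 \<dots> = push M D K1 h (\<iota> (V \<inter> D) D z)"
    using VD D by (intro \<iota>_push[OF HK1 lev(2) K1 lev(1) _ _ h _ _ z]) auto
  also have "push M K1 K g \<dots> = push M D K (h \<otimes> g) (\<iota> (V \<inter> D) D z)"
    using M.push_comp[OF lev(1) K1 K hh z1] by simp
  finally show ?thesis
    by (simp add: dcoset_term_def D_def z_def)
qed

text \<open>For \<gamma> in \<open>K\<close>, conjugating P = K \<inter> \<sigma> K \<sigma>^-1 by
  \<gamma> gives the intersection of \<open>K\<close> with the conjugate of \<open>K\<close> by
  \<gamma> \<sigma>. As \<open>V\<close> is contained in \<open>K\<close>, it meets both conjugates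
  in the same subgroup, so the Mackey summand at \<gamma> becomes the term at \<gamma> \<sigma>
  after applying [\<sigma>]_*.\<close>

lemma hecke_push_\<iota>_reps:
  assumes \<sigma>: "\<sigma> \<in> carrier G" and \<Gamma>: "dcoset_reps G V K (K \<inter> conj_by G \<sigma> K) \<Gamma>"
  shows "hecke_push G M K \<sigma> K (\<iota> V K x) = (\<Oplus>\<^bsub>obj M K\<^esub>\<gamma>\<in>\<Gamma>. dcoset_term V K x (\<gamma> \<otimes> \<sigma>))"
proof -
  define P where "P = K \<inter> conj_by G \<sigma> K"
  have P: "P \<in> \<Upsilon>\<^sub>G" "P \<subseteq> K" "P \<subseteq> conj_by G \<sigma> K"
    using K \<sigma> M.T1 M.T3 by (auto simp: P_def)
  have \<sigma>P: "\<sigma> \<in> Hom_P G P K" using M.level_Hom_P_iff[OF P(1) K] P \<sigma> by simp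
  define t where "t \<gamma> = push M (conj_by G \<gamma> P) P \<gamma>
      (\<iota> (V \<inter> conj_by G \<gamma> P) (conj_by G \<gamma> P) (pull N (V \<inter> conj_by G \<gamma> P) V \<one> x))" for \<gamma>
  have main: "t \<gamma> \<in> carrier (obj M P) \<and> push M P K \<sigma> (t \<gamma>) = dcoset_term V K x (\<gamma> \<otimes> \<sigma>)"
    if "\<gamma> \<in> \<Gamma>" for \<gamma>
  proof -
    have \<gamma>: "\<gamma> \<in> K" using \<Gamma> that by (auto simp: dcoset_reps_def)
    then have \<gamma>c: "\<gamma> \<in> carrier G" using M.level_subset K by blast
    define Q where "Q = conj_by G \<gamma> P"
    define D where "D = conj_by G (\<gamma> \<otimes> \<sigma>) K"
    note lev = dcoset_term_levels[OF m_closed[OF \<gamma>c \<sigma>], folded D_def]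
    have Q: "Q \<in> \<Upsilon>\<^sub>G" using M.T1 P \<gamma>c by (simp add: Q_def)
    have QD: "Q = K \<inter> D"
      unfolding Q_def P_def D_def using conj_by_subgroup[OF M.level_subgroup[OF K] \<gamma>] \<gamma>c \<sigma> K
      by (simp add: conj_by_Int conj_by_conj_by M.level_subset conj_by_carrier)
    then have VQ: "V \<inter> Q = V \<inter> D" using VK by blast
    define z where "z = pull N (V \<inter> D) V \<one> x"
    have z: "z \<in> carrier (obj N (V \<inter> D))" using lev(4) by (simp add: z_def)
    have z1: "\<iota> (V \<inter> D) Q z \<in> carrier (obj M Q)"
      using \<iota>_closed[OF lev(2) Q _ z] VQ by blast
    have homs: "\<gamma> \<in> Hom_P G Q P" "\<one> \<in> Hom_P G Q D"
      using M.level_Hom_P_iff[OF Q P(1)] \<gamma>c M.level_Hom_P_one[OF Q lev(1)] QD by (auto simp: Q_def)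
    have t: "t \<gamma> = push M Q P \<gamma> (\<iota> (V \<inter> D) Q z)"
      by (simp add: t_def Q_def[symmetric] VQ z_def)
    \<comment> \<open>The trivial push is inserted so that compatibility of \<iota> with pushes, for
      h = 1, compares the target levels \<open>Q\<close> and \<open>D\<close>.\<close>
    have "\<iota> (V \<inter> D) D z = \<iota> (V \<inter> D) D (push N (V \<inter> D) (V \<inter> D) \<one> z)"
      using N.push_one[OF lev(2) z] by simp
    also have "\<dots> = push M Q D \<one> (\<iota> (V \<inter> D) Q z)"
      using QD VQ z subgroup.one_closed[OF subgroup_H] M.level_subset[OF lev(1)] level_H_subset[OF lev(2)] H_subset
      by (intro \<iota>_push[OF lev(2) lev(2) lev(1) Q]) (auto simp: conj_by_one)
    finally have "dcoset_term V K x (\<gamma> \<otimes> \<sigma>) = push M D K (\<gamma> \<otimes> \<sigma>) (push M Q D \<one> (\<iota> (V \<inter> D) Q z))"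
      by (simp add: dcoset_term_def D_def z_def)
    also have "\<dots> = push M Q K (\<gamma> \<otimes> \<sigma>) (\<iota> (V \<inter> D) Q z)"
      using M.push_comp[OF Q lev(1) K homs(2) lev(3) z1] \<gamma>c \<sigma> by simp
    also have "\<dots> = push M P K \<sigma> (t \<gamma>)"
      using M.push_comp[OF Q P(1) K homs(1) \<sigma>P z1] t by simp
    finally show ?thesis
      using M.push_closed[OF Q P(1) homs(1) z1] t by simp
  qed
  have "hecke_push G M K \<sigma> K (\<iota> V K x) = push M P K \<sigma> (pull M P K \<one> (\<iota> V K x))"
    using M.hecke_push_eq[OF K K \<sigma> \<iota>_closed[OF V K VK x]] by (simp add: P_def)
  also have "\<dots> = push M P K \<sigma> (\<Oplus>\<^bsub>obj M P\<^esub>\<gamma>\<in>\<Gamma>. t \<gamma>)"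
    using mackey[OF V K P(1) VK P(2) \<Gamma>[folded P_def] x] by (simp add: t_def)
  also have "\<dots> = (\<Oplus>\<^bsub>obj M K\<^esub>\<gamma>\<in>\<Gamma>. push M P K \<sigma> (t \<gamma>))"
    using main by (intro mod_hom_finsum[OF M.module_obj[OF P(1)] M.module_obj[OF K] M.push_hom[OF P(1) K \<sigma>P]]) blast
  also have "\<dots> = (\<Oplus>\<^bsub>obj M K\<^esub>\<gamma>\<in>\<Gamma>. dcoset_term V K x (\<gamma> \<otimes> \<sigma>))"
  proof -
    interpret MK: Module.module R "obj M K" by (rule M.module_obj[OF K])
    have "\<gamma> \<in> \<Gamma> \<Longrightarrow> \<gamma> \<in> carrier G" for \<gamma>
      using \<Gamma> M.level_subset[OF K] by (auto simp: dcoset_reps_def)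
    then show ?thesis using main \<sigma> dcoset_term_closed by (intro MK.M.finsum_cong') auto
  qed
  finally show ?thesis .
qed

text \<open>\<open>hecke_push_\<iota>_reps\<close> speaks of products \<gamma> \<sigma>; arbitrary
  representatives differ from these by right factors in \<open>K\<close>, under which the terms are
  invariant.\<close>

lemma hecke_push_\<iota>:
  assumes \<sigma>: "\<sigma> \<in> carrier G" and D: "dcoset_reps G V (dcoset G K \<sigma> K) K D"
  shows "hecke_push G M K \<sigma> K (\<iota> V K x) = (\<Oplus>\<^bsub>obj M K\<^esub>d\<in>D. dcoset_term V K x d)"
proof -
  have sub: "subgroup V G"
    using subgroup_H N.level_subgroup[OF V] by (rule incl_subgroup)
  obtain \<gamma> where \<gamma>: "inj_on \<gamma> D" "dcoset_reps G V K (K \<inter> conj_by G \<sigma> K) (\<gamma> ` D)"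
    "\<And>d. d \<in> D \<Longrightarrow> \<gamma> d \<in> K \<and> (\<exists>k\<in>K. d = \<gamma> d \<otimes> \<sigma> \<otimes> k)"
    by (rule dcoset_reps_transfer[OF sub M.level_subgroup[OF K] VK \<sigma> D]) (rule that)
  interpret MK: Module.module R "obj M K" by (rule M.module_obj[OF K])
  have \<gamma>c: "\<gamma> d \<in> carrier G" if "d \<in> D" for d
    using \<gamma>(3)[OF that] M.level_subset[OF K] by blast
  have "dcoset_term V K x d = dcoset_term V K x (\<gamma> d \<otimes> \<sigma>)" if "d \<in> D" for d
    using \<gamma>(3)[OF that] dcoset_term_right[OF m_closed[OF \<gamma>c[OF that] \<sigma>]] by metis
  then have "(\<Oplus>\<^bsub>obj M K\<^esub>d\<in>D. dcoset_term V K x d) = (\<Oplus>\<^bsub>obj M K\<^esub>d\<in>D. dcoset_term V K x (\<gamma> d \<otimes> \<sigma>))"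
    using \<gamma>c \<sigma> dcoset_term_closed by (intro MK.M.finsum_cong') auto
  also have "\<dots> = (\<Oplus>\<^bsub>obj M K\<^esub>c\<in>\<gamma> ` D. dcoset_term V K x (c \<otimes> \<sigma>))"
    using \<gamma>c \<sigma> dcoset_term_closed \<gamma>(1) by (intro MK.M.finsum_reindex[symmetric]) auto
  also have "\<dots> = hecke_push G M K \<sigma> K (\<iota> V K x)"
    using hecke_push_\<iota>_reps[OF \<sigma> \<gamma>(2)] by simp
  finally show ?thesis by simp
qed

end

end

section \<open>Restricted tensor products\<close>

locale directed_system =
  fixes D :: "('i::order) set" and A :: "'i \<Rightarrow> ('r, 'a) module" and \<phi> :: "'i \<Rightarrow> 'i \<Rightarrow> 'a \<Rightarrow> 'a" and R :: "('r, 'c) ring_scheme"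
  assumes directed: "i \<in> D \<Longrightarrow> j \<in> D \<Longrightarrow> \<exists>k\<in>D. i \<le> k \<and> j \<le> k"
    and \<phi>_hom: "i \<in> D \<Longrightarrow> j \<in> D \<Longrightarrow> i \<le> j \<Longrightarrow> \<phi> i j \<in> mod_hom R (A i) (A j)"
    and \<phi>_comp: "i \<in> D \<Longrightarrow> j \<in> D \<Longrightarrow> k \<in> D \<Longrightarrow> i \<le> j \<Longrightarrow> j \<le> k \<Longrightarrow> a \<in> carrier (A i) \<Longrightarrow>
      \<phi> j k (\<phi> i j a) = \<phi> i k a"
    and add_closed: "i \<in> D \<Longrightarrow> a \<in> carrier (A i) \<Longrightarrow> b \<in> carrier (A i) \<Longrightarrow> a \<oplus>\<^bsub>A i\<^esub> b \<in> carrier (A i)"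
    and smult_closed: "i \<in> D \<Longrightarrow> r \<in> carrier R \<Longrightarrow> a \<in> carrier (A i) \<Longrightarrow> r \<odot>\<^bsub>A i\<^esub> a \<in> carrier (A i)"
begin

abbreviation "cls \<equiv> dirlim_class D A \<phi>"

lemma cls_iff: "(j, b) \<in> cls i a \<longleftrightarrow>
    j \<in> D \<and> b \<in> carrier (A j) \<and> (\<exists>k\<in>D. i \<le> k \<and> j \<le> k \<and> \<phi> i k a = \<phi> j k b)"
  by (simp add: dirlim_class_def)

lemma later:
  assumes "i \<in> D" "j \<in> D" "k \<in> D" "l \<in> D" "i \<le> k" "j \<le> k" "k \<le> l" "a \<in> carrier (A i)" "b \<in> carrier (A j)"
    and "\<phi> i k a = \<phi> j k b"
  shows "\<phi> i l a = \<phi> j l b"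
  using assms \<phi>_comp[of i k l a] \<phi>_comp[of j k l b] by simp

text \<open>Eventual equality is transitive: two indices at which equalities hold have a common
  upper bound, where both persist.\<close>

lemma cls_eq:
  assumes i: "i \<in> D" "a \<in> carrier (A i)" and jb: "(j, b) \<in> cls i a"
  shows "cls i a = cls j b"
proof -
  obtain k where j: "j \<in> D" "b \<in> carrier (A j)" and k: "k \<in> D" "i \<le> k" "j \<le> k" "\<phi> i k a = \<phi> j k b"
    using jb by (auto simp: cls_iff)
  have *: "(\<exists>m\<in>D. i \<le> m \<and> l \<le> m \<and> \<phi> i m a = \<phi> l m c) \<longleftrightarrow> (\<exists>m\<in>D. j \<le> m \<and> l \<le> m \<and> \<phi> j m b = \<phi> l m c)"
    if l: "l \<in> D" "c \<in> carrier (A l)" for l c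
  proof
    assume "\<exists>m\<in>D. i \<le> m \<and> l \<le> m \<and> \<phi> i m a = \<phi> l m c"
    then obtain m where m: "m \<in> D" "i \<le> m" "l \<le> m" "\<phi> i m a = \<phi> l m c" by blast
    obtain n where n: "n \<in> D" "k \<le> n" "m \<le> n" using directed k(1) m(1) by blast
    have "\<phi> i n a = \<phi> j n b" by (rule later[of i j k]) (use i j k n in auto)
    moreover have "\<phi> i n a = \<phi> l n c" by (rule later[of i l m]) (use i l m n in auto)
    moreover have "j \<le> n" "l \<le> n" using k m n by auto
    ultimately show "\<exists>m\<in>D. j \<le> m \<and> l \<le> m \<and> \<phi> j m b = \<phi> l m c" using n(1) by auto
  next
    assume "\<exists>m\<in>D. j \<le> m \<and> l \<le> m \<and> \<phi> j m b = \<phi> l m c"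
    then obtain m where m: "m \<in> D" "j \<le> m" "l \<le> m" "\<phi> j m b = \<phi> l m c" by blast
    obtain n where n: "n \<in> D" "k \<le> n" "m \<le> n" using directed k(1) m(1) by blast
    have "\<phi> i n a = \<phi> j n b" by (rule later[of i j k]) (use i j k n in auto)
    moreover have "\<phi> j n b = \<phi> l n c" by (rule later[of j l m]) (use j l m n in auto)
    moreover have "i \<le> n" "l \<le> n" using k m n by auto
    ultimately show "\<exists>m\<in>D. i \<le> m \<and> l \<le> m \<and> \<phi> i m a = \<phi> l m c" using n(1) by auto
  qed
  have "(l, c) \<in> cls i a \<longleftrightarrow> (l, c) \<in> cls j b" for l c
    unfolding cls_iff using *[of l c] by blast
  then show ?thesis
    by (intro Set.set_eqI) (metis surj_pair)
qed

lemma cls_self: "i \<in> D \<Longrightarrow> a \<in> carrier (A i) \<Longrightarrow> (i, a) \<in> cls i a"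
  by (auto simp: cls_iff)

lemma cls_map:
  assumes "i \<in> D" "k \<in> D" "i \<le> k" "a \<in> carrier (A i)"
  shows "cls k (\<phi> i k a) = cls i a"
proof -
  have "\<phi> i k a \<in> carrier (A k)" using mod_homD(1)[OF \<phi>_hom] assms by blast
  then have "(k, \<phi> i k a) \<in> cls i a"
    unfolding cls_iff using \<phi>_comp[of i k k a] assms by auto
  then show ?thesis using cls_eq[OF assms(1,4)] by simp
qed

lemma cls_eqI:
  assumes "i \<in> D" "j \<in> D" "k \<in> D" "i \<le> k" "j \<le> k" "a \<in> carrier (A i)" "b \<in> carrier (A j)"
    and "\<phi> i k a = \<phi> j k b"
  shows "cls i a = cls j b"
  using cls_map[of i k a] cls_map[of j k b] assms by simp

text \<open>The sum in \<open>dirlim\<close> is a union over all representatives and all upper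
  bounds. By \<open>*\<close> every set in this union is the same class, so the union is that
  class.\<close>

lemma cls_add:
  assumes i: "i \<in> D" and a: "a \<in> carrier (A i)" and b: "b \<in> carrier (A i)"
  shows "cls i a \<oplus>\<^bsub>dirlim D A \<phi>\<^esub> cls i b = cls i (a \<oplus>\<^bsub>A i\<^esub> b)"
proof -
  have *: "cls k (\<phi> j k a' \<oplus>\<^bsub>A k\<^esub> \<phi> l k b') = cls i (a \<oplus>\<^bsub>A i\<^esub> b)"
    if ja: "(j, a') \<in> cls i a" and lb: "(l, b') \<in> cls i b" and k: "k \<in> D" "j \<le> k" "l \<le> k" for j a' l b' k
  proof -
    obtain m where j: "j \<in> D" "a' \<in> carrier (A j)" and m: "m \<in> D" "i \<le> m" "j \<le> m" "\<phi> i m a = \<phi> j m a'"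
      using ja by (auto simp: cls_iff)
    obtain n where l: "l \<in> D" "b' \<in> carrier (A l)" and n: "n \<in> D" "i \<le> n" "l \<le> n" "\<phi> i n b = \<phi> l n b'"
      using lb by (auto simp: cls_iff)
    obtain p where p: "p \<in> D" "m \<le> p" "n \<le> p" using directed m(1) n(1) by blast
    obtain q where q: "q \<in> D" "p \<le> q" "k \<le> q" using directed k(1) p(1) by blast
    have le: "i \<le> q" "j \<le> q" "l \<le> q" "m \<le> q" "n \<le> q" using m n p q by auto
    have 1: "\<phi> i q a = \<phi> j q a'" by (rule later[of i j m]) (use i a j m le q in auto)
    have 2: "\<phi> i q b = \<phi> l q b'" by (rule later[of i l n]) (use i b l n le q in auto)
    note hk = mod_homD[OF \<phi>_hom[OF k(1) q(1,3)]] and hi = mod_homD[OF \<phi>_hom[OF i q(1) le(1)]]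
      and hj = mod_homD[OF \<phi>_hom[OF j(1) k(1,2)]] and hl = mod_homD[OF \<phi>_hom[OF l(1) k(1,3)]]
    have "\<phi> k q (\<phi> j k a' \<oplus>\<^bsub>A k\<^esub> \<phi> l k b') = \<phi> j q a' \<oplus>\<^bsub>A q\<^esub> \<phi> l q b'"
      using hk(2)[OF hj(1)[OF j(2)] hl(1)[OF l(2)]] \<phi>_comp j l k q by simp
    also have "\<dots> = \<phi> i q (a \<oplus>\<^bsub>A i\<^esub> b)"
      using hi(2)[OF a b] 1 2 by simp
    finally show ?thesis
      using cls_eqI[OF k(1) i q(1,3) le(1)] add_closed i a b k hj(1)[OF j(2)] hl(1)[OF l(2)] by blast
  qed
  have "cls i a \<oplus>\<^bsub>dirlim D A \<phi>\<^esub> cls i b =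
    (\<Union>(j, a')\<in>cls i a. \<Union>(l, b')\<in>cls i b. \<Union>k\<in>{k\<in>D. j \<le> k \<and> l \<le> k}. cls k (\<phi> j k a' \<oplus>\<^bsub>A k\<^esub> \<phi> l k b'))"
    by (simp add: dirlim_def)
  also have "\<dots> = cls i (a \<oplus>\<^bsub>A i\<^esub> b)"
  proof (intro equalityI subsetI)
    fix z assume "z \<in> (\<Union>(j, a')\<in>cls i a. \<Union>(l, b')\<in>cls i b. \<Union>k\<in>{k\<in>D. j \<le> k \<and> l \<le> k}.
      cls k (\<phi> j k a' \<oplus>\<^bsub>A k\<^esub> \<phi> l k b'))"
    then show "z \<in> cls i (a \<oplus>\<^bsub>A i\<^esub> b)" using * by auto
  next
    fix z assume "z \<in> cls i (a \<oplus>\<^bsub>A i\<^esub> b)"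
    \<comment> \<open>This is the member of the union with representatives a and b and upper bound
      i.\<close>
    then have "z \<in> cls i (\<phi> i i a \<oplus>\<^bsub>A i\<^esub> \<phi> i i b)"
      using *[OF cls_self[OF i a] cls_self[OF i b] i] by simp
    then show "z \<in> (\<Union>(j, a')\<in>cls i a. \<Union>(l, b')\<in>cls i b. \<Union>k\<in>{k\<in>D. j \<le> k \<and> l \<le> k}.
      cls k (\<phi> j k a' \<oplus>\<^bsub>A k\<^esub> \<phi> l k b'))"
      using cls_self[OF i a] cls_self[OF i b] i by fast
  qed
  finally show ?thesis .
qed

lemma cls_smult:
  assumes i: "i \<in> D" and a: "a \<in> carrier (A i)" and r: "r \<in> carrier R"
  shows "r \<odot>\<^bsub>dirlim D A \<phi>\<^esub> cls i a = cls i (r \<odot>\<^bsub>A i\<^esub> a)"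
proof -
  have *: "cls j (r \<odot>\<^bsub>A j\<^esub> b) = cls i (r \<odot>\<^bsub>A i\<^esub> a)" if jb: "(j, b) \<in> cls i a" for j b
  proof -
    obtain k where j: "j \<in> D" "b \<in> carrier (A j)" and k: "k \<in> D" "i \<le> k" "j \<le> k" "\<phi> i k a = \<phi> j k b"
      using jb by (auto simp: cls_iff)
    have "\<phi> j k (r \<odot>\<^bsub>A j\<^esub> b) = \<phi> i k (r \<odot>\<^bsub>A i\<^esub> a)"
      using mod_homD(3)[OF \<phi>_hom] i a r j k by simp
    then show ?thesis
      using cls_eqI[OF j(1) i k(1,3,2)] smult_closed i a r j by blast
  qed
  have "r \<odot>\<^bsub>dirlim D A \<phi>\<^esub> cls i a = (\<Union>(j, b)\<in>cls i a. cls j (r \<odot>\<^bsub>A j\<^esub> b))"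
    by (simp add: dirlim_def)
  also have "\<dots> = cls i (r \<odot>\<^bsub>A i\<^esub> a)"
    using * cls_self[OF i a] by fast
  finally show ?thesis .
qed

lemma cls_closed: "i \<in> D \<Longrightarrow> a \<in> carrier (A i) \<Longrightarrow> cls i a \<in> carrier (dirlim D A \<phi>)"
  by (auto simp: dirlim_def)

end

section \<open>Free modules and generated submodules\<close>

lemma free_mod_module:
  fixes R :: "('r, 'c) ring_scheme" and S :: "'s set"
  assumes "cring R"
  shows "Module.module R (free_mod R S)"
proof -
  interpret R: cring R by fact
  let ?F = "free_mod R S"
  have add: "(\<lambda>s\<in>S. f s \<oplus>\<^bsub>R\<^esub> h s) \<in> carrier ?F" if "f \<in> carrier ?F" "h \<in> carrier ?F" for f h
  proof -
    have "{s \<in> S. (\<lambda>s\<in>S. f s \<oplus>\<^bsub>R\<^esub> h s) s \<noteq> \<zero>\<^bsub>R\<^esub>} \<subseteq> {s \<in> S. f s \<noteq> \<zero>\<^bsub>R\<^esub>} \<union> {s \<in> S. h s \<noteq> \<zero>\<^bsub>R\<^esub>}"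
      by auto
    moreover have "finite ({s \<in> S. f s \<noteq> \<zero>\<^bsub>R\<^esub>} \<union> {s \<in> S. h s \<noteq> \<zero>\<^bsub>R\<^esub>})"
      using that by (simp add: free_mod_def)
    ultimately have "finite {s \<in> S. (\<lambda>s\<in>S. f s \<oplus>\<^bsub>R\<^esub> h s) s \<noteq> \<zero>\<^bsub>R\<^esub>}" by (rule finite_subset)
    then show ?thesis using that by (auto simp: free_mod_def PiE_iff)
  qed
  have smult: "(\<lambda>s\<in>S. a \<otimes>\<^bsub>R\<^esub> f s) \<in> carrier ?F" if "a \<in> carrier R" "f \<in> carrier ?F" for a f
  proof -
    have "{s \<in> S. (\<lambda>s\<in>S. a \<otimes>\<^bsub>R\<^esub> f s) s \<noteq> \<zero>\<^bsub>R\<^esub>} \<subseteq> {s \<in> S. f s \<noteq> \<zero>\<^bsub>R\<^esub>}"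
      using that(1) by auto
    moreover have "finite {s \<in> S. f s \<noteq> \<zero>\<^bsub>R\<^esub>}" using that by (simp add: free_mod_def)
    ultimately have "finite {s \<in> S. (\<lambda>s\<in>S. a \<otimes>\<^bsub>R\<^esub> f s) s \<noteq> \<zero>\<^bsub>R\<^esub>}" by (rule finite_subset)
    then show ?thesis using that by (auto simp: free_mod_def PiE_iff)
  qed
  have val: "f s \<in> carrier R" if "f \<in> carrier ?F" "s \<in> S" for f s
    using that by (auto simp: free_mod_def)
  have eqI: "f = h" if "f \<in> extensional S" "h \<in> extensional S" "\<And>s. s \<in> S \<Longrightarrow> f s = h s" for f h :: "'s \<Rightarrow> 'r"
    using that by (rule extensionalityI)
  have e: "f \<in> extensional S" if "f \<in> carrier ?F" for f
    using that by (auto simp: free_mod_def PiE_iff)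
  show ?thesis
  proof (rule moduleI)
    show "abelian_group ?F"
    proof (rule abelian_groupI)
      fix f assume f: "f \<in> carrier ?F"
      \<comment> \<open>The negative is taken as the multiple by -1, so that its closure comes from
        \<open>smult\<close>.\<close>
      have "(\<lambda>s\<in>S. (\<ominus>\<^bsub>R\<^esub> \<one>\<^bsub>R\<^esub>) \<otimes>\<^bsub>R\<^esub> f s) \<in> carrier ?F" using f by (intro smult) simp_all
      moreover have "(\<lambda>s\<in>S. (\<ominus>\<^bsub>R\<^esub> \<one>\<^bsub>R\<^esub>) \<otimes>\<^bsub>R\<^esub> f s) \<oplus>\<^bsub>?F\<^esub> f = \<zero>\<^bsub>?F\<^esub>"
        using val[OF f] by (auto simp: free_mod_def R.l_minus R.l_neg intro!: restrict_ext)
      ultimately show "\<exists>h\<in>carrier ?F. h \<oplus>\<^bsub>?F\<^esub> f = \<zero>\<^bsub>?F\<^esub>" by blast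
    next
      fix f h assume "f \<in> carrier ?F" "h \<in> carrier ?F"
      then show "f \<oplus>\<^bsub>?F\<^esub> h \<in> carrier ?F" using add[of f h] by (simp add: free_mod_def)
    next
      fix f assume f: "f \<in> carrier ?F"
      show "\<zero>\<^bsub>?F\<^esub> \<oplus>\<^bsub>?F\<^esub> f = f"
        by (rule eqI) (simp_all add: free_mod_def val[OF f] e[OF f])
    next
      fix f h k assume f: "f \<in> carrier ?F" "h \<in> carrier ?F" "k \<in> carrier ?F"
      show "f \<oplus>\<^bsub>?F\<^esub> h \<oplus>\<^bsub>?F\<^esub> k = f \<oplus>\<^bsub>?F\<^esub> (h \<oplus>\<^bsub>?F\<^esub> k)"
        by (rule eqI) (simp_all add: free_mod_def R.a_assoc val[OF f(1)] val[OF f(2)] val[OF f(3)])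
    next
      fix f h assume f: "f \<in> carrier ?F" "h \<in> carrier ?F"
      show "f \<oplus>\<^bsub>?F\<^esub> h = h \<oplus>\<^bsub>?F\<^esub> f"
        by (rule eqI) (simp_all add: free_mod_def R.a_comm val[OF f(1)] val[OF f(2)])
    qed (simp add: free_mod_def)
  next
    fix a f assume "a \<in> carrier R" "f \<in> carrier ?F"
    then show "a \<odot>\<^bsub>?F\<^esub> f \<in> carrier ?F" using smult[of a f] by (simp add: free_mod_def)
  next
    fix f assume f: "f \<in> carrier ?F"
    show "\<one>\<^bsub>R\<^esub> \<odot>\<^bsub>?F\<^esub> f = f"
      by (rule eqI) (simp_all add: free_mod_def val[OF f] e[OF f])
  next
    fix a b f assume f: "a \<in> carrier R" "b \<in> carrier R" "f \<in> carrier ?F"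
    show "(a \<oplus>\<^bsub>R\<^esub> b) \<odot>\<^bsub>?F\<^esub> f = a \<odot>\<^bsub>?F\<^esub> f \<oplus>\<^bsub>?F\<^esub> b \<odot>\<^bsub>?F\<^esub> f"
      by (rule eqI) (simp_all add: free_mod_def R.l_distr val[OF f(3)] f(1,2))
    show "(a \<otimes>\<^bsub>R\<^esub> b) \<odot>\<^bsub>?F\<^esub> f = a \<odot>\<^bsub>?F\<^esub> (b \<odot>\<^bsub>?F\<^esub> f)"
      by (rule eqI) (simp_all add: free_mod_def R.m_assoc val[OF f(3)] f(1,2))
  next
    fix a f h assume f: "a \<in> carrier R" "f \<in> carrier ?F" "h \<in> carrier ?F"
    show "a \<odot>\<^bsub>?F\<^esub> (f \<oplus>\<^bsub>?F\<^esub> h) = a \<odot>\<^bsub>?F\<^esub> f \<oplus>\<^bsub>?F\<^esub> a \<odot>\<^bsub>?F\<^esub> h"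
      by (rule eqI) (simp_all add: free_mod_def R.r_distr val[OF f(2)] val[OF f(3)] f(1))
  qed fact
qed

lemma free_mod_val: "f \<in> carrier (free_mod R S) \<Longrightarrow> s \<in> S \<Longrightarrow> f s \<in> carrier R"
  by (auto simp: free_mod_def)

lemma free_basis_closed:
  assumes "cring R" "x \<in> S"
  shows "free_basis R S x \<in> carrier (free_mod R S)"
proof -
  interpret R: cring R by fact
  have "{s \<in> S. free_basis R S x s \<noteq> \<zero>\<^bsub>R\<^esub>} \<subseteq> {x}" by (auto simp: free_basis_def)
  then have "finite {s \<in> S. free_basis R S x s \<noteq> \<zero>\<^bsub>R\<^esub>}" by (rule finite_subset) simp
  then show ?thesis by (auto simp: free_mod_def free_basis_def)
qed

lemma submodule_submod_gen:
  assumes "Module.module R M" "X \<subseteq> carrier M"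
  shows "submodule (submod_gen R M X) R M" "X \<subseteq> submod_gen R M X"
proof -
  interpret Module.module R M by fact
  \<comment> \<open>The whole module is among the submodules intersected, which keeps the
    intersection inside the carrier.\<close>
  have top: "submodule (carrier M) R M" by (rule submoduleI) auto
  show "submodule (submod_gen R M X) R M"
  proof (rule submoduleI)
    show "submod_gen R M X \<subseteq> carrier M" using top assms(2) by (auto simp: submod_gen_def)
    show "\<zero>\<^bsub>M\<^esub> \<in> submod_gen R M X"
      unfolding submod_gen_def using subgroup.one_closed[OF submodule.axioms(1)] by fastforce
    fix a b assume a: "a \<in> submod_gen R M X"
    then show "\<ominus>\<^bsub>M\<^esub> a \<in> submod_gen R M X" using submoduleE(3) by (auto simp: submod_gen_def)
    assume b: "b \<in> submod_gen R M X"
    with a show "a \<oplus>\<^bsub>M\<^esub> b \<in> submod_gen R M X" using submoduleE(5) by (auto simp: submod_gen_def)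
  next
    fix r a assume "r \<in> carrier R" "a \<in> submod_gen R M X"
    then show "r \<odot>\<^bsub>M\<^esub> a \<in> submod_gen R M X" using submoduleE(4) by (auto simp: submod_gen_def)
  qed
  show "X \<subseteq> submod_gen R M X" by (auto simp: submod_gen_def)
qed

lemma submod_gen_least: "submodule S R M \<Longrightarrow> X \<subseteq> S \<Longrightarrow> submod_gen R M X \<subseteq> S"
  by (auto simp: submod_gen_def)

section \<open>Cosets and quotient modules\<close>

context
  fixes R :: "('r, 'c) ring_scheme" and M :: "('r, 'm) module"
  assumes M: "Module.module R M"
begin

interpretation Module.module R M by (rule M)

lemma submodule_abelian_subgroup: "submodule S R M \<Longrightarrow> abelian_subgroup S M"
  by (intro abelian_subgroupI3 additive_subgroup.intro submodule.axioms(1) M.abelian_group_axioms)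

lemma quot_mod_add:
  assumes "submodule S R M" "x \<in> carrier M" "y \<in> carrier M"
  shows "(S +>\<^bsub>M\<^esub> x) \<oplus>\<^bsub>quot_mod M S\<^esub> (S +>\<^bsub>M\<^esub> y) = S +>\<^bsub>M\<^esub> (x \<oplus>\<^bsub>M\<^esub> y)"
  using abelian_subgroup.a_rcos_sum[OF submodule_abelian_subgroup] assms by (simp add: quot_mod_def)

lemma mem_coset: "y \<in> S +>\<^bsub>M\<^esub> x \<longleftrightarrow> (\<exists>s\<in>S. y = s \<oplus>\<^bsub>M\<^esub> x)"
  by (auto simp: a_r_coset_def')

lemma coset_eq_add:
  assumes S: "submodule S R M" and x: "x \<in> carrier M" and s: "s \<in> S"
  shows "S +>\<^bsub>M\<^esub> (s \<oplus>\<^bsub>M\<^esub> x) = S +>\<^bsub>M\<^esub> x"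
proof -
  interpret abelian_subgroup S M by (rule submodule_abelian_subgroup[OF S])
  have "s \<oplus>\<^bsub>M\<^esub> x \<in> S +>\<^bsub>M\<^esub> x" using s by (auto simp: mem_coset)
  then show ?thesis using a_repr_independence'[of "s \<oplus>\<^bsub>M\<^esub> x" x] x by simp
qed

lemma coset_eq_minus:
  assumes S: "submodule S R M" and x: "x \<in> carrier M" "y \<in> carrier M" and s: "x \<ominus>\<^bsub>M\<^esub> y \<in> S"
  shows "S +>\<^bsub>M\<^esub> x = S +>\<^bsub>M\<^esub> y"
proof -
  have "(x \<ominus>\<^bsub>M\<^esub> y) \<oplus>\<^bsub>M\<^esub> y = x"
    using x by (simp add: a_minus_def M.a_assoc M.l_neg)
  then show ?thesis using coset_eq_add[OF S x(2) s] by simp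
qed

lemma coset_self: "submodule S R M \<Longrightarrow> x \<in> carrier M \<Longrightarrow> x \<in> S +>\<^bsub>M\<^esub> x"
  unfolding mem_coset using subgroup.one_closed[OF submodule.axioms(1), of S R M]
  by (intro bexI[of _ "\<zero>\<^bsub>M\<^esub>"]) auto

text \<open>Maps out of a quotient are defined as unions over representatives; such a union
  collapses once all its members agree.\<close>

lemma UN_coset:
  assumes S: "submodule S R M" and x: "x \<in> carrier M"
    and "\<And>s. s \<in> S \<Longrightarrow> f (s \<oplus>\<^bsub>M\<^esub> x) = f x"
  shows "(\<Union>c\<in>S +>\<^bsub>M\<^esub> x. f c) = f x"
proof
  show "(\<Union>c\<in>S +>\<^bsub>M\<^esub> x. f c) \<subseteq> f x"
    using assms(3) unfolding mem_coset Ball_def UN_subset_iff by fast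
qed (use coset_self[OF S x] in blast)

lemma quot_mod_smult:
  assumes S: "submodule S R M" and x: "x \<in> carrier M" and a: "a \<in> carrier R"
  shows "a \<odot>\<^bsub>quot_mod M S\<^esub> (S +>\<^bsub>M\<^esub> x) = S +>\<^bsub>M\<^esub> (a \<odot>\<^bsub>M\<^esub> x)"
proof -
  have "S +>\<^bsub>M\<^esub> (a \<odot>\<^bsub>M\<^esub> (s \<oplus>\<^bsub>M\<^esub> x)) = S +>\<^bsub>M\<^esub> (a \<odot>\<^bsub>M\<^esub> x)" if "s \<in> S" for s
  proof -
    have "s \<in> carrier M" using submoduleE(1)[OF S] that by blast
    then show ?thesis
      using coset_eq_add[OF S _ submoduleE(4)[OF S a that], of "a \<odot>\<^bsub>M\<^esub> x"] a x
      by (simp add: smult_r_distr)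
  qed
  then show ?thesis
    using UN_coset[OF S x, of "\<lambda>c. S +>\<^bsub>M\<^esub> (a \<odot>\<^bsub>M\<^esub> c)"] by (simp add: quot_mod_def)
qed

end

section \<open>Tensor products of families and their direct limit\<close>

definition free_ext ::
  "('r, 'c) ring_scheme \<Rightarrow> ('v \<Rightarrow> ('r, 'a) module) \<Rightarrow> ('v \<Rightarrow> 'a) \<Rightarrow> 'v set \<Rightarrow> 'v set \<Rightarrow>
     (('v \<Rightarrow> 'a) \<Rightarrow> 'r) \<Rightarrow> ('v \<Rightarrow> 'a) \<Rightarrow> 'r" where
  "free_ext R A e J J' f =
     (\<lambda>s \<in> fam J' A. if \<forall>v\<in>J' - J. s v = e v then f (restrict s J) else \<zero>\<^bsub>R\<^esub>)"

definition fam_ext :: "('v \<Rightarrow> 'a) \<Rightarrow> 'v set \<Rightarrow> 'v set \<Rightarrow> ('v \<Rightarrow> 'a) \<Rightarrow> 'v \<Rightarrow> 'a" where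
  "fam_ext e J J' x = (\<lambda>v\<in>J'. if v \<in> J then x v else e v)"

text \<open>The vectors are required outside \<open>B\<close> only: at a level W, the module at a
  place with W v \<noteq> U v is a different one, in which \<open>e v\<close> need not lie.\<close>

locale restricted_family = R: cring R for R :: "('r, 'c) ring_scheme" +
  fixes I B :: "'v set" and A :: "'v \<Rightarrow> ('r, 'a) module" and e :: "'v \<Rightarrow> 'a"
  assumes modules: "v \<in> I \<Longrightarrow> Module.module R (A v)"
    and B: "finite B" "B \<subseteq> I"
    and vectors: "v \<in> I - B \<Longrightarrow> e v \<in> carrier (A v)"
begin

abbreviation "F J \<equiv> free_mod R (fam J A)"
abbreviation "b J \<equiv> free_basis R (fam J A)"
abbreviation "rels J \<equiv> tensor_rels R J A"
abbreviation "levels \<equiv> fin_above I B"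
abbreviation "E \<equiv> free_ext R A e"

lemma levelsD: "J \<in> levels \<Longrightarrow> B \<subseteq> J" "J \<in> levels \<Longrightarrow> J \<subseteq> I" "J \<in> levels \<Longrightarrow> finite J"
  by (auto simp: fin_above_def)

lemma F_module: "Module.module R (F J)"
  by (rule free_mod_module) (rule R.is_cring)

lemma b_closed: "x \<in> fam J A \<Longrightarrow> b J x \<in> carrier (F J)"
  by (rule free_basis_closed[OF R.is_cring])

lemma fam_upd: "x \<in> fam J A \<Longrightarrow> v \<in> J \<Longrightarrow> c \<in> carrier (A v) \<Longrightarrow> x(v := c) \<in> fam J A"
  by (auto simp: PiE_iff extensional_def)

abbreviation "add_rel J x v c d \<equiv>
  b J (x(v := c \<oplus>\<^bsub>A v\<^esub> d)) \<ominus>\<^bsub>F J\<^esub> (b J (x(v := c)) \<oplus>\<^bsub>F J\<^esub> b J (x(v := d)))"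
abbreviation "smult_rel J x v a c \<equiv>
  b J (x(v := a \<odot>\<^bsub>A v\<^esub> c)) \<ominus>\<^bsub>F J\<^esub> (a \<odot>\<^bsub>F J\<^esub> b J (x(v := c)))"

definition gens :: "'v set \<Rightarrow> (('v \<Rightarrow> 'a) \<Rightarrow> 'r) set" where
  "gens J = {add_rel J x v c d | x v c d.
            x \<in> fam J A \<and> v \<in> J \<and> c \<in> carrier (A v) \<and> d \<in> carrier (A v)} \<union>
         {smult_rel J x v a c | x v a c.
            x \<in> fam J A \<and> v \<in> J \<and> a \<in> carrier R \<and> c \<in> carrier (A v)}"

lemma gens_addI:
  assumes "x \<in> fam J A" "v \<in> J" "c \<in> carrier (A v)" "d \<in> carrier (A v)"
  shows "add_rel J x v c d \<in> gens J"
  unfolding gens_def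
  by (rule UnI1, rule CollectI, rule exI[of _ x], rule exI[of _ v], rule exI[of _ c], rule exI[of _ d])
    (simp only: assms simp_thms)

lemma gens_smultI:
  assumes "x \<in> fam J A" "v \<in> J" "a \<in> carrier R" "c \<in> carrier (A v)"
  shows "smult_rel J x v a c \<in> gens J"
  unfolding gens_def
  by (rule UnI2, rule CollectI, rule exI[of _ x], rule exI[of _ v], rule exI[of _ a], rule exI[of _ c])
    (simp only: assms simp_thms)

lemma rels_eq: "rels J = submod_gen R (F J) (gens J)"
  by (simp add: tensor_rels_def gens_def Let_def)

lemma A_closed:
  assumes "v \<in> I" "c \<in> carrier (A v)"
  shows "d \<in> carrier (A v) \<Longrightarrow> c \<oplus>\<^bsub>A v\<^esub> d \<in> carrier (A v)"
    and "a \<in> carrier R \<Longrightarrow> a \<odot>\<^bsub>A v\<^esub> c \<in> carrier (A v)"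
proof -
  interpret Av: Module.module R "A v" by (rule modules) fact
  show "d \<in> carrier (A v) \<Longrightarrow> c \<oplus>\<^bsub>A v\<^esub> d \<in> carrier (A v)" "a \<in> carrier R \<Longrightarrow> a \<odot>\<^bsub>A v\<^esub> c \<in> carrier (A v)"
    using assms by auto
qed

lemma gens_closed: "J \<subseteq> I \<Longrightarrow> gens J \<subseteq> carrier (F J)"
proof -
  interpret F: Module.module R "F J" by (rule F_module)
  assume "J \<subseteq> I"
  then show ?thesis
    unfolding gens_def
    by (auto intro!: F.M.minus_closed F.M.add.m_closed F.smult_closed b_closed fam_upd A_closed)
qed

lemma rels_submodule: "J \<subseteq> I \<Longrightarrow> submodule (rels J) R (F J)"
  unfolding rels_eq by (intro submodule_submod_gen F_module gens_closed)

lemma gens_rels: "J \<subseteq> I \<Longrightarrow> gens J \<subseteq> rels J"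
  unfolding rels_eq by (intro submodule_submod_gen F_module gens_closed)

lemma tensor_carrier: "carrier (tensor R J A) = {rels J +>\<^bsub>F J\<^esub> f | f. f \<in> carrier (F J)}"
  by (auto simp: tensor_def quot_mod_def A_RCOSETS_def')

lemma tensor_add:
  "J \<subseteq> I \<Longrightarrow> f \<in> carrier (F J) \<Longrightarrow> h \<in> carrier (F J) \<Longrightarrow>
    (rels J +>\<^bsub>F J\<^esub> f) \<oplus>\<^bsub>tensor R J A\<^esub> (rels J +>\<^bsub>F J\<^esub> h) = rels J +>\<^bsub>F J\<^esub> (f \<oplus>\<^bsub>F J\<^esub> h)"
  unfolding tensor_def by (rule quot_mod_add[OF F_module rels_submodule])

lemma tensor_smult:
  "J \<subseteq> I \<Longrightarrow> a \<in> carrier R \<Longrightarrow> f \<in> carrier (F J) \<Longrightarrow>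
    a \<odot>\<^bsub>tensor R J A\<^esub> (rels J +>\<^bsub>F J\<^esub> f) = rels J +>\<^bsub>F J\<^esub> (a \<odot>\<^bsub>F J\<^esub> f)"
  unfolding tensor_def by (rule quot_mod_smult[OF F_module rels_submodule])

lemma pure_closed: "x \<in> fam J A \<Longrightarrow> tensor_pure R J A x \<in> carrier (tensor R J A)"
  unfolding tensor_carrier tensor_pure_def using b_closed by blast

lemma pure_add:
  assumes "J \<subseteq> I" "x \<in> fam J A" "v \<in> J" "c \<in> carrier (A v)" "d \<in> carrier (A v)"
  shows "tensor_pure R J A (x(v := c \<oplus>\<^bsub>A v\<^esub> d)) =
    tensor_pure R J A (x(v := c)) \<oplus>\<^bsub>tensor R J A\<^esub> tensor_pure R J A (x(v := d))"
proof -
  interpret F: Module.module R "F J" by (rule F_module)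
  have cd: "c \<oplus>\<^bsub>A v\<^esub> d \<in> carrier (A v)" using A_closed assms by blast
  note cl = b_closed[OF fam_upd[OF assms(2,3) cd]] b_closed[OF fam_upd[OF assms(2,3,4)]]
    b_closed[OF fam_upd[OF assms(2,3,5)]]
  have "add_rel J x v c d \<in> rels J"
    using gens_addI[OF assms(2-5)] gens_rels[OF assms(1)] by blast
  then have "rels J +>\<^bsub>F J\<^esub> b J (x(v := c \<oplus>\<^bsub>A v\<^esub> d)) =
      rels J +>\<^bsub>F J\<^esub> (b J (x(v := c)) \<oplus>\<^bsub>F J\<^esub> b J (x(v := d)))"
    using cl by (intro coset_eq_minus[OF F_module rels_submodule[OF assms(1)]]) auto
  then show ?thesis
    unfolding tensor_pure_def using tensor_add[OF assms(1) cl(2,3)] by simp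
qed

lemma pure_smult:
  assumes "J \<subseteq> I" "x \<in> fam J A" "v \<in> J" "a \<in> carrier R" "c \<in> carrier (A v)"
  shows "tensor_pure R J A (x(v := a \<odot>\<^bsub>A v\<^esub> c)) = a \<odot>\<^bsub>tensor R J A\<^esub> tensor_pure R J A (x(v := c))"
proof -
  interpret F: Module.module R "F J" by (rule F_module)
  have cd: "a \<odot>\<^bsub>A v\<^esub> c \<in> carrier (A v)" using A_closed assms by blast
  note cl = b_closed[OF fam_upd[OF assms(2,3) cd]] b_closed[OF fam_upd[OF assms(2,3,5)]]
  have "smult_rel J x v a c \<in> rels J"
    using gens_smultI[OF assms(2-5)] gens_rels[OF assms(1)] by blast
  then have "rels J +>\<^bsub>F J\<^esub> b J (x(v := a \<odot>\<^bsub>A v\<^esub> c)) = rels J +>\<^bsub>F J\<^esub> (a \<odot>\<^bsub>F J\<^esub> b J (x(v := c)))"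
    using cl assms(4) by (intro coset_eq_minus[OF F_module rels_submodule[OF assms(1)]]) auto
  then show ?thesis
    unfolding tensor_pure_def using tensor_smult[OF assms(1,4) cl(2)] by simp
qed

lemma E_hom:
  assumes "J \<subseteq> J'"
  shows "E J J' \<in> mod_hom R (F J) (F J')"
proof -
  have res: "restrict s J \<in> fam J A" if "s \<in> fam J' A" for s
    using that assms by (auto simp: PiE_iff)
  have "E J J' f \<in> carrier (F J')" if f: "f \<in> carrier (F J)" for f
  proof -
    \<comment> \<open>A family in the support of the extended function is the extension by
      \<open>e\<close> of a family in the support of f, so finiteness is inherited.\<close>
    have "{s \<in> fam J' A. E J J' f s \<noteq> \<zero>\<^bsub>R\<^esub>} \<subseteq> fam_ext e J J' ` {s \<in> fam J A. f s \<noteq> \<zero>\<^bsub>R\<^esub>}"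
    proof
      fix s assume "s \<in> {s \<in> fam J' A. E J J' f s \<noteq> \<zero>\<^bsub>R\<^esub>}"
      then have s: "s \<in> fam J' A" "\<forall>v\<in>J' - J. s v = e v" "f (restrict s J) \<noteq> \<zero>\<^bsub>R\<^esub>"
        by (auto simp: free_ext_def split: if_splits)
      have "s = fam_ext e J J' (restrict s J)"
        using s(1,2) assms by (auto simp: fam_ext_def fun_eq_iff PiE_iff extensional_def)
      then show "s \<in> fam_ext e J J' ` {s \<in> fam J A. f s \<noteq> \<zero>\<^bsub>R\<^esub>}"
        using s res by blast
    qed
    moreover have "finite (fam_ext e J J' ` {s \<in> fam J A. f s \<noteq> \<zero>\<^bsub>R\<^esub>})"
      using f by (simp add: free_mod_def)
    ultimately have "finite {s \<in> fam J' A. E J J' f s \<noteq> \<zero>\<^bsub>R\<^esub>}" by (rule finite_subset)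
    moreover have "E J J' f \<in> fam J' A \<rightarrow>\<^sub>E carrier R"
      using free_mod_val[OF f res] by (auto simp: free_ext_def)
    ultimately show ?thesis by (simp add: free_mod_def)
  qed
  then show ?thesis
    unfolding mod_hom_def using res
    by (auto simp: free_mod_def free_ext_def intro!: restrict_ext)
qed

lemma E_basis:
  assumes "J \<subseteq> J'" "x \<in> fam J A"
  shows "E J J' (b J x) = b J' (fam_ext e J J' x)"
proof (rule extensionalityI)
  fix s assume s: "s \<in> fam J' A"
  have "restrict s J \<in> fam J A" using s assms(1) by (auto simp: PiE_iff)
  moreover have "(\<forall>v\<in>J' - J. s v = e v) \<and> restrict s J = x \<longleftrightarrow> s = fam_ext e J J' x"
  proof
    assume l: "(\<forall>v\<in>J' - J. s v = e v) \<and> restrict s J = x"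
    then have x: "x = restrict s J" by simp
    show "s = fam_ext e J J' x"
      unfolding x using s conjunct1[OF l] by (auto simp: fam_ext_def fun_eq_iff PiE_iff extensional_def restrict_def)
  next
    assume "s = fam_ext e J J' x"
    then show "(\<forall>v\<in>J' - J. s v = e v) \<and> restrict s J = x"
      using assms by (auto simp: fam_ext_def fun_eq_iff PiE_iff extensional_def restrict_def)
  qed
  ultimately show "E J J' (b J x) s = b J' (fam_ext e J J' x) s"
    using s by (auto simp: free_ext_def free_basis_def)
qed (auto simp: free_ext_def free_basis_def)

lemma fam_ext_fam:
  assumes "J \<in> levels" "J' \<in> levels" "J \<subseteq> J'" "x \<in> fam J A"
  shows "fam_ext e J J' x \<in> fam J' A"
  using assms vectors levelsD(1)[OF assms(1)] levelsD(2)[OF assms(2)]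
  by (auto simp: fam_ext_def PiE_iff)

text \<open>By \<open>submodule_preimage\<close> only generators matter. Extending a family by
  \<open>e\<close> commutes with changing a coordinate in J, so a generator goes to the generator of
  the same kind for the extended family.\<close>

lemma E_rels:
  assumes J: "J \<in> levels" "J' \<in> levels" "J \<subseteq> J'" and f: "f \<in> rels J"
  shows "E J J' f \<in> rels J'"
proof -
  note E = mod_homD[OF E_hom[OF J(3)]]
  have I: "J \<subseteq> I" "J' \<subseteq> I" using levelsD J by auto
  interpret F: Module.module R "F J" by (rule F_module)
  have upd: "fam_ext e J J' (x(v := c)) = (fam_ext e J J' x)(v := c)" if "v \<in> J" for x v c
    using that J(3) by (auto simp: fam_ext_def fun_eq_iff)
  have "gens J \<subseteq> {f \<in> carrier (F J). E J J' f \<in> rels J'}"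
  proof
    fix f assume f: "f \<in> gens J"
    then have fc: "f \<in> carrier (F J)" using gens_closed I by blast
    from f consider
      (add) x v c d where "f = add_rel J x v c d"
        "x \<in> fam J A" "v \<in> J" "c \<in> carrier (A v)" "d \<in> carrier (A v)"
      | (smult) x v a c where "f = smult_rel J x v a c"
        "x \<in> fam J A" "v \<in> J" "a \<in> carrier R" "c \<in> carrier (A v)"
      unfolding gens_def by blast
    then have "E J J' f \<in> gens J'"
    proof cases
      case add
      have cd: "c \<oplus>\<^bsub>A v\<^esub> d \<in> carrier (A v)" using A_closed add I by blast
      note fu = fam_upd[OF add(2,3) cd] fam_upd[OF add(2,3,4)] fam_upd[OF add(2,3,5)]
      note bc = fu[THEN b_closed]
      have "E J J' f = E J J' (b J (x(v := c \<oplus>\<^bsub>A v\<^esub> d))) \<ominus>\<^bsub>F J'\<^esub>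
          (E J J' (b J (x(v := c))) \<oplus>\<^bsub>F J'\<^esub> E J J' (b J (x(v := d))))"
        unfolding add(1) using mod_hom_minus[OF F_module F_module E_hom[OF J(3)] bc(1) F.M.add.m_closed[OF bc(2,3)]]
          E(2)[OF bc(2,3)] by simp
      then have "E J J' f = add_rel J' (fam_ext e J J' x) v c d"
        unfolding E_basis[OF J(3) fu(1)] E_basis[OF J(3) fu(2)] E_basis[OF J(3) fu(3)] upd[OF add(3)] .
      then show ?thesis
        using gens_addI[OF fam_ext_fam[OF J add(2)] subsetD[OF J(3) add(3)] add(4,5)] by simp
    next
      case smult
      have cd: "a \<odot>\<^bsub>A v\<^esub> c \<in> carrier (A v)" using A_closed smult I by blast
      note fu = fam_upd[OF smult(2,3) cd] fam_upd[OF smult(2,3,5)]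
      note bc = fu[THEN b_closed]
      have "E J J' f = E J J' (b J (x(v := a \<odot>\<^bsub>A v\<^esub> c))) \<ominus>\<^bsub>F J'\<^esub> (a \<odot>\<^bsub>F J'\<^esub> E J J' (b J (x(v := c))))"
        unfolding smult(1)
        using mod_hom_minus[OF F_module F_module E_hom[OF J(3)] bc(1) F.smult_closed[OF smult(4) bc(2)]]
          E(3)[OF smult(4) bc(2)] by simp
      then have "E J J' f = smult_rel J' (fam_ext e J J' x) v a c"
        unfolding E_basis[OF J(3) fu(1)] E_basis[OF J(3) fu(2)] upd[OF smult(3)] .
      then show ?thesis
        using gens_smultI[OF fam_ext_fam[OF J smult(2)] subsetD[OF J(3) smult(3)] smult(4,5)] by simp
    qed
    then show "f \<in> {f \<in> carrier (F J). E J J' f \<in> rels J'}"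
      using fc gens_rels I by blast
  qed
  then have "rels J \<subseteq> {f \<in> carrier (F J). E J J' f \<in> rels J'}"
    unfolding rels_eq[of J]
    by (rule submod_gen_least[OF submodule_preimage[OF F_module F_module E_hom[OF J(3)] rels_submodule[OF I(2)]]])
  then show ?thesis using f by blast
qed

text \<open>\<open>free_ext\<close> is the inner expression of \<open>tensor_ext\<close>. As it
  respects relations, the union over a coset collapses to a single value.\<close>

lemma tensor_ext_coset:
  assumes J: "J \<in> levels" "J' \<in> levels" "J \<subseteq> J'" and f: "f \<in> carrier (F J)"
  shows "tensor_ext R A e J J' (rels J +>\<^bsub>F J\<^esub> f) = rels J' +>\<^bsub>F J'\<^esub> E J J' f"
proof -
  interpret F: Module.module R "F J" by (rule F_module)
  interpret F': Module.module R "F J'" by (rule F_module)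
  have I: "J \<subseteq> I" "J' \<subseteq> I" using levelsD J by auto
  note E = mod_homD[OF E_hom[OF J(3)]]
  have "rels J' +>\<^bsub>F J'\<^esub> E J J' (s \<oplus>\<^bsub>F J\<^esub> f) = rels J' +>\<^bsub>F J'\<^esub> E J J' f" if s: "s \<in> rels J" for s
  proof -
    have sc: "s \<in> carrier (F J)" using F.submoduleE(1)[OF rels_submodule[OF I(1)]] s by blast
    show ?thesis
      unfolding E(2)[OF sc f]
      by (rule coset_eq_add[OF F_module rels_submodule[OF I(2)] E(1)[OF f] E_rels[OF J s]])
  qed
  then show ?thesis
    using UN_coset[OF F_module rels_submodule[OF I(1)] f, of "\<lambda>h. rels J' +>\<^bsub>F J'\<^esub> E J J' h"]
    by (simp add: tensor_ext_def free_ext_def)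
qed

lemma E_comp:
  assumes "J \<subseteq> J'" "J' \<subseteq> J''"
  shows "E J' J'' (E J J' f) = E J J'' f"
proof (rule extensionalityI)
  fix s assume s: "s \<in> fam J'' A"
  have r: "restrict s J' \<in> fam J' A" using s assms by (auto simp: PiE_iff)
  have rr: "restrict (restrict s J') J = restrict s J"
    using assms by (auto simp: fun_eq_iff restrict_def)
  have "(\<forall>v\<in>J'' - J. s v = e v) \<longleftrightarrow> (\<forall>v\<in>J'' - J'. s v = e v) \<and> (\<forall>v\<in>J' - J. restrict s J' v = e v)"
    using assms by auto
  then show "E J' J'' (E J J' f) s = E J J'' f s"
    using s r rr by (auto simp: free_ext_def)
qed (auto simp: free_ext_def)

sublocale system: directed_system levels "\<lambda>J. tensor R J A" "tensor_ext R A e" R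
proof
  fix J J' assume "J \<in> levels" "J' \<in> levels"
  then show "\<exists>\<kappa>\<in>levels. J \<le> \<kappa> \<and> J' \<le> \<kappa>"
    by (intro bexI[of _ "J \<union> J'"]) (auto simp: fin_above_def)
next
  fix J J' assume J: "J \<in> levels" "J' \<in> levels" "J \<le> J'"
  have I: "J \<subseteq> I" "J' \<subseteq> I" using levelsD J by auto
  interpret F: Module.module R "F J" by (rule F_module)
  note E = mod_homD[OF E_hom[OF J(3)]]
  show "tensor_ext R A e J J' \<in> mod_hom R (tensor R J A) (tensor R J' A)"
    unfolding mod_hom_def
  proof (intro CollectI conjI ballI funcsetI)
    fix x assume "x \<in> carrier (tensor R J A)"
    then show "tensor_ext R A e J J' x \<in> carrier (tensor R J' A)"
      using tensor_ext_coset[OF J] E(1) unfolding tensor_carrier by blast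
  next
    fix x y assume "x \<in> carrier (tensor R J A)" "y \<in> carrier (tensor R J A)"
    then obtain f h where f: "x = rels J +>\<^bsub>F J\<^esub> f" "f \<in> carrier (F J)"
      and h: "y = rels J +>\<^bsub>F J\<^esub> h" "h \<in> carrier (F J)"
      unfolding tensor_carrier by blast
    show "tensor_ext R A e J J' (x \<oplus>\<^bsub>tensor R J A\<^esub> y) =
        tensor_ext R A e J J' x \<oplus>\<^bsub>tensor R J' A\<^esub> tensor_ext R A e J J' y"
      using f h E by (simp add: tensor_add I tensor_ext_coset[OF J])
  next
    fix a x assume a: "a \<in> carrier R" and "x \<in> carrier (tensor R J A)"
    then obtain f where f: "x = rels J +>\<^bsub>F J\<^esub> f" "f \<in> carrier (F J)"
      unfolding tensor_carrier by blast
    show "tensor_ext R A e J J' (a \<odot>\<^bsub>tensor R J A\<^esub> x) = a \<odot>\<^bsub>tensor R J' A\<^esub> tensor_ext R A e J J' x"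
      using f a E by (simp add: tensor_smult I tensor_ext_coset[OF J])
  qed
next
  fix J J' J'' a assume J: "J \<in> levels" "J' \<in> levels" "J'' \<in> levels" "J \<le> J'" "J' \<le> J''"
    and "a \<in> carrier (tensor R J A)"
  then obtain f where f: "a = rels J +>\<^bsub>F J\<^esub> f" "f \<in> carrier (F J)"
    unfolding tensor_carrier by blast
  show "tensor_ext R A e J' J'' (tensor_ext R A e J J' a) = tensor_ext R A e J J'' a"
    unfolding f(1)
    using tensor_ext_coset[OF J(1,2,4) f(2)] tensor_ext_coset[OF J(2,3,5) mod_homD(1)[OF E_hom[OF J(4)] f(2)]]
      tensor_ext_coset[OF J(1,3) order_trans[OF J(4,5)] f(2)] E_comp[OF J(4,5)] by simp
next
  fix J a b assume J: "J \<in> levels" and ab: "a \<in> carrier (tensor R J A)" "b \<in> carrier (tensor R J A)"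
  interpret F: Module.module R "F J" by (rule F_module)
  obtain f h where f: "a = rels J +>\<^bsub>F J\<^esub> f" "f \<in> carrier (F J)"
    and h: "b = rels J +>\<^bsub>F J\<^esub> h" "h \<in> carrier (F J)"
    using ab unfolding tensor_carrier by blast
  show "a \<oplus>\<^bsub>tensor R J A\<^esub> b \<in> carrier (tensor R J A)"
    unfolding f h tensor_add[OF levelsD(2)[OF J] f(2) h(2)] tensor_carrier using f h by blast
next
  fix J r a assume J: "J \<in> levels" and r: "r \<in> carrier R" and a: "a \<in> carrier (tensor R J A)"
  interpret F: Module.module R "F J" by (rule F_module)
  obtain f where f: "a = rels J +>\<^bsub>F J\<^esub> f" "f \<in> carrier (F J)"
    using a unfolding tensor_carrier by blast
  show "r \<odot>\<^bsub>tensor R J A\<^esub> a \<in> carrier (tensor R J A)"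
    unfolding f tensor_smult[OF levelsD(2)[OF J] r f(2)] tensor_carrier using f r by blast
qed

lemma rtensor_eq: "rtensor R I B A e = dirlim levels (\<lambda>J. tensor R J A) (tensor_ext R A e)"
  by (simp add: rtensor_def)

lemma rfamD:
  assumes "x \<in> rfam I A e" "J \<subseteq> I"
  shows "restrict x J \<in> fam J A"
  using assms by (auto simp: rfam_def PiE_iff)

text \<open>A pure tensor is defined at the smallest level that carries it. Families differing at
  one place may have different smallest levels, so comparing them needs the freedom to pass to a
  larger one.\<close>

lemma rtensor_pure_level:
  assumes x: "x \<in> rfam I A e" and J: "J \<in> levels" "{v \<in> I. x v \<noteq> e v} \<subseteq> J"
  shows "rtensor_pure R I B A e x = system.cls J (tensor_pure R J A (restrict x J))"
proof -
  define \<kappa> where "\<kappa> = B \<union> {v \<in> I. x v \<noteq> e v}"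
  have \<kappa>: "\<kappa> \<in> levels" "\<kappa> \<subseteq> J"
    using x B J levelsD[OF J(1)] by (auto simp: \<kappa>_def fin_above_def rfam_def)
  have I: "\<kappa> \<subseteq> I" "J \<subseteq> I" using levelsD J \<kappa> by auto
  note rx = rfamD[OF x I(1)]
  have "fam_ext e \<kappa> J (restrict x \<kappa>) = restrict x J"
    using \<kappa>(2) I by (auto simp: fam_ext_def fun_eq_iff \<kappa>_def)
  then have "tensor_ext R A e \<kappa> J (tensor_pure R \<kappa> A (restrict x \<kappa>)) = tensor_pure R J A (restrict x J)"
    unfolding tensor_pure_def using tensor_ext_coset[OF \<kappa>(1) J(1) \<kappa>(2) b_closed[OF rx]] E_basis[OF \<kappa>(2) rx]
    by simp
  then show ?thesis
    using system.cls_map[OF \<kappa>(1) J(1) \<kappa>(2) pure_closed[OF rx]]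
    by (simp add: rtensor_pure_def \<kappa>_def[symmetric])
qed

lemma rtensor_pure_closed:
  assumes x: "x \<in> rfam I A e"
  shows "rtensor_pure R I B A e x \<in> carrier (rtensor R I B A e)"
proof -
  define J where "J = B \<union> {v \<in> I. x v \<noteq> e v}"
  have J: "J \<in> levels"
    using x B by (auto simp: J_def fin_above_def rfam_def)
  have "rtensor_pure R I B A e x = system.cls J (tensor_pure R J A (restrict x J))"
    by (rule rtensor_pure_level[OF x J]) (auto simp: J_def)
  then show ?thesis
    unfolding rtensor_eq
    using system.cls_closed[OF J pure_closed[OF rfamD[OF x levelsD(2)[OF J]]]] by simp
qed

lemma rfam_upd:
  assumes "x \<in> rfam I A e" "v \<in> I" "c \<in> carrier (A v)"
  shows "x(v := c) \<in> rfam I A e"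
proof -
  have "{w \<in> I. (x(v := c)) w \<noteq> e w} \<subseteq> insert v {w \<in> I. x w \<noteq> e w}" by auto
  moreover have "finite (insert v {w \<in> I. x w \<noteq> e w})" using assms(1) by (simp add: rfam_def)
  ultimately have "finite {w \<in> I. (x(v := c)) w \<noteq> e w}" by (rule finite_subset)
  then show ?thesis using assms fam_upd[of x I v c] by (simp add: rfam_def)
qed

context
  fixes x v
  assumes x: "x \<in> rfam I A e" and v: "v \<in> I"
begin

text \<open>The smallest level of x(v := c) may or may not contain v, according to c. This level
  works for every c, so linearity can be read off inside one tensor product.\<close>

private definition "J = insert v (B \<union> {v \<in> I. x v \<noteq> e v})"

private lemma J: "J \<in> levels" "v \<in> J"
  using x v B by (auto simp: J_def fin_above_def rfam_def)

private lemma upd: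
  assumes "c \<in> carrier (A v)"
  shows "rtensor_pure R I B A e (x(v := c)) = system.cls J (tensor_pure R J A ((restrict x J)(v := c)))"
proof -
  have "restrict (x(v := c)) J = (restrict x J)(v := c)"
    using J(2) by (auto simp: fun_eq_iff)
  moreover have "{w \<in> I. (x(v := c)) w \<noteq> e w} \<subseteq> J" by (auto simp: J_def)
  ultimately show ?thesis
    using rtensor_pure_level[OF rfam_upd[OF x v assms] J(1)] by simp
qed

lemma rtensor_pure_add:
  assumes c: "c \<in> carrier (A v)" and d: "d \<in> carrier (A v)"
  shows "rtensor_pure R I B A e (x(v := c \<oplus>\<^bsub>A v\<^esub> d)) =
    rtensor_pure R I B A e (x(v := c)) \<oplus>\<^bsub>rtensor R I B A e\<^esub> rtensor_pure R I B A e (x(v := d))"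
proof -
  have I: "J \<subseteq> I" using levelsD J by blast
  note r = rfamD[OF x I]
  show ?thesis
    unfolding upd[OF A_closed(1)[OF v c d]] upd[OF c] upd[OF d] rtensor_eq pure_add[OF I r J(2) c d]
    by (rule system.cls_add[symmetric]) (intro J pure_closed fam_upd r c d)+
qed

lemma rtensor_pure_smult:
  assumes a: "a \<in> carrier R" and c: "c \<in> carrier (A v)"
  shows "rtensor_pure R I B A e (x(v := a \<odot>\<^bsub>A v\<^esub> c)) =
    a \<odot>\<^bsub>rtensor R I B A e\<^esub> rtensor_pure R I B A e (x(v := c))"
proof -
  have I: "J \<subseteq> I" using levelsD J by blast
  note r = rfamD[OF x I]
  show ?thesis
    unfolding upd[OF A_closed(2)[OF v c a]] upd[OF c] rtensor_eq pure_smult[OF I r J(2) a c]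
    by (rule system.cls_smult[symmetric]) (intro J pure_closed fam_upd r c a)+
qed

end

end

section \<open>Restricted products\<close>

locale restricted_product =
  fixes I :: "'v set" and G :: "'v \<Rightarrow> 'g monoid" and K :: "'v \<Rightarrow> 'g set"
  assumes groups: "v \<in> I \<Longrightarrow> Group.group (G v)" and K_subgroup: "v \<in> I \<Longrightarrow> subgroup (K v) (G v)"
begin

abbreviation "P \<equiv> rprod I G K"
abbreviation "place \<equiv> place_incl I G"

lemma P_carrier: "x \<in> carrier P \<longleftrightarrow> x \<in> (\<Pi>\<^sub>E v\<in>I. carrier (G v)) \<and> finite {v\<in>I. x v \<notin> K v}"
  by (simp add: rprod_def)

lemma P_closed: "x \<in> carrier P \<Longrightarrow> v \<in> I \<Longrightarrow> x v \<in> carrier (G v)"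
  by (auto simp: P_carrier)

lemma P_ext: "x \<in> carrier P \<Longrightarrow> x \<in> extensional I"
  by (auto simp: P_carrier PiE_iff)

lemma P_mult: "v \<in> I \<Longrightarrow> (x \<otimes>\<^bsub>P\<^esub> y) v = x v \<otimes>\<^bsub>G v\<^esub> y v"
  by (simp add: rprod_def)

lemma P_one: "v \<in> I \<Longrightarrow> \<one>\<^bsub>P\<^esub> v = \<one>\<^bsub>G v\<^esub>"
  by (simp add: rprod_def)

lemma P_mult_ext: "x \<otimes>\<^bsub>P\<^esub> y \<in> extensional I"
  by (simp add: rprod_def)

lemma P_group: "Group.group P"
proof (rule groupI)
  fix x y assume xy: "x \<in> carrier P" "y \<in> carrier P"
  have "{v\<in>I. (x \<otimes>\<^bsub>P\<^esub> y) v \<notin> K v} \<subseteq> {v\<in>I. x v \<notin> K v} \<union> {v\<in>I. y v \<notin> K v}"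
    using subgroup.m_closed[OF K_subgroup] by (auto simp: P_mult)
  moreover have "finite ({v\<in>I. x v \<notin> K v} \<union> {v\<in>I. y v \<notin> K v})"
    using xy by (simp add: P_carrier)
  ultimately have "finite {v\<in>I. (x \<otimes>\<^bsub>P\<^esub> y) v \<notin> K v}" by (rule finite_subset)
  moreover have "x v \<otimes>\<^bsub>G v\<^esub> y v \<in> carrier (G v)" if "v \<in> I" for v
    using monoid.m_closed[OF group.is_monoid[OF groups[OF that]]] P_closed xy that by blast
  ultimately show "x \<otimes>\<^bsub>P\<^esub> y \<in> carrier P"
    using P_mult_ext by (auto simp: P_carrier PiE_iff P_mult)
next
  have "{v\<in>I. \<one>\<^bsub>P\<^esub> v \<notin> K v} = {}"
    using subgroup.one_closed[OF K_subgroup] by (auto simp: P_one)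
  then have "finite {v\<in>I. \<one>\<^bsub>P\<^esub> v \<notin> K v}"
    by (metis finite.emptyI)
  moreover have "\<one>\<^bsub>P\<^esub> \<in> (\<Pi>\<^sub>E v\<in>I. carrier (G v))"
    using monoid.one_closed[OF group.is_monoid[OF groups]] by (auto simp: rprod_def)
  ultimately show "\<one>\<^bsub>P\<^esub> \<in> carrier P"
    by (simp add: P_carrier)
next
  fix x y z assume x: "x \<in> carrier P" "y \<in> carrier P" "z \<in> carrier P"
  show "x \<otimes>\<^bsub>P\<^esub> y \<otimes>\<^bsub>P\<^esub> z = x \<otimes>\<^bsub>P\<^esub> (y \<otimes>\<^bsub>P\<^esub> z)"
    using monoid.m_assoc[OF group.is_monoid[OF groups]] P_closed x
    by (intro extensionalityI[OF P_mult_ext P_mult_ext]) (simp add: P_mult)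
next
  fix x assume x: "x \<in> carrier P"
  show "\<one>\<^bsub>P\<^esub> \<otimes>\<^bsub>P\<^esub> x = x"
    using monoid.l_one[OF group.is_monoid[OF groups]] P_closed x
    by (intro extensionalityI[OF P_mult_ext P_ext]) (simp_all add: P_mult P_one)
  define y where "y = (\<lambda>v\<in>I. inv\<^bsub>G v\<^esub> x v)"
  have "{v\<in>I. y v \<notin> K v} \<subseteq> {v\<in>I. x v \<notin> K v}"
    using subgroup.m_inv_closed[OF K_subgroup] by (auto simp: y_def)
  moreover have "finite {v\<in>I. x v \<notin> K v}" using x by (simp add: P_carrier)
  ultimately have "finite {v\<in>I. y v \<notin> K v}" by (rule finite_subset)
  then have "y \<in> carrier P"
    using group.inv_closed[OF groups] P_closed[OF x] by (auto simp: P_carrier y_def)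
  moreover have "y \<otimes>\<^bsub>P\<^esub> x = \<one>\<^bsub>P\<^esub>"
    using group.l_inv[OF groups] P_closed[OF x] by (auto simp: rprod_def y_def intro!: restrict_ext)
  ultimately show "\<exists>y\<in>carrier P. y \<otimes>\<^bsub>P\<^esub> x = \<one>\<^bsub>P\<^esub>" by blast
qed

sublocale P: Group.group P
  by (rule P_group)

lemma P_inv: "x \<in> carrier P \<Longrightarrow> v \<in> I \<Longrightarrow> (inv\<^bsub>P\<^esub> x) v = inv\<^bsub>G v\<^esub> (x v)"
proof -
  assume x: "x \<in> carrier P" and v: "v \<in> I"
  interpret Gv: Group.group "G v" by (rule groups[OF v])
  have "(inv\<^bsub>P\<^esub> x) v \<otimes>\<^bsub>G v\<^esub> x v = \<one>\<^bsub>G v\<^esub>"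
    using P.l_inv[OF x] P_mult[OF v, of "inv\<^bsub>P\<^esub> x" x] P_one[OF v] by simp
  then show ?thesis
    using Gv.inv_equality P_closed[OF x v] P_closed[OF P.inv_closed[OF x] v] by metis
qed

text \<open>The computation is purely componentwise, so the product of the sets \<open>A v\<close>
  need not lie inside the restricted product.\<close>

lemma conj_by_PiE:
  assumes x: "x \<in> carrier P"
  shows "conj_by P x (\<Pi>\<^sub>E v\<in>I. A v) = (\<Pi>\<^sub>E v\<in>I. conj_by (G v) (x v) (A v))"
proof (intro equalityI subsetI)
  fix y assume "y \<in> conj_by P x (\<Pi>\<^sub>E v\<in>I. A v)"
  then obtain a where a: "a \<in> (\<Pi>\<^sub>E v\<in>I. A v)" "y = x \<otimes>\<^bsub>P\<^esub> a \<otimes>\<^bsub>P\<^esub> inv\<^bsub>P\<^esub> x"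
    unfolding mem_conj_by by blast
  then show "y \<in> (\<Pi>\<^sub>E v\<in>I. conj_by (G v) (x v) (A v))"
    using P_mult_ext by (auto simp: PiE_iff P_mult P_inv[OF x] mem_conj_by)
next
  fix y assume y: "y \<in> (\<Pi>\<^sub>E v\<in>I. conj_by (G v) (x v) (A v))"
  then have "\<forall>v\<in>I. \<exists>a. a \<in> A v \<and> y v = x v \<otimes>\<^bsub>G v\<^esub> a \<otimes>\<^bsub>G v\<^esub> inv\<^bsub>G v\<^esub> (x v)"
    by (auto simp: PiE_iff mem_conj_by)
  then obtain a where a: "\<And>v. v \<in> I \<Longrightarrow> a v \<in> A v \<and> y v = x v \<otimes>\<^bsub>G v\<^esub> a v \<otimes>\<^bsub>G v\<^esub> inv\<^bsub>G v\<^esub> (x v)"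
    by metis
  have "y = x \<otimes>\<^bsub>P\<^esub> restrict a I \<otimes>\<^bsub>P\<^esub> inv\<^bsub>P\<^esub> x"
    by (rule extensionalityI[OF _ P_mult_ext]) (use y a in \<open>auto simp: PiE_iff P_mult P_inv[OF x]\<close>)
  moreover have "restrict a I \<in> (\<Pi>\<^sub>E v\<in>I. A v)" using a by auto
  ultimately show "y \<in> conj_by P x (\<Pi>\<^sub>E v\<in>I. A v)"
    unfolding mem_conj_by by blast
qed

lemma place_apply:
  "v \<in> I \<Longrightarrow> place v s v = s"
  "w \<in> I \<Longrightarrow> w \<noteq> v \<Longrightarrow> place v s w = \<one>\<^bsub>G w\<^esub>"
  by (auto simp: place_incl_def)

lemma place_closed:
  assumes "v \<in> I" "s \<in> carrier (G v)"
  shows "place v s \<in> carrier P"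
proof -
  have "{w\<in>I. place v s w \<notin> K w} \<subseteq> {v}"
    using subgroup.one_closed[OF K_subgroup] by (auto simp: place_incl_def)
  then have "finite {w\<in>I. place v s w \<notin> K w}" by (rule finite_subset) simp
  moreover have "place v s w \<in> carrier (G w)" if "w \<in> I" for w
    using assms group.is_monoid[OF groups[OF that], THEN monoid.one_closed] that
    by (cases "w = v") (auto simp: place_apply)
  ultimately show ?thesis
    by (auto simp: P_carrier place_incl_def)
qed

lemma place_mult:
  assumes "v \<in> I"
  shows "place v s \<otimes>\<^bsub>P\<^esub> place v t = place v (s \<otimes>\<^bsub>G v\<^esub> t)"
proof (rule extensionalityI[OF P_mult_ext])
  fix w assume w: "w \<in> I"
  interpret Gw: Group.group "G w" by (rule groups[OF w])
  show "(place v s \<otimes>\<^bsub>P\<^esub> place v t) w = place v (s \<otimes>\<^bsub>G v\<^esub> t) w"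
    using w by (simp add: P_mult place_incl_def)
qed (simp add: place_incl_def)

text \<open>At each place one of the two factors is trivial.\<close>

lemma place_commute:
  assumes v: "v \<in> I" "s \<in> carrier (G v)" and x: "x \<in> carrier P" "x v = \<one>\<^bsub>G v\<^esub>"
  shows "place v s \<otimes>\<^bsub>P\<^esub> x = x \<otimes>\<^bsub>P\<^esub> place v s"
proof (rule extensionalityI[OF P_mult_ext P_mult_ext])
  fix w assume w: "w \<in> I"
  interpret Gw: Group.group "G w" by (rule groups[OF w])
  show "(place v s \<otimes>\<^bsub>P\<^esub> x) w = (x \<otimes>\<^bsub>P\<^esub> place v s) w"
    using v x(2) P_closed[OF x(1) w] w Gw.l_one Gw.r_one
    by (cases "w = v") (simp_all add: P_mult place_apply)
qed

text \<open>Away from v the embedded element is trivial, so the components there of a point of the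
  double coset lie in \<open>C w\<close> and can be absorbed into the right factor. Only the double
  coset at v remains visible.\<close>

lemma dcoset_reps_place:
  assumes v: "v \<in> I" and s: "s \<in> carrier (G v)"
    and V: "\<And>w. w \<in> I \<Longrightarrow> subgroup (V w) (G w)" and C: "\<And>w. w \<in> I \<Longrightarrow> subgroup (C w) (G w)"
    and VC: "\<And>w. w \<in> I \<Longrightarrow> V w \<subseteq> C w" and CP: "(\<Pi>\<^sub>E w\<in>I. C w) \<subseteq> carrier P"
    and D: "dcoset_reps (G v) (V v) (dcoset (G v) (C v) s (C v)) (C v) D"
  shows "dcoset_reps P (\<Pi>\<^sub>E w\<in>I. V w) (dcoset P (\<Pi>\<^sub>E w\<in>I. C w) (place v s) (\<Pi>\<^sub>E w\<in>I. C w))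
    (\<Pi>\<^sub>E w\<in>I. C w) (place v ` D)"
proof -
  let ?V = "\<Pi>\<^sub>E w\<in>I. V w" and ?C = "\<Pi>\<^sub>E w\<in>I. C w" and ?p = "place v"
  interpret Gv: Group.group "G v" by (rule groups[OF v])
  have plV: "?p a \<in> ?V" if "a \<in> V v" for a
    using that v V[THEN subgroup.one_closed] by (auto simp: place_incl_def)
  have plC: "?p a \<in> ?C" if "a \<in> C v" for a
    using that v C[THEN subgroup.one_closed] by (auto simp: place_incl_def)
  have pinj: "a = b" if "?p a = ?p b" for a b
    using fun_cong[OF that, of v] v by (simp add: place_apply)
  show ?thesis
    unfolding dcoset_reps_def
  proof (intro conjI ballI)
    show "?p ` D \<subseteq> dcoset P ?C (?p s) ?C"
    proof
      fix x assume "x \<in> ?p ` D"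
      then obtain d where d: "d \<in> D" "x = ?p d" by blast
      then have "d \<in> dcoset (G v) (C v) s (C v)" using D by (auto simp: dcoset_reps_def)
      then obtain a b where ab: "a \<in> C v" "b \<in> C v" "d = a \<otimes>\<^bsub>G v\<^esub> s \<otimes>\<^bsub>G v\<^esub> b"
        unfolding mem_dcoset by blast
      show "x \<in> dcoset P ?C (?p s) ?C"
        by (rule dcosetI[OF plC[OF ab(1)] plC[OF ab(2)]]) (simp add: d(2) ab(3) place_mult[OF v])
    qed
    fix x assume "x \<in> dcoset P ?C (?p s) ?C"
    then obtain a b where ab: "a \<in> ?C" "b \<in> ?C" "x = a \<otimes>\<^bsub>P\<^esub> ?p s \<otimes>\<^bsub>P\<^esub> b"
      unfolding mem_dcoset by blast
    have "x v = a v \<otimes>\<^bsub>G v\<^esub> s \<otimes>\<^bsub>G v\<^esub> b v" "a v \<in> C v" "b v \<in> C v"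
      using ab v by (auto simp: P_mult place_apply)
    then have "x v \<in> dcoset (G v) (C v) s (C v)" by (intro dcosetI)
    then obtain d where d: "d \<in> D" "x v \<in> dcoset (G v) (V v) d (C v)"
      and du: "\<And>e. e \<in> D \<Longrightarrow> x v \<in> dcoset (G v) (V v) e (C v) \<Longrightarrow> e = d"
      using D unfolding dcoset_reps_def by blast
    obtain u k where uk: "u \<in> V v" "k \<in> C v" "x v = u \<otimes>\<^bsub>G v\<^esub> d \<otimes>\<^bsub>G v\<^esub> k"
      using d(2) unfolding mem_dcoset by blast
    have xw: "x w \<in> C w" if w: "w \<in> I" "w \<noteq> v" for w
    proof -
      interpret Gw: Group.group "G w" by (rule groups[OF w(1)])
      interpret Cw: subgroup "C w" "G w" by (rule C[OF w(1)])
      have "a w \<in> C w" "b w \<in> C w" using ab w by auto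
      then show ?thesis using w by (simp add: ab(3) P_mult place_apply Cw.mem_carrier)
    qed
    \<comment> \<open>All components of x away from v go into the right factor.\<close>
    define y where "y = (\<lambda>w\<in>I. if w = v then k else x w)"
    have y: "y \<in> ?C" using xw uk by (auto simp: y_def)
    have xy: "x = ?p u \<otimes>\<^bsub>P\<^esub> ?p d \<otimes>\<^bsub>P\<^esub> y"
    proof (rule extensionalityI[OF _ P_mult_ext])
      show "x \<in> extensional I" using ab(3) P_mult_ext by simp
      fix w assume w: "w \<in> I"
      interpret Gw: Group.group "G w" by (rule groups[OF w])
      show "x w = (?p u \<otimes>\<^bsub>P\<^esub> ?p d \<otimes>\<^bsub>P\<^esub> y) w"
        using w uk(3) xw[OF w] subgroup.mem_carrier[OF C[OF w]]
        by (cases "w = v") (simp_all add: P_mult place_apply y_def)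
    qed
    show "\<exists>!r. r \<in> ?p ` D \<and> x \<in> dcoset P ?V r ?C"
    proof (rule ex1I[of _ "?p d"])
      show "?p d \<in> ?p ` D \<and> x \<in> dcoset P ?V (?p d) ?C"
        using d(1) dcosetI[OF plV[OF uk(1)] y xy] by blast
      fix r assume "r \<in> ?p ` D \<and> x \<in> dcoset P ?V r ?C"
      then obtain e where e: "e \<in> D" "r = ?p e" "x \<in> dcoset P ?V (?p e) ?C" by blast
      then obtain a b where "a \<in> ?V" "b \<in> ?C" "x = a \<otimes>\<^bsub>P\<^esub> ?p e \<otimes>\<^bsub>P\<^esub> b"
        unfolding mem_dcoset by blast
      then have "x v = a v \<otimes>\<^bsub>G v\<^esub> e \<otimes>\<^bsub>G v\<^esub> b v" "a v \<in> V v" "b v \<in> C v"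
        using v by (auto simp: P_mult place_apply)
      then have "x v \<in> dcoset (G v) (V v) e (C v)" by (intro dcosetI)
      then show "r = ?p d" using du e by simp
    qed
  qed
qed

end

section \<open>The norm relations\<close>

locale hecke_tensor =
  fixes R :: "('r, 'c) ring_scheme" and I :: "'v set"
    and G :: "'v \<Rightarrow> 'g monoid" and T :: "'v \<Rightarrow> 'g topology" and H K L U :: "'v \<Rightarrow> 'g set"
    and Hl :: "'v \<Rightarrow> 'g monoid" and THl :: "'v \<Rightarrow> 'g topology"
    and TG TH :: "('v \<Rightarrow> 'g) topology" and \<Upsilon>\<^sub>G \<Upsilon>\<^sub>H :: "('v \<Rightarrow> 'g) set set" and \<Upsilon>l :: "'v \<Rightarrow> 'g set set"
    and N :: "('v \<Rightarrow> 'g, 'r, 'n) ric_data" and M :: "('v \<Rightarrow> 'g, 'r, 'm) ric_data"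
    and \<iota> :: "('v \<Rightarrow> 'g) set \<Rightarrow> ('v \<Rightarrow> 'g) set \<Rightarrow> 'n \<Rightarrow> 'm"
    and Nl :: "'v \<Rightarrow> ('g, 'r, 'a) ric_data" and e :: "'v \<Rightarrow> 'a"
    and \<Theta> :: "('v \<Rightarrow> 'g set) \<Rightarrow> ('v set \<times> (('v \<Rightarrow> 'a) \<Rightarrow> 'r) set) set \<Rightarrow> 'n"
    and \<HH> :: "'v \<Rightarrow> 'g \<Rightarrow> 'r"
  assumes ring: "cring R"
    and G: "v \<in> I \<Longrightarrow> topological_group (G v) (T v)"
    and H: "v \<in> I \<Longrightarrow> subgroup (H v) (G v)"
    and Hl_def: "Hl = (\<lambda>v. (G v)\<lparr>carrier := H v\<rparr>)"
    and K: "v \<in> I \<Longrightarrow> compact_open_subgroup (G v) (T v) (K v)"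
    and U_def: "U = (\<lambda>v. H v \<inter> K v)"
    and L: "v \<in> I \<Longrightarrow> subgroup (L v) (G v)" and LK: "v \<in> I \<Longrightarrow> L v \<subseteq> K v"
    and levels_G: "finite \<nu> \<Longrightarrow> \<nu> \<subseteq> I \<Longrightarrow> level I K L \<nu> \<in> \<Upsilon>\<^sub>G"
    and \<Upsilon>l_def: "\<Upsilon>l = (\<lambda>v. (\<lambda>K'. K' \<inter> H v) ` local_levels (G v) (K v) (L v))"
    and N: "ric_functor (rprod I Hl U) TH \<Upsilon>\<^sub>H R N"
    and M: "ric_functor (rprod I G K) TG \<Upsilon>\<^sub>G R M"
    and \<iota>: "mackey_pushforward (rprod I G K) TG \<Upsilon>\<^sub>G (carrier (rprod I Hl U)) \<Upsilon>\<^sub>H R N M \<iota>"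
    and Nl: "v \<in> I \<Longrightarrow> ric_functor (Hl v) (THl v) (\<Upsilon>l v) R (Nl v)"
    and tensor: "restricted_tensor_functor R I Hl U \<Upsilon>l \<Upsilon>\<^sub>H Nl e N \<Theta>"
    and \<HH>: "v \<in> I \<Longrightarrow> hecke_fun (G v) R (K v) (K v) (\<HH> v)"
begin

lemma group_G: "v \<in> I \<Longrightarrow> Group.group (G v)"
  using G by (simp add: topological_group_def)

lemma group_Hl: "v \<in> I \<Longrightarrow> Group.group (Hl v)"
  using subgroup.subgroup_is_group[OF H group_G] by (simp add: Hl_def)

lemma K_subgroup: "v \<in> I \<Longrightarrow> subgroup (K v) (G v)"
  using K by (simp add: compact_open_subgroup_def)

lemma U_subgroup: "v \<in> I \<Longrightarrow> subgroup (U v) (Hl v)"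
proof -
  assume v: "v \<in> I"
  interpret Gv: Group.group "G v" by (rule group_G[OF v])
  show ?thesis
    unfolding U_def Hl_def
    by (rule Gv.subgroup_incl[OF Gv.subgroups_Inter_pair[OF H[OF v] K_subgroup[OF v]] H[OF v]]) simp
qed

sublocale GG: restricted_product I G K
  by (rule restricted_product.intro) (simp_all add: group_G K_subgroup)

sublocale HH: restricted_product I Hl U
  by (rule restricted_product.intro) (simp_all add: group_Hl U_subgroup)

abbreviation "GG \<equiv> rprod I G K"
abbreviation "place \<equiv> place_incl I G"
abbreviation "lvl \<equiv> level I K L"
abbreviation "hsupp v \<equiv> supp (G v) R (\<HH> v)"
abbreviation "hreps v \<equiv> hecke_reps (G v) R (K v) (K v) (\<HH> v)"
abbreviation "hecke_at k v \<equiv> hecke_place I G K R M k v (\<HH> v)"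
abbreviation "HH \<equiv> rprod I Hl U"

text \<open>A pushforward sees its source group as a subset of the ambient group, while N lives on a
  restricted product of its own. The two structures share their multiplication and unit.\<close>

lemma HH_eq: "GG\<lparr>carrier := carrier HH\<rparr> = HH"
  by (simp add: rprod_def Hl_def)

sublocale F: functor_pushforward GG TG \<Upsilon>\<^sub>G "carrier HH" \<Upsilon>\<^sub>H R N M \<iota> TH
  using \<iota> M N by (simp add: functor_pushforward_def HH_eq)

sublocale NH: ric_functor HH TH \<Upsilon>\<^sub>H R N
  by (rule N)

sublocale tensor: restricted_tensor_functor R I Hl U \<Upsilon>l \<Upsilon>\<^sub>H Nl e N \<Theta>
  by (rule tensor)

lemma HH_one: "\<one>\<^bsub>HH\<^esub> = \<one>\<^bsub>GG\<^esub>"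
  by (simp add: rprod_def Hl_def)

lemma place_Hl: "place_incl I Hl v h = place v h"
  by (simp add: place_incl_def Hl_def fun_eq_iff)

section \<open>Pure tensors in N\<close>

abbreviation "PL \<equiv> product_levels I U \<Upsilon>l \<Upsilon>\<^sub>H"
abbreviation "rf W \<equiv> rfam I (\<lambda>v. obj (Nl v) (W v)) e"

definition ptensor :: "('v \<Rightarrow> 'g set) \<Rightarrow> ('v \<Rightarrow> 'a) \<Rightarrow> 'n" where
  "ptensor W x = \<Theta> W (functor_tensor_pure R I U Nl e W x)"

lemma PL_D:
  assumes "W \<in> PL"
  shows "v \<in> I \<Longrightarrow> W v \<in> \<Upsilon>l v" "finite {v\<in>I. W v \<noteq> U v}" "(Pi\<^sub>E I W) \<in> \<Upsilon>\<^sub>H" "W \<in> extensional I"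
  using assms by (auto simp: product_levels_def PiE_iff)

lemma rf_D:
  assumes "x \<in> rf W"
  shows "v \<in> I \<Longrightarrow> x v \<in> carrier (obj (Nl v) (W v))" "finite {v\<in>I. x v \<noteq> e v}" "x \<in> extensional I"
  using assms by (auto simp: rfam_def PiE_iff)

lemma restricted_family:
  assumes "W \<in> PL"
  shows "restricted_family R I {v\<in>I. W v \<noteq> U v} (\<lambda>v. obj (Nl v) (W v)) e"
proof (intro restricted_family.intro restricted_family_axioms.intro ring)
  show "Module.module R (obj (Nl v) (W v))" if "v \<in> I" for v
    using ric_functor.module_obj[OF Nl] PL_D(1)[OF assms] that by blast
  show "e v \<in> carrier (obj (Nl v) (W v))" if "v \<in> I - {v\<in>I. W v \<noteq> U v}" for v
    using tensor.vectors that by auto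
qed (use PL_D[OF assms] in auto)

lemma ptensor_closed:
  assumes "W \<in> PL" "x \<in> rf W"
  shows "ptensor W x \<in> carrier (obj N (Pi\<^sub>E I W))"
proof -
  interpret restricted_family R I "{v\<in>I. W v \<noteq> U v}" "\<lambda>v. obj (Nl v) (W v)" e
    by (rule restricted_family[OF assms(1)])
  have "\<Theta> W \<in> mod_hom R (functor_tensor R I U Nl e W) (obj N (Pi\<^sub>E I W))"
    using tensor.iso[OF assms(1)] by (simp add: mod_iso_def)
  then show ?thesis
    unfolding ptensor_def by (rule mod_homD(1)) (rule rtensor_pure_closed[OF assms(2)])
qed

text \<open>This is what moves a linear combination of correspondences at v into the factor at v of
  a pure tensor.\<close>

lemma ptensor_mod_hom:
  assumes W: "W \<in> PL" and x: "x \<in> rf W" and v: "v \<in> I"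
  shows "(\<lambda>c. ptensor W (x(v := c))) \<in> mod_hom R (obj (Nl v) (W v)) (obj N (Pi\<^sub>E I W))"
proof -
  interpret restricted_family R I "{v\<in>I. W v \<noteq> U v}" "\<lambda>v. obj (Nl v) (W v)" e
    by (rule restricted_family[OF W])
  have "\<Theta> W \<in> mod_hom R (functor_tensor R I U Nl e W) (obj N (Pi\<^sub>E I W))"
    using tensor.iso[OF W] by (simp add: mod_iso_def)
  note \<Theta> = mod_homD[OF this]
  note cl = rtensor_pure_closed[OF rfam_upd[OF x v]]
  show ?thesis
    unfolding mod_hom_def ptensor_def
    by (auto simp: \<Theta> cl rtensor_pure_add[OF x v] rtensor_pure_smult[OF x v])
qed

lemma push_ptensor:
  assumes "W \<in> PL" "W' \<in> PL" "h \<in> Hom_P HH (Pi\<^sub>E I W) (Pi\<^sub>E I W')" "x \<in> rf W"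
  shows "push N (Pi\<^sub>E I W) (Pi\<^sub>E I W') h (ptensor W x) =
    ptensor W' (\<lambda>v\<in>I. push (Nl v) (W v) (W' v) (h v) (x v))"
  unfolding ptensor_def by (rule tensor.push_pure[OF assms])

lemma pull_ptensor:
  assumes "W \<in> PL" "W' \<in> PL" "h \<in> Hom_P HH (Pi\<^sub>E I W) (Pi\<^sub>E I W')" "x \<in> rf W'"
  shows "pull N (Pi\<^sub>E I W) (Pi\<^sub>E I W') h (ptensor W' x) =
    ptensor W (\<lambda>v\<in>I. pull (Nl v) (W v) (W' v) (h v) (x v))"
  unfolding ptensor_def by (rule tensor.pull_pure[OF assms])

text \<open>The correspondence is a pullback to W \<inter> h W' h^-1 followed by a push, and both
  act factor by factor. Away from v the element is trivial and the three levels agree, so the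
  identity laws leave the factors unchanged.\<close>

lemma hecke_push_ptensor:
  assumes v: "v \<in> I" and h: "h \<in> H v" and W: "W \<in> PL" "W' \<in> PL"
    and WW: "\<And>w. w \<in> I \<Longrightarrow> w \<noteq> v \<Longrightarrow> W w = W' w" and x: "x \<in> rf W"
  shows "hecke_push HH N (Pi\<^sub>E I W) (place v h) (Pi\<^sub>E I W') (ptensor W x) =
    ptensor W' (x(v := hecke_push (Hl v) (Nl v) (W v) h (W' v) (x v)))"
proof -
  let ?h = "place v h"
  interpret Nv: ric_functor "Hl v" "THl v" "\<Upsilon>l v" R "Nl v" by (rule Nl[OF v])
  have hl: "h \<in> carrier (Hl v)" using h by (simp add: Hl_def)
  have hH: "?h \<in> carrier HH" using HH.place_closed[OF v hl] by (simp add: place_Hl)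
  have hv: "?h v = h" "\<And>w. w \<in> I \<Longrightarrow> w \<noteq> v \<Longrightarrow> ?h w = \<one>\<^bsub>Hl w\<^esub>"
    using v by (simp_all add: place_incl_def Hl_def)
  \<comment> \<open>\<open>Z\<close> lists the components of the intermediate level; factorwise
    action is available only for levels known to be such products.\<close>
  define Z where "Z = (\<lambda>w\<in>I. W w \<inter> conj_by (Hl w) (?h w) (W' w))"
  have Zv: "Z v = W v \<inter> conj_by (Hl v) h (W' v)" using v by (simp add: Z_def hv)
  have Wc: "W w \<subseteq> carrier (Hl w)" if "w \<in> I" for w
  proof -
    interpret Nw: ric_functor "Hl w" "THl w" "\<Upsilon>l w" R "Nl w" by (rule Nl[OF that])
    show ?thesis using Nw.level_subset[OF PL_D(1)[OF W(1) that]] .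
  qed
  have Zw: "Z w = W w" if "w \<in> I" "w \<noteq> v" for w
    using group.conj_by_one[OF group_Hl[OF that(1)] Wc[OF that(1)]] that by (simp add: Z_def hv WW[symmetric])
  have PZ: "(Pi\<^sub>E I Z) = (Pi\<^sub>E I W) \<inter> conj_by HH ?h (Pi\<^sub>E I W')"
    unfolding HH.conj_by_PiE[OF hH] PiE_Int by (rule PiE_cong) (simp add: Z_def)
  have Z: "Z \<in> PL"
    unfolding product_levels_def
  proof (intro CollectI conjI)
    show "Z \<in> (\<Pi>\<^sub>E v\<in>I. \<Upsilon>l v)"
    proof (rule PiE_I)
      fix w assume w: "w \<in> I"
      show "Z w \<in> \<Upsilon>l w"
        using Zv Zw[OF w] PL_D(1)[OF W(1)] PL_D(1)[OF W(2)] Nv.T1 Nv.T3 hl v w by (cases "w = v") auto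
    qed (simp add: Z_def)
    have "{w\<in>I. Z w \<noteq> U w} \<subseteq> insert v {w\<in>I. W w \<noteq> U w}" using Zw by auto
    then show "finite {w\<in>I. Z w \<noteq> U w}" using PL_D(2)[OF W(1)] by (meson finite_insert finite_subset)
    show "(Pi\<^sub>E I Z) \<in> \<Upsilon>\<^sub>H"
      unfolding PZ using NH.T1 NH.T3 PL_D(3)[OF W(1)] PL_D(3)[OF W(2)] hH by blast
  qed
  have hom1: "\<one>\<^bsub>HH\<^esub> \<in> Hom_P HH (Pi\<^sub>E I Z) (Pi\<^sub>E I W)"
    using PZ by (intro NH.level_Hom_P_one PL_D(3) Z W) blast
  have hom2: "?h \<in> Hom_P HH (Pi\<^sub>E I Z) (Pi\<^sub>E I W')"
    using PZ hH NH.level_Hom_P_iff[OF PL_D(3)[OF Z] PL_D(3)[OF W(2)]] by blast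
  define x1 where "x1 = (\<lambda>w\<in>I. pull (Nl w) (Z w) (W w) (\<one>\<^bsub>HH\<^esub> w) (x w))"
  have x1v: "x1 v = pull (Nl v) (Z v) (W v) \<one>\<^bsub>Hl v\<^esub> (x v)"
    using v by (simp add: x1_def HH.P_one)
  have x1w: "x1 w = x w" if w: "w \<in> I" "w \<noteq> v" for w
  proof -
    interpret Nw: ric_functor "Hl w" "THl w" "\<Upsilon>l w" R "Nl w" by (rule Nl[OF w(1)])
    show ?thesis
      using Nw.pull_one[OF PL_D(1)[OF W(1) w(1)]] rf_D(1)[OF x w(1)] Zw w by (simp add: x1_def HH.P_one)
  qed
  have Zv': "Z v \<in> \<Upsilon>l v" "W v \<in> \<Upsilon>l v" "W' v \<in> \<Upsilon>l v" "Z v \<subseteq> W v"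
    using PL_D(1)[OF Z v] PL_D(1)[OF W(1) v] PL_D(1)[OF W(2) v] Zv by auto
  have x1: "x1 \<in> rf Z"
  proof -
    have "x1 w \<in> carrier (obj (Nl w) (Z w))" if w: "w \<in> I" for w
    proof (cases "w = v")
      case True
      then show ?thesis
        using Nv.pull_closed[OF Zv'(1,2) Nv.level_Hom_P_one[OF Zv'(1,2,4)] rf_D(1)[OF x v]] x1v by simp
    next
      case False
      then show ?thesis using x1w Zw w rf_D(1)[OF x w] by simp
    qed
    moreover have "{w\<in>I. x1 w \<noteq> e w} \<subseteq> insert v {w\<in>I. x w \<noteq> e w}" using x1w by auto
    then have "finite {w\<in>I. x1 w \<noteq> e w}" using rf_D(2)[OF x] by (meson finite_insert finite_subset)
    ultimately show ?thesis by (simp add: rfam_def PiE_iff x1_def)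
  qed
  have "hecke_push HH N (Pi\<^sub>E I W) ?h (Pi\<^sub>E I W') (ptensor W x) =
      push N (Pi\<^sub>E I Z) (Pi\<^sub>E I W') ?h (pull N (Pi\<^sub>E I Z) (Pi\<^sub>E I W) \<one>\<^bsub>HH\<^esub> (ptensor W x))"
    using NH.hecke_push_eq[OF PL_D(3)[OF W(1)] PL_D(3)[OF W(2)] hH] ptensor_closed[OF W(1) x] PZ by auto
  also have "\<dots> = push N (Pi\<^sub>E I Z) (Pi\<^sub>E I W') ?h (ptensor Z x1)"
    unfolding x1_def using pull_ptensor[OF Z W(1) hom1 x] by simp
  also have "\<dots> = ptensor W' (\<lambda>w\<in>I. push (Nl w) (Z w) (W' w) (?h w) (x1 w))"
    by (rule push_ptensor[OF Z W(2) hom2 x1])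
  also have "(\<lambda>w\<in>I. push (Nl w) (Z w) (W' w) (?h w) (x1 w)) =
      x(v := hecke_push (Hl v) (Nl v) (W v) h (W' v) (x v))"
  proof
    fix w
    consider "w \<notin> I" | "w = v" | "w \<in> I" "w \<noteq> v" by blast
    then show "(\<lambda>w\<in>I. push (Nl w) (Z w) (W' w) (?h w) (x1 w)) w =
      (x(v := hecke_push (Hl v) (Nl v) (W v) h (W' v) (x v))) w"
    proof cases
      case 1
      then show ?thesis using v rf_D(3)[OF x] by (auto simp: extensional_def)
    next
      case 2
      then show ?thesis
        using v Nv.hecke_push_eq[OF Zv'(2,3) hl rf_D(1)[OF x v]] by (simp add: hv x1v Zv)
    next
      case 3
      interpret Nw: ric_functor "Hl w" "THl w" "\<Upsilon>l w" R "Nl w" by (rule Nl[OF 3(1)])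
      show ?thesis
        using 3 Nw.push_one[OF PL_D(1)[OF W(1) 3(1)] rf_D(1)[OF x 3(1)]]
        by (simp add: hv x1w Zw WW[symmetric])
    qed
  qed
  finally show ?thesis .
qed

text \<open>The components at \<open>v\<close> of \<open>t K[\<nu>] t\<inverse>\<close> and of its intersection with \<open>H\<close>; \<open>e v\<close> is the vector
  \<open>x\<^bsub>U v\<^esub>\<close>, and \<open>twisted t \<nu> x\<close> is \<open>[t]\<^sub>* \<circ> \<iota>\<^sub>*\<close> applied to \<open>\<otimes> x v\<close>.\<close>

definition gcomp :: "('v \<Rightarrow> 'g) \<Rightarrow> 'v set \<Rightarrow> 'v \<Rightarrow> 'g set" where
  "gcomp t \<nu> v = conj_by (G v) (t v) (if v \<in> \<nu> then L v else K v)"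

definition hcomp :: "('v \<Rightarrow> 'g) \<Rightarrow> 'v set \<Rightarrow> 'v \<Rightarrow> 'g set" where
  "hcomp t \<nu> = (\<lambda>v\<in>I. H v \<inter> gcomp t \<nu> v)"

definition twisted :: "('v \<Rightarrow> 'g) \<Rightarrow> 'v set \<Rightarrow> ('v \<Rightarrow> 'a) \<Rightarrow> 'm" where
  "twisted t \<nu> x = push M (conj_by GG t (lvl \<nu>)) (lvl \<nu>) t
     (\<iota> (Pi\<^sub>E I (hcomp t \<nu>)) (conj_by GG t (lvl \<nu>)) (ptensor (hcomp t \<nu>) x))"

lemma level_component_subgroup: "v \<in> I \<Longrightarrow> subgroup (if v \<in> \<nu> then L v else K v) (G v)"
  using K_subgroup L by simp

lemma gcomp_subgroup:
  assumes "t \<in> carrier GG" "v \<in> I"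
  shows "subgroup (gcomp t \<nu> v) (G v)"
  unfolding gcomp_def
  by (rule group.subgroup_conj_by[OF group_G level_component_subgroup GG.P_closed]) (use assms in auto)

lemma conj_level: "t \<in> carrier GG \<Longrightarrow> conj_by GG t (lvl \<nu>) = (Pi\<^sub>E I (gcomp t \<nu>))"
  unfolding level_def gcomp_def by (rule GG.conj_by_PiE)

lemma Hl_carrier: "carrier (Hl v) = H v"
  by (simp add: Hl_def)

context
  fixes t \<nu>
  assumes t: "t \<in> carrier GG" and \<nu>: "finite \<nu>" "\<nu> \<subseteq> I"
begin

lemma conj_level_mem: "conj_by GG t (lvl \<nu>) \<in> \<Upsilon>\<^sub>G"
  using F.M.T1 levels_G[OF \<nu>] t by blast

text \<open>For almost all v the component of t lies in \<open>K v\<close>, and conjugation by it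
  preserves \<open>K v\<close>.\<close>

lemma finite_hcomp: "finite {v\<in>I. hcomp t \<nu> v \<noteq> U v}"
proof -
  have "{v\<in>I. hcomp t \<nu> v \<noteq> U v} \<subseteq> \<nu> \<union> {v\<in>I. t v \<notin> K v}"
    using group.conj_by_subgroup[OF group_G K_subgroup] by (auto simp: hcomp_def gcomp_def U_def)
  moreover have "finite (\<nu> \<union> {v\<in>I. t v \<notin> K v})" using \<nu> t by (simp add: GG.P_carrier)
  ultimately show ?thesis by (rule finite_subset)
qed

text \<open>The full product already satisfies the finiteness condition of the restricted product,
  because almost all components are \<open>U v\<close>.\<close>

lemma PiE_hcomp: "(Pi\<^sub>E I (hcomp t \<nu>)) = carrier HH \<inter> conj_by GG t (lvl \<nu>)"
proof (intro equalityI subsetI)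
  fix x assume x: "x \<in> (Pi\<^sub>E I (hcomp t \<nu>))"
  have "{v\<in>I. x v \<notin> U v} \<subseteq> {v\<in>I. hcomp t \<nu> v \<noteq> U v}" using x by (auto simp: PiE_iff)
  then have "finite {v\<in>I. x v \<notin> U v}" using finite_hcomp by (rule finite_subset)
  then show "x \<in> carrier HH \<inter> conj_by GG t (lvl \<nu>)"
    using x unfolding conj_level[OF t] by (auto simp: HH.P_carrier PiE_iff hcomp_def Hl_carrier)
next
  fix x assume "x \<in> carrier HH \<inter> conj_by GG t (lvl \<nu>)"
  then show "x \<in> (Pi\<^sub>E I (hcomp t \<nu>))"
    unfolding conj_level[OF t] by (auto simp: HH.P_carrier PiE_iff hcomp_def Hl_carrier)
qed

lemma PiE_hcomp_mem: "(Pi\<^sub>E I (hcomp t \<nu>)) \<in> \<Upsilon>\<^sub>H"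
  unfolding PiE_hcomp using F.level_Int_H[OF conj_level_mem] by (simp add: Int_commute)

lemma hcomp_PL: "hcomp t \<nu> \<in> PL"
  unfolding product_levels_def
proof (intro CollectI conjI PiE_I)
  fix v assume v: "v \<in> I"
  \<comment> \<open>A single conjugate is the intersection of a one-element family.\<close>
  have "gcomp t \<nu> v \<in> local_levels (G v) (K v) (L v)"
    unfolding local_levels_def gcomp_def using GG.P_closed[OF t v]
    by (intro CollectI exI[of _ "{conj_by (G v) (t v) (if v \<in> \<nu> then L v else K v)}"]) auto
  then show "hcomp t \<nu> v \<in> \<Upsilon>l v"
    using v by (auto simp: \<Upsilon>l_def hcomp_def)
next
  show "hcomp t \<nu> v = undefined" if "v \<notin> I" for v using that by (simp add: hcomp_def)
qed (rule finite_hcomp PiE_hcomp_mem)+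

lemma twisted_closed:
  assumes x: "x \<in> rf (hcomp t \<nu>)"
  shows "\<iota> (Pi\<^sub>E I (hcomp t \<nu>)) (conj_by GG t (lvl \<nu>)) (ptensor (hcomp t \<nu>) x)
      \<in> carrier (obj M (conj_by GG t (lvl \<nu>)))"
    and "twisted t \<nu> x \<in> carrier (obj M (lvl \<nu>))"
proof -
  show 1: "\<iota> (Pi\<^sub>E I (hcomp t \<nu>)) (conj_by GG t (lvl \<nu>)) (ptensor (hcomp t \<nu>) x)
      \<in> carrier (obj M (conj_by GG t (lvl \<nu>)))"
    using PiE_hcomp by (intro F.\<iota>_closed PiE_hcomp_mem conj_level_mem ptensor_closed hcomp_PL x) blast
  have "t \<in> Hom_P GG (conj_by GG t (lvl \<nu>)) (lvl \<nu>)"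
    using F.M.level_Hom_P_iff[OF conj_level_mem levels_G[OF \<nu>]] t by blast
  then show "twisted t \<nu> x \<in> carrier (obj M (lvl \<nu>))"
    unfolding twisted_def by (intro F.M.push_closed conj_level_mem levels_G \<nu> 1)
qed

end

text \<open>Projecting after [t]_* is the same as projecting between the conjugated levels first.
  That projection commutes with \<iota> and then acts on the pure tensor factor by factor.\<close>

lemma push_twisted:
  assumes t: "t \<in> carrier GG" and \<mu>: "finite \<mu>" "\<mu> \<subseteq> I" and \<nu>: "\<nu> \<subseteq> \<mu>" and x: "x \<in> rf (hcomp t \<mu>)"
  shows "push M (lvl \<mu>) (lvl \<nu>) \<one>\<^bsub>GG\<^esub> (twisted t \<mu> x) =
    twisted t \<nu> (\<lambda>v\<in>I. push (Nl v) (hcomp t \<mu> v) (hcomp t \<nu> v) \<one>\<^bsub>Hl v\<^esub> (x v))"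
proof -
  have \<nu>': "finite \<nu>" "\<nu> \<subseteq> I" using \<mu> \<nu> finite_subset by auto
  define a where "a = lvl \<mu>"
  define b where "b = lvl \<nu>"
  define A where "A = conj_by GG t a"
  define B where "B = conj_by GG t b"
  define V where "V = (Pi\<^sub>E I (hcomp t \<mu>))"
  define W where "W = (Pi\<^sub>E I (hcomp t \<nu>))"
  note defs = a_def[symmetric] b_def[symmetric] A_def[symmetric] B_def[symmetric] V_def[symmetric] W_def[symmetric]
  have lv: "a \<in> \<Upsilon>\<^sub>G" "b \<in> \<Upsilon>\<^sub>G" "A \<in> \<Upsilon>\<^sub>G" "B \<in> \<Upsilon>\<^sub>G" "V \<in> \<Upsilon>\<^sub>H" "W \<in> \<Upsilon>\<^sub>H"
    using levels_G[OF \<mu>] levels_G[OF \<nu>'] conj_level_mem[OF t \<mu>] conj_level_mem[OF t \<nu>']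
      PiE_hcomp_mem[OF t \<mu>] PiE_hcomp_mem[OF t \<nu>'] by (simp_all add: defs)
  have ab: "a \<subseteq> b" unfolding a_def b_def level_def
    by (rule PiE_mono) (use \<nu> LK in auto)
  have AB: "A \<subseteq> B" unfolding A_def B_def using ab by (rule conj_by_mono)
  have V: "V = carrier HH \<inter> A" and W: "W = carrier HH \<inter> B"
    using PiE_hcomp[OF t \<mu>] PiE_hcomp[OF t \<nu>'] by (simp_all add: defs)
  have VW: "V \<subseteq> W" using AB V W by blast
  define z where "z = ptensor (hcomp t \<mu>) x"
  have z: "z \<in> carrier (obj N V)" unfolding z_def V_def by (intro ptensor_closed hcomp_PL t \<mu> x)
  define u where "u = \<iota> V A z"
  have u: "u \<in> carrier (obj M A)" using F.\<iota>_closed[OF lv(5,3) _ z] V by (simp add: u_def)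
  have homs: "t \<in> Hom_P GG A a" "t \<in> Hom_P GG B b" "\<one>\<^bsub>GG\<^esub> \<in> Hom_P GG a b" "\<one>\<^bsub>GG\<^esub> \<in> Hom_P GG A B"
    using F.M.level_Hom_P_iff lv t F.M.level_Hom_P_one ab AB by (auto simp: A_def B_def)
  have "push M a b \<one>\<^bsub>GG\<^esub> (push M A a t u) = push M A b t u"
    using F.M.push_comp[OF lv(3,1,2) homs(1,3) u] t by simp
  also have "\<dots> = push M B b t (push M A B \<one>\<^bsub>GG\<^esub> u)"
    using F.M.push_comp[OF lv(3,4,2) homs(4,2) u] t by simp
  also have "push M A B \<one>\<^bsub>GG\<^esub> u = \<iota> W B (push N V W \<one>\<^bsub>GG\<^esub> z)"
    unfolding u_def
    using VW AB W V z subgroup.one_closed[OF F.subgroup_H] F.M.level_subset[OF lv(4)] F.level_H_subset[OF lv(6)] F.H_subset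
    by (intro F.\<iota>_push[symmetric, OF lv(6,5,4,3)]) (simp_all add: GG.P.conj_by_one le_infI2)
  also have "push N V W \<one>\<^bsub>GG\<^esub> z = ptensor (hcomp t \<nu>) (\<lambda>v\<in>I. push (Nl v) (hcomp t \<mu> v) (hcomp t \<nu> v) (\<one>\<^bsub>HH\<^esub> v) (x v))"
    unfolding z_def V_def W_def HH_one[symmetric]
    by (intro push_ptensor hcomp_PL t \<mu> \<nu>' x NH.level_Hom_P_one) (use lv(5,6) VW in \<open>simp_all add: defs\<close>)
  also have "(\<lambda>v\<in>I. push (Nl v) (hcomp t \<mu> v) (hcomp t \<nu> v) (\<one>\<^bsub>HH\<^esub> v) (x v)) =
      (\<lambda>v\<in>I. push (Nl v) (hcomp t \<mu> v) (hcomp t \<nu> v) \<one>\<^bsub>Hl v\<^esub> (x v))"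
    by (rule restrict_ext) (simp add: HH.P_one)
  finally show ?thesis
    unfolding twisted_def by (simp only: u_def z_def V_def W_def A_def B_def a_def b_def)
qed

section \<open>The Hecke operator at one place\<close>

lemma \<HH>_closed: "v \<in> I \<Longrightarrow> g \<in> carrier (G v) \<Longrightarrow> \<HH> v g \<in> carrier R"
  using group.hecke_fun_closed[OF group_G ring \<HH>] .

lemma supp_carrier: "hsupp v \<subseteq> carrier (G v)"
  by (auto simp: supp_def)

lemma supp_stable: "v \<in> I \<Longrightarrow> x \<in> hsupp v \<Longrightarrow> dcoset (G v) (K v) x (K v) \<subseteq> hsupp v"
  using group.supp_dcoset[OF group_G ring \<HH> K_subgroup K_subgroup] .

lemma hreps_correct:
  assumes v: "v \<in> I"
  shows "dcoset_reps (G v) (K v) (hsupp v) (K v) (hreps v)"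
    and "finite (hreps v)"
    and "hreps v \<subseteq> carrier (G v)"
proof -
  show 1: "dcoset_reps (G v) (K v) (hsupp v) (K v) (hreps v)"
    unfolding hecke_reps_def
    by (rule someI_ex, rule group.dcoset_reps_ex[OF group_G[OF v] K_subgroup[OF v] K_subgroup[OF v] supp_carrier])
      (rule supp_stable[OF v])
  show "finite (hreps v)"
    by (rule group.finite_supp_reps[OF group_G[OF v] ring \<HH>[OF v] K_subgroup[OF v] K_subgroup[OF v] 1])
  show "hreps v \<subseteq> carrier (G v)"
    using 1 supp_carrier unfolding dcoset_reps_def by blast
qed

lemma hecke_place_mod_hom:
  assumes v: "v \<in> I" and k: "k \<in> \<Upsilon>\<^sub>G"
  shows "hecke_at k v \<in> mod_hom R (obj M k) (obj M k)"
proof -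
  interpret Mk: Module.module R "obj M k" by (rule F.M.module_obj[OF k])
  let ?S = "hreps v"
  let ?h = "\<lambda>\<sigma>. hecke_push GG M k (place v \<sigma>) k"
  note S = hreps_correct[OF v]
  have h: "?h \<sigma> \<in> mod_hom R (obj M k) (obj M k)" if "\<sigma> \<in> ?S" for \<sigma>
    using F.M.hecke_push_mod_hom[OF k k] GG.place_closed[OF v] S(3) that by blast
  note hD = mod_homD[OF h]
  have c: "\<HH> v \<sigma> \<in> carrier R" if "\<sigma> \<in> ?S" for \<sigma> using \<HH>_closed[OF v] S(3) that by blast
  have cl: "\<HH> v \<sigma> \<odot>\<^bsub>obj M k\<^esub> ?h \<sigma> x \<in> carrier (obj M k)" if "\<sigma> \<in> ?S" "x \<in> carrier (obj M k)" for \<sigma> x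
    using c hD(1) that by simp
  show ?thesis
    unfolding mod_hom_def
  proof (intro CollectI conjI ballI funcsetI)
    fix x assume x: "x \<in> carrier (obj M k)"
    show "hecke_at k v x \<in> carrier (obj M k)"
      unfolding hecke_place_def using cl x by (intro Mk.M.finsum_closed) auto
    fix y assume y: "y \<in> carrier (obj M k)"
    have "hecke_at k v (x \<oplus>\<^bsub>obj M k\<^esub> y) =
      (\<Oplus>\<^bsub>obj M k\<^esub>\<sigma>\<in>?S. (\<HH> v \<sigma> \<odot>\<^bsub>obj M k\<^esub> ?h \<sigma> x) \<oplus>\<^bsub>obj M k\<^esub> (\<HH> v \<sigma> \<odot>\<^bsub>obj M k\<^esub> ?h \<sigma> y))"
      unfolding hecke_place_def using cl x y c hD by (intro Mk.M.finsum_cong') (auto simp: Mk.smult_r_distr)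
    also have "\<dots> = hecke_at k v x \<oplus>\<^bsub>obj M k\<^esub> hecke_at k v y"
      unfolding hecke_place_def using cl x y by (intro Mk.M.finsum_addf) auto
    finally show "hecke_at k v (x \<oplus>\<^bsub>obj M k\<^esub> y) =
      hecke_at k v x \<oplus>\<^bsub>obj M k\<^esub> hecke_at k v y" .
  next
    fix a x assume a: "a \<in> carrier R" and x: "x \<in> carrier (obj M k)"
    have "hecke_at k v (a \<odot>\<^bsub>obj M k\<^esub> x) =
      (\<Oplus>\<^bsub>obj M k\<^esub>\<sigma>\<in>?S. a \<odot>\<^bsub>obj M k\<^esub> (\<HH> v \<sigma> \<odot>\<^bsub>obj M k\<^esub> ?h \<sigma> x))"
      unfolding hecke_place_def
    proof (rule Mk.M.finsum_cong')
      fix \<sigma> assume \<sigma>: "\<sigma> \<in> ?S"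
      show "\<HH> v \<sigma> \<odot>\<^bsub>obj M k\<^esub> ?h \<sigma> (a \<odot>\<^bsub>obj M k\<^esub> x) = a \<odot>\<^bsub>obj M k\<^esub> (\<HH> v \<sigma> \<odot>\<^bsub>obj M k\<^esub> ?h \<sigma> x)"
        using a x c[OF \<sigma>] hD(1,3)[OF \<sigma>] by (simp add: Mk.smult_assoc1[symmetric] Mk.R.m_comm)
    qed (use a x cl in auto)
    also have "\<dots> = a \<odot>\<^bsub>obj M k\<^esub> hecke_at k v x"
      unfolding hecke_place_def using cl x a S(2) by (intro Mk.finsum_smult_ldistr[symmetric]) auto
    finally show "hecke_at k v (a \<odot>\<^bsub>obj M k\<^esub> x) = a \<odot>\<^bsub>obj M k\<^esub> hecke_at k v x" .
  qed
qed

lemma place_mult_closed: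
  "v \<in> I \<Longrightarrow> c \<in> carrier (G v) \<Longrightarrow> t \<in> carrier GG \<Longrightarrow> place v c \<otimes>\<^bsub>GG\<^esub> t \<in> carrier GG"
  using GG.P.m_closed GG.place_closed by blast

lemma place_HH: "v \<in> I \<Longrightarrow> h \<in> H v \<Longrightarrow> place v h \<in> carrier HH"
  using HH.place_closed[of v h] by (simp add: place_Hl Hl_carrier)

text \<open>Trivial at v, t commutes with every embedded representative \<sigma>, so
  \<open>hecke_push_push_commute\<close> applies to each summand.\<close>

lemma hecke_at_push_commute:
  assumes v: "v \<in> I" and k: "k \<in> \<Upsilon>\<^sub>G" and t: "t \<in> carrier GG" "t v = \<one>\<^bsub>G v\<^esub>"
  defines "k' \<equiv> conj_by GG t k"
  assumes u: "u \<in> carrier (obj M k')"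
  shows "hecke_at k v (push M k' k t u) = push M k' k t (hecke_at k' v u)"
proof -
  have k': "k' \<in> \<Upsilon>\<^sub>G" unfolding k'_def by (rule F.M.T1[OF k t(1)])
  have t': "t \<in> Hom_P GG k' k" using F.M.level_Hom_P_iff[OF k' k] t by (simp add: k'_def)
  note p = F.M.push_hom[OF k' k t']
  interpret Mk: Module.module R "obj M k" by (rule F.M.module_obj[OF k])
  interpret Mk': Module.module R "obj M k'" by (rule F.M.module_obj[OF k'])
  have S: "\<sigma> \<in> carrier (G v)" if "\<sigma> \<in> hreps v" for \<sigma> using hreps_correct(3)[OF v] that by blast
  note pS = GG.place_closed[OF v S] and cS = \<HH>_closed[OF v S]
  note hcl = F.M.hecke_push_closed[OF k' k' pS u]
  have "hecke_at k v (push M k' k t u) =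
      (\<Oplus>\<^bsub>obj M k\<^esub>\<sigma>\<in>hreps v. push M k' k t (\<HH> v \<sigma> \<odot>\<^bsub>obj M k'\<^esub> hecke_push GG M k' (place v \<sigma>) k' u))"
    unfolding hecke_place_def
  proof (rule Mk.M.finsum_cong'[OF refl])
    fix \<sigma> assume \<sigma>: "\<sigma> \<in> hreps v"
    have "hecke_push GG M k (place v \<sigma>) k (push M k' k t u) =
        push M k' k t (hecke_push GG M k' (place v \<sigma>) k' u)"
      using F.M.hecke_push_push_commute[OF k pS[OF \<sigma>] t(1) GG.place_commute[OF v S[OF \<sigma>] t]] u
      by (simp add: k'_def)
    then show "\<HH> v \<sigma> \<odot>\<^bsub>obj M k\<^esub> hecke_push GG M k (place v \<sigma>) k (push M k' k t u) =
        push M k' k t (\<HH> v \<sigma> \<odot>\<^bsub>obj M k'\<^esub> hecke_push GG M k' (place v \<sigma>) k' u)"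
      using mod_homD(3)[OF p cS[OF \<sigma>] hcl[OF \<sigma>]] by simp
  qed (use mod_homD(1)[OF p] cS hcl in auto)
  also have "\<dots> = push M k' k t (hecke_at k' v u)"
    unfolding hecke_place_def
    by (rule mod_hom_finsum[symmetric, OF F.M.module_obj[OF k'] F.M.module_obj[OF k] p]) (use cS hcl in auto)
  finally show ?thesis .
qed

text \<open>These are exactly the representatives over which \<open>hecke_fun_push\<close> sums for
  h -> \<open>\<HH>\<close>(h \<gamma>), so the sums below match the operator in the local
  hypothesis with no change of representatives.\<close>

abbreviation fibre_reps :: "'v \<Rightarrow> 'g \<Rightarrow> 'g set" where
  "fibre_reps v \<gamma> \<equiv> hecke_reps (Hl v) R (U v) (H v \<inter> conj_by (G v) \<gamma> (K v)) (\<lambda>h. \<HH> v (h \<otimes>\<^bsub>G v\<^esub> \<gamma>))"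

section \<open>The support modulo \<open>U v\<close>, sorted by left classes modulo
  \<open>H v\<close>\<close>

context
  fixes v J \<gamma>
  assumes v: "v \<in> I" and J: "finite J" "inj_on \<gamma> J"
    and \<gamma>: "dcoset_reps (G v) (H v) (H v <#>\<^bsub>G v\<^esub> hsupp v) (K v) (\<gamma> ` J)"
begin

interpretation Gv: topological_group "G v" "T v"
  by (rule G[OF v])

lemma \<gamma>_closed: "j \<in> J \<Longrightarrow> \<gamma> j \<in> carrier (G v)"
proof -
  assume "j \<in> J"
  then have "\<gamma> j \<in> H v <#>\<^bsub>G v\<^esub> hsupp v"
    using \<gamma> by (auto simp: dcoset_reps_def)
  then obtain h s where hs: "h \<in> H v" "s \<in> hsupp v" "\<gamma> j = h \<otimes>\<^bsub>G v\<^esub> s"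
    unfolding set_mult_def by blast
  then show ?thesis
    using Gv.m_closed subgroup.mem_carrier[OF H[OF v]] supp_carrier by auto
qed

lemma U_subgroup_G: "subgroup (U v) (G v)" "U v \<subseteq> H v" "U v \<subseteq> K v"
  using Gv.subgroups_Inter_pair[OF H[OF v] K_subgroup[OF v]] by (simp_all add: U_def)

lemma supp_stable_U: "x \<in> hsupp v \<Longrightarrow> dcoset (G v) (U v) x (K v) \<subseteq> hsupp v"
proof -
  assume "x \<in> hsupp v"
  then have "dcoset (G v) (K v) x (K v) \<subseteq> hsupp v" by (rule supp_stable[OF v])
  moreover have "dcoset (G v) (U v) x (K v) \<subseteq> dcoset (G v) (K v) x (K v)"
    using U_subgroup_G(3) unfolding subset_iff mem_dcoset by blast
  ultimately show ?thesis by blast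
qed

text \<open>Double cosets in \<open>Hl v\<close> and in \<open>G v\<close> are formed with the same
  multiplication, so the existence needed for the choice can be shown in \<open>G v\<close>, where
  stability of the fibre is known.\<close>

lemma fibre_reps_correct:
  assumes c: "c \<in> carrier (G v)"
  shows "dcoset_reps (G v) (U v) {h \<in> H v. h \<otimes>\<^bsub>G v\<^esub> c \<in> hsupp v}
    (H v \<inter> conj_by (G v) c (K v)) (fibre_reps v c)"
proof -
  have hc: "h \<otimes>\<^bsub>G v\<^esub> c \<in> carrier (G v)" if "h \<in> H v" for h
    using c that subgroup.mem_carrier[OF H[OF v]] by simp
  have "supp (Hl v) R (\<lambda>h. \<HH> v (h \<otimes>\<^bsub>G v\<^esub> c)) = {h \<in> H v. h \<otimes>\<^bsub>G v\<^esub> c \<in> hsupp v}"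
    using hc by (auto simp: supp_def Hl_carrier)
  moreover have "dcoset_reps (Hl v) A X B = dcoset_reps (G v) A X B" for A X B
    by (intro ext) (simp add: dcoset_reps_def Hl_def dcoset_carrier_update)
  moreover have "\<exists>S. dcoset_reps (G v) (U v) {h \<in> H v. h \<otimes>\<^bsub>G v\<^esub> c \<in> hsupp v}
    (H v \<inter> conj_by (G v) c (K v)) S"
  proof (rule Gv.dcoset_reps_ex)
    show "subgroup (H v \<inter> conj_by (G v) c (K v)) (G v)"
      using Gv.subgroups_Inter_pair H[OF v] Gv.subgroup_conj_by[OF K_subgroup[OF v] c] by blast
    show "{h \<in> H v. h \<otimes>\<^bsub>G v\<^esub> c \<in> hsupp v} \<subseteq> carrier (G v)"
      using subgroup.subset[OF H[OF v]] by blast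
    show "dcoset (G v) (U v) h (H v \<inter> conj_by (G v) c (K v)) \<subseteq> {h \<in> H v. h \<otimes>\<^bsub>G v\<^esub> c \<in> hsupp v}"
      if "h \<in> {h \<in> H v. h \<otimes>\<^bsub>G v\<^esub> c \<in> hsupp v}" for h
      by (rule Gv.dcoset_fibre_stable[OF H[OF v] U_subgroup_G(1) K_subgroup[OF v] U_subgroup_G(2) supp_carrier
            supp_stable_U c that])
  qed (rule U_subgroup_G)
  ultimately show ?thesis
    unfolding hecke_reps_def by (simp add: someI_ex)
qed

text \<open>The operator \<open>\<hh>\<^sub>*\<close> attached to the function \<open>h \<mapsto> \<HH> v (h c)\<close> on \<open>H v\<close>, acting on \<open>N\<close> at the place \<open>v\<close>.\<close>

definition fibre_sum :: "'g \<Rightarrow> ('v \<Rightarrow> 'g) set \<Rightarrow> ('v \<Rightarrow> 'g) set \<Rightarrow> 'n \<Rightarrow> 'n" where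
  "fibre_sum c V W y = (\<Oplus>\<^bsub>obj N W\<^esub>h\<in>fibre_reps v c.
     \<HH> v (h \<otimes>\<^bsub>G v\<^esub> c) \<odot>\<^bsub>obj N W\<^esub> hecke_push HH N V (place v h) W y)"

abbreviation all_reps :: "'g set" where
  "all_reps \<equiv> (\<Union>j\<in>J. (\<lambda>h. h \<otimes>\<^bsub>G v\<^esub> \<gamma> j) ` fibre_reps v (\<gamma> j))"

lemma all_reps_correct:
  "dcoset_reps (G v) (U v) (hsupp v) (K v) all_reps"
  "\<And>j h j' h'. j \<in> J \<Longrightarrow> h \<in> fibre_reps v (\<gamma> j) \<Longrightarrow> j' \<in> J \<Longrightarrow> h' \<in> fibre_reps v (\<gamma> j') \<Longrightarrow>
    h \<otimes>\<^bsub>G v\<^esub> \<gamma> j = h' \<otimes>\<^bsub>G v\<^esub> \<gamma> j' \<Longrightarrow> j = j' \<and> h = h'"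
proof -
  have c: "c \<in> carrier (G v)" if "c \<in> \<gamma> ` J" for c using \<gamma>_closed that by blast
  note fib = Gv.dcoset_reps_fibre[OF H[OF v] U_subgroup_G(1) K_subgroup[OF v] U_subgroup_G(2) supp_carrier
      supp_stable_U \<gamma> fibre_reps_correct[OF c]]
  show "dcoset_reps (G v) (U v) (hsupp v) (K v) all_reps"
    using fib(1) by simp
  show "j = j' \<and> h = h'" if "j \<in> J" "h \<in> fibre_reps v (\<gamma> j)" "j' \<in> J" "h' \<in> fibre_reps v (\<gamma> j')"
    "h \<otimes>\<^bsub>G v\<^esub> \<gamma> j = h' \<otimes>\<^bsub>G v\<^esub> \<gamma> j'" for j h j' h'
    using fib(2)[of "\<gamma> j" h "\<gamma> j'" h'] that J(2) by (auto simp: inj_on_def)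
qed

text \<open>Each double coset of \<open>K v\<close> is a union of double cosets of
  \<open>U v\<close> and \<open>K v\<close>. Transferring its representatives into
  \<open>K v\<close> itself makes the right group open in \<open>G v\<close>, and compactness of
  \<open>K v\<close> gives finiteness.\<close>

lemma all_reps_part:
  assumes \<sigma>: "\<sigma> \<in> hreps v"
  defines "D \<equiv> all_reps \<inter> dcoset (G v) (K v) \<sigma> (K v)"
  shows "dcoset_reps (G v) (U v) (dcoset (G v) (K v) \<sigma> (K v)) (K v) D" "finite D"
proof -
  note Ks = K_subgroup[OF v]
  have \<sigma>c: "\<sigma> \<in> carrier (G v)" using \<sigma> hreps_correct(3)[OF v] by blast
  have \<sigma>s: "\<sigma> \<in> hsupp v" using \<sigma> hreps_correct(1)[OF v] by (auto simp: dcoset_reps_def)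
  have st: "dcoset (G v) (U v) y (K v) \<subseteq> dcoset (G v) (K v) \<sigma> (K v)" if "y \<in> dcoset (G v) (K v) \<sigma> (K v)" for y
  proof
    fix z assume "z \<in> dcoset (G v) (U v) y (K v)"
    then have "z \<in> dcoset (G v) (K v) y (K v)"
      using U_subgroup_G(3) unfolding mem_dcoset by blast
    then show "z \<in> dcoset (G v) (K v) \<sigma> (K v)"
      using Gv.dcoset_trans[OF Ks Ks \<sigma>c that] by blast
  qed
  show D: "dcoset_reps (G v) (U v) (dcoset (G v) (K v) \<sigma> (K v)) (K v) D"
    unfolding D_def
    by (rule Gv.dcoset_reps_restrict[OF all_reps_correct(1) supp_stable[OF v \<sigma>s] st U_subgroup_G(1) Ks supp_carrier])
  obtain \<phi> where \<phi>: "inj_on \<phi> D" "dcoset_reps (G v) (U v) (K v) (K v \<inter> conj_by (G v) \<sigma> (K v)) (\<phi> ` D)"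
    by (rule Gv.dcoset_reps_transfer[OF U_subgroup_G(1) Ks U_subgroup_G(3) \<sigma>c D]) (rule that)
  have Kco: "openin (T v) (K v)" "compactin (T v) (K v)"
    using K[OF v] by (simp_all add: compact_open_subgroup_def)
  have "finite (\<phi> ` D)"
    by (rule Gv.finite_dcoset_reps[OF Kco(2) U_subgroup_G(1) _ _ \<phi>(2)])
      (use Gv.subgroups_Inter_pair[OF Ks Gv.subgroup_conj_by[OF Ks \<sigma>c]]
        openin_Int[OF Kco(1) Gv.openin_conj_by[OF Kco(1) \<sigma>c]] in auto)
  then show "finite D" using \<phi>(1) by (rule finite_imageD)
qed

lemma finite_all_reps: "finite all_reps"
proof -
  have "all_reps \<subseteq> hsupp v" using all_reps_correct(1) by (simp add: dcoset_reps_def)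
  then have "all_reps = (\<Union>\<sigma>\<in>hreps v. all_reps \<inter> dcoset (G v) (K v) \<sigma> (K v))"
    by (rule Gv.dcoset_reps_disjoint_union(1)[OF hreps_correct(1)[OF v]])
  then show ?thesis using all_reps_part(2) hreps_correct(2)[OF v] by (metis (no_types, lifting) finite_UN_I)
qed

text \<open>Right multiplication by \<gamma>(j) embeds the representatives of the fibre into the
  finite set \<open>all_reps\<close>.\<close>

lemma finite_fibre_reps: "j \<in> J \<Longrightarrow> finite (fibre_reps v (\<gamma> j))"
proof -
  assume j: "j \<in> J"
  have "(\<lambda>h. h \<otimes>\<^bsub>G v\<^esub> \<gamma> j) ` fibre_reps v (\<gamma> j) \<subseteq> all_reps" using j by blast
  then have "finite ((\<lambda>h. h \<otimes>\<^bsub>G v\<^esub> \<gamma> j) ` fibre_reps v (\<gamma> j))" using finite_all_reps by (rule finite_subset)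
  moreover have "inj_on (\<lambda>h. h \<otimes>\<^bsub>G v\<^esub> \<gamma> j) (fibre_reps v (\<gamma> j))"
    using all_reps_correct(2)[OF j _ j] by (intro inj_onI) blast
  ultimately show ?thesis by (rule finite_imageD)
qed

lemma fibre_reps_subset: "j \<in> J \<Longrightarrow> fibre_reps v (\<gamma> j) \<subseteq> H v"
  using conjunct1[OF fibre_reps_correct[OF \<gamma>_closed, unfolded dcoset_reps_def]] by blast

section \<open>The operator at v on a twisted pure tensor\<close>

context
  fixes t \<nu>
  assumes t: "t \<in> carrier GG" "t v = \<one>\<^bsub>G v\<^esub>" and \<nu>: "finite \<nu>" "\<nu> \<subseteq> I" "v \<notin> \<nu>"
begin

lemma gcomp_v: "gcomp t \<nu> v = K v"
  using Gv.conj_by_one[OF subgroup.subset[OF K_subgroup[OF v]]] by (simp add: gcomp_def t \<nu>)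

lemma hcomp_v: "hcomp t \<nu> v = U v"
  using v by (simp add: hcomp_def gcomp_v U_def)

text \<open>One finite set \<open>D\<close> is sorted twice: by double cosets of \<open>K v\<close>,
  which matches the definition of the operator, and by left classes modulo \<open>H v\<close>, which
  matches the claim. The passage is possible because \<open>\<HH>\<close> is constant on double
  cosets of \<open>K v\<close>: replacing its value at \<sigma> by its value at d removes the
  reference to \<sigma>.\<close>

lemma hecke_sum_\<iota>:
  assumes y: "y \<in> carrier (obj N (Pi\<^sub>E I (hcomp t \<nu>)))"
  defines "K' \<equiv> conj_by GG t (lvl \<nu>)" and "V \<equiv> Pi\<^sub>E I (hcomp t \<nu>)"
  defines "K1 \<equiv> \<lambda>j. conj_by GG (place v (\<gamma> j)) K'"
  shows "hecke_at K' v (\<iota> V K' y) = (\<Oplus>\<^bsub>obj M K'\<^esub>j\<in>J. push M (K1 j) K' (place v (\<gamma> j))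
      (\<iota> (carrier HH \<inter> K1 j) (K1 j) (fibre_sum (\<gamma> j) V (carrier HH \<inter> K1 j) y)))"
proof -
  let ?S = "hreps v"
  define p where "p = place v"
  define D where "D = (\<Union>j\<in>J. (\<lambda>h. h \<otimes>\<^bsub>G v\<^esub> \<gamma> j) ` fibre_reps v (\<gamma> j))"
  define DK where "DK \<sigma> = D \<inter> dcoset (G v) (K v) \<sigma> (K v)" for \<sigma>
  note all = all_reps_correct[folded D_def]
  note S = hreps_correct[OF v] and Ks = K_subgroup[OF v]
  note part = all_reps_part[folded D_def DK_def]
  have K': "K' \<in> \<Upsilon>\<^sub>G" unfolding K'_def by (rule conj_level_mem[OF t(1) \<nu>(1,2)])
  have V: "V \<in> \<Upsilon>\<^sub>H" unfolding V_def by (rule PiE_hcomp_mem[OF t(1) \<nu>(1,2)])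
  have VK: "V = carrier HH \<inter> K'" unfolding V_def K'_def by (rule PiE_hcomp[OF t(1) \<nu>(1,2)])
  have VsK: "V \<subseteq> K'" using VK by blast
  have y': "y \<in> carrier (obj N V)" using y by (simp add: V_def)
  interpret MK: Module.module R "obj M K'" by (rule F.M.module_obj[OF K'])
  have Ds: "D \<subseteq> hsupp v" using all(1) by (simp add: dcoset_reps_def)
  have Dc: "d \<in> carrier (G v)" if "d \<in> D" for d using that Ds supp_carrier by blast
  have pc: "p c \<in> carrier GG" if "c \<in> carrier (G v)" for c
    unfolding p_def by (rule GG.place_closed[OF v that])
  have pinj: "inj_on p X" for X
    by (rule inj_onI) (metis p_def GG.place_apply(1) v)
  define f where "f d = F.dcoset_term V K' y (p d)" for d
  have fc: "f d \<in> carrier (obj M K')" if "d \<in> carrier (G v)" for d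
    unfolding f_def by (rule F.dcoset_term_closed[OF V K' VsK y' pc[OF that]])
  have \<HH>c: "\<HH> v d \<in> carrier R" if "d \<in> carrier (G v)" for d using \<HH>_closed[OF v that] .
  have KE: "K' = (Pi\<^sub>E I (gcomp t \<nu>))" unfolding K'_def by (rule conj_level[OF t(1)])
  have step: "\<HH> v \<sigma> \<odot>\<^bsub>obj M K'\<^esub> hecke_push GG M K' (p \<sigma>) K' (\<iota> V K' y) =
      (\<Oplus>\<^bsub>obj M K'\<^esub>d\<in>DK \<sigma>. \<HH> v d \<odot>\<^bsub>obj M K'\<^esub> f d)" if \<sigma>: "\<sigma> \<in> ?S" for \<sigma>
  proof -
    have \<sigma>c: "\<sigma> \<in> carrier (G v)" using S(3) \<sigma> by blast
    have "dcoset_reps GG (Pi\<^sub>E I (hcomp t \<nu>)) (dcoset GG (Pi\<^sub>E I (gcomp t \<nu>)) (p \<sigma>) (Pi\<^sub>E I (gcomp t \<nu>)))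
      (Pi\<^sub>E I (gcomp t \<nu>)) (p ` DK \<sigma>)"
      unfolding p_def
    proof (rule GG.dcoset_reps_place[OF v \<sigma>c])
      fix w assume w: "w \<in> I"
      show C: "subgroup (gcomp t \<nu> w) (G w)" by (rule gcomp_subgroup[OF t(1) w])
      show "subgroup (hcomp t \<nu> w) (G w)"
        using group.subgroups_Inter_pair[OF group_G[OF w] H[OF w] C] w by (simp add: hcomp_def)
      show "hcomp t \<nu> w \<subseteq> gcomp t \<nu> w" using w by (simp add: hcomp_def)
    next
      show "(Pi\<^sub>E I (gcomp t \<nu>)) \<subseteq> carrier GG" using F.M.level_subset[OF K'] by (simp add: KE)
      show "dcoset_reps (G v) (hcomp t \<nu> v) (dcoset (G v) (gcomp t \<nu> v) \<sigma> (gcomp t \<nu> v)) (gcomp t \<nu> v) (DK \<sigma>)"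
        unfolding gcomp_v hcomp_v by (rule part(1)[OF \<sigma>])
    qed
    then have "dcoset_reps GG V (dcoset GG K' (p \<sigma>) K') K' (p ` DK \<sigma>)"
      by (simp add: V_def KE)
    then have "hecke_push GG M K' (p \<sigma>) K' (\<iota> V K' y) = (\<Oplus>\<^bsub>obj M K'\<^esub>d\<in>p ` DK \<sigma>. F.dcoset_term V K' y d)"
      by (rule F.hecke_push_\<iota>[OF V K' VsK y' pc[OF \<sigma>c]])
    also have "\<dots> = (\<Oplus>\<^bsub>obj M K'\<^esub>d\<in>DK \<sigma>. f d)"
      unfolding f_def using fc Dc by (intro MK.M.finsum_reindex[OF _ pinj]) (auto simp: f_def DK_def)
    finally have "\<HH> v \<sigma> \<odot>\<^bsub>obj M K'\<^esub> hecke_push GG M K' (p \<sigma>) K' (\<iota> V K' y) =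
        (\<Oplus>\<^bsub>obj M K'\<^esub>d\<in>DK \<sigma>. \<HH> v \<sigma> \<odot>\<^bsub>obj M K'\<^esub> f d)"
      using MK.finsum_smult_ldistr[OF part(2)[OF \<sigma>] \<HH>c[OF \<sigma>c], of f] fc Dc by (auto simp: DK_def)
    also have "\<dots> = (\<Oplus>\<^bsub>obj M K'\<^esub>d\<in>DK \<sigma>. \<HH> v d \<odot>\<^bsub>obj M K'\<^esub> f d)"
    proof (rule MK.M.finsum_cong')
      fix d assume d: "d \<in> DK \<sigma>"
      have "\<HH> v d = \<HH> v \<sigma>"
        by (rule Gv.hecke_fun_invariant[OF ring \<HH>[OF v] Ks Ks \<sigma>c]) (use d in \<open>simp add: DK_def\<close>)
      then show "\<HH> v \<sigma> \<odot>\<^bsub>obj M K'\<^esub> f d = \<HH> v d \<odot>\<^bsub>obj M K'\<^esub> f d" by simp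
    qed (use fc \<HH>c Dc in \<open>auto simp: DK_def\<close>)
    finally show ?thesis .
  qed
  note split = Gv.dcoset_reps_disjoint_union[OF S(1) Ds]
  have "hecke_at K' v (\<iota> V K' y) =
      (\<Oplus>\<^bsub>obj M K'\<^esub>\<sigma>\<in>?S. \<Oplus>\<^bsub>obj M K'\<^esub>d\<in>DK \<sigma>. \<HH> v d \<odot>\<^bsub>obj M K'\<^esub> f d)"
    unfolding hecke_place_def p_def[symmetric]
    using step fc \<HH>c Dc by (intro MK.M.finsum_cong') (auto simp: DK_def intro!: MK.M.finsum_closed)
  \<comment> \<open>The image under the identity gives the union the shape of
    \<open>finsum_image_disjoint\<close>.\<close>
  also have "\<dots> = (\<Oplus>\<^bsub>obj M K'\<^esub>d\<in>(\<Union>\<sigma>\<in>?S. (\<lambda>d. d) ` DK \<sigma>). \<HH> v d \<odot>\<^bsub>obj M K'\<^esub> f d)"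
  proof (rule MK.M.finsum_image_disjoint[symmetric, OF S(2) part(2)])
    show "\<sigma> = \<sigma>' \<and> d = d'" if "\<sigma> \<in> ?S" "d \<in> DK \<sigma>" "\<sigma>' \<in> ?S" "d' \<in> DK \<sigma>'" "d = d'" for \<sigma> d \<sigma>' d'
      using split(2)[OF that(1,3)] that unfolding DK_def by blast
    show "\<HH> v d \<odot>\<^bsub>obj M K'\<^esub> f d \<in> carrier (obj M K')" if "\<sigma> \<in> ?S" "d \<in> DK \<sigma>" for \<sigma> d
      using that fc \<HH>c Dc by (auto simp: DK_def)
  qed
  also have "(\<Union>\<sigma>\<in>?S. (\<lambda>d. d) ` DK \<sigma>) = D"
    using split(1) by (simp add: DK_def)
  also have "(\<Oplus>\<^bsub>obj M K'\<^esub>d\<in>D. \<HH> v d \<odot>\<^bsub>obj M K'\<^esub> f d) =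
      (\<Oplus>\<^bsub>obj M K'\<^esub>j\<in>J. \<Oplus>\<^bsub>obj M K'\<^esub>h\<in>fibre_reps v (\<gamma> j).
        \<HH> v (h \<otimes>\<^bsub>G v\<^esub> \<gamma> j) \<odot>\<^bsub>obj M K'\<^esub> f (h \<otimes>\<^bsub>G v\<^esub> \<gamma> j))"
    unfolding D_def
  proof (rule MK.M.finsum_image_disjoint[OF J(1) finite_fibre_reps])
    show "j = j' \<and> h = h'" if "j \<in> J" "h \<in> fibre_reps v (\<gamma> j)" "j' \<in> J" "h' \<in> fibre_reps v (\<gamma> j')"
      "h \<otimes>\<^bsub>G v\<^esub> \<gamma> j = h' \<otimes>\<^bsub>G v\<^esub> \<gamma> j'" for j h j' h'
      by (rule all(2)[OF that])
    show "\<HH> v (h \<otimes>\<^bsub>G v\<^esub> \<gamma> j) \<odot>\<^bsub>obj M K'\<^esub> f (h \<otimes>\<^bsub>G v\<^esub> \<gamma> j) \<in> carrier (obj M K')"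
      if "j \<in> J" "h \<in> fibre_reps v (\<gamma> j)" for j h
    proof -
      have "h \<otimes>\<^bsub>G v\<^esub> \<gamma> j \<in> carrier (G v)" using that Dc unfolding D_def by blast
      then show ?thesis using fc \<HH>c by simp
    qed
  qed
  also have "\<dots> = (\<Oplus>\<^bsub>obj M K'\<^esub>j\<in>J. push M (K1 j) K' (place v (\<gamma> j))
      (\<iota> (carrier HH \<inter> K1 j) (K1 j) (fibre_sum (\<gamma> j) V (carrier HH \<inter> K1 j) y)))"
  proof (rule MK.M.finsum_cong'[OF refl], rule Pi_I)
    fix j assume j: "j \<in> J"
    let ?K1 = "K1 j" and ?V = "carrier HH \<inter> K1 j"
    let ?F = "fibre_reps v (\<gamma> j)"
    have gc: "\<gamma> j \<in> carrier (G v)" by (rule \<gamma>_closed[OF j])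
    note g = pc[OF gc]
    have K1: "?K1 \<in> \<Upsilon>\<^sub>G" using F.M.T1 K' g by (simp add: K1_def p_def)
    have V'l: "?V \<in> \<Upsilon>\<^sub>H" using F.level_Int_H[OF K1] by (simp add: Int_commute)
    have V'K: "?V \<subseteq> ?K1" by simp
    have hom: "p (\<gamma> j) \<in> Hom_P GG ?K1 K'" using F.M.level_Hom_P_iff[OF K1 K'] g by (simp add: K1_def p_def)
    note \<iota>D = mod_homD[OF F.hom[OF V'l K1 V'K]] and pD = mod_homD[OF F.M.push_hom[OF K1 K' hom]]
    interpret NV: Module.module R "obj N ?V" by (rule NH.module_obj[OF V'l])
    interpret MK1: Module.module R "obj M ?K1" by (rule F.M.module_obj[OF K1])
    define z where "z h = hecke_push HH N V (p h) ?V y" for h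
    define c where "c h = \<HH> v (h \<otimes>\<^bsub>G v\<^esub> \<gamma> j)" for h
    have Fh: "h \<in> H v" if "h \<in> ?F" for h using fibre_reps_subset[OF j] that by blast
    have z: "z h \<in> carrier (obj N ?V)" if "h \<in> ?F" for h
      unfolding z_def using NH.hecke_push_closed[OF V V'l _ y'] place_HH[OF v Fh[OF that]] by (simp add: p_def)
    have c: "c h \<in> carrier R" if "h \<in> ?F" for h
      unfolding c_def using \<HH>c gc subgroup.mem_carrier[OF H[OF v] Fh[OF that]] by simp
    have fh: "f (h \<otimes>\<^bsub>G v\<^esub> \<gamma> j) = push M ?K1 K' (p (\<gamma> j)) (\<iota> ?V ?K1 (z h))" if "h \<in> ?F" for h
    proof -
      have "f (h \<otimes>\<^bsub>G v\<^esub> \<gamma> j) = F.dcoset_term V K' y (p h \<otimes>\<^bsub>GG\<^esub> p (\<gamma> j))"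
        by (simp add: f_def p_def GG.place_mult[OF v])
      also have "\<dots> = push M ?K1 K' (p (\<gamma> j)) (\<iota> ?V ?K1 (z h))"
        using F.dcoset_term_mult[OF V K' VsK y' _ g, of "p h"] place_HH[OF v Fh[OF that]]
        by (simp add: z_def K1_def HH_eq p_def)
      finally show ?thesis .
    qed
    \<comment> \<open>All terms with the same j share the maps [\<gamma>(j)]_* and \<iota>, so by
      linearity the sum over h can be moved inside both.\<close>
    have "push M ?K1 K' (p (\<gamma> j)) (\<iota> ?V ?K1 (\<Oplus>\<^bsub>obj N ?V\<^esub>h\<in>?F. c h \<odot>\<^bsub>obj N ?V\<^esub> z h)) =
        push M ?K1 K' (p (\<gamma> j)) (\<Oplus>\<^bsub>obj M ?K1\<^esub>h\<in>?F. \<iota> ?V ?K1 (c h \<odot>\<^bsub>obj N ?V\<^esub> z h))"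
      by (subst mod_hom_finsum[OF NH.module_obj[OF V'l] F.M.module_obj[OF K1] F.hom[OF V'l K1 V'K]])
        (use z c in auto)
    also have "\<dots> = (\<Oplus>\<^bsub>obj M K'\<^esub>h\<in>?F. push M ?K1 K' (p (\<gamma> j)) (\<iota> ?V ?K1 (c h \<odot>\<^bsub>obj N ?V\<^esub> z h)))"
      by (rule mod_hom_finsum[OF F.M.module_obj[OF K1] F.M.module_obj[OF K'] F.M.push_hom[OF K1 K' hom]])
        (use z c \<iota>D in auto)
    also have "\<dots> = (\<Oplus>\<^bsub>obj M K'\<^esub>h\<in>?F. c h \<odot>\<^bsub>obj M K'\<^esub> f (h \<otimes>\<^bsub>G v\<^esub> \<gamma> j))"
      using z c \<iota>D pD fh by (intro MK.M.finsum_cong') auto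
    finally show "(\<Oplus>\<^bsub>obj M K'\<^esub>h\<in>?F. \<HH> v (h \<otimes>\<^bsub>G v\<^esub> \<gamma> j) \<odot>\<^bsub>obj M K'\<^esub> f (h \<otimes>\<^bsub>G v\<^esub> \<gamma> j)) =
        push M ?K1 K' (place v (\<gamma> j)) (\<iota> ?V ?K1 (fibre_sum (\<gamma> j) V ?V y))"
      unfolding c_def z_def fibre_sum_def p_def by simp
    have "(\<Oplus>\<^bsub>obj N ?V\<^esub>h\<in>?F. c h \<odot>\<^bsub>obj N ?V\<^esub> z h) \<in> carrier (obj N ?V)"
      using z c by (intro NV.M.finsum_closed) auto
    then have "fibre_sum (\<gamma> j) V ?V y \<in> carrier (obj N ?V)"
      by (simp add: fibre_sum_def c_def z_def p_def)
    then show "push M ?K1 K' (place v (\<gamma> j)) (\<iota> ?V ?K1 (fibre_sum (\<gamma> j) V ?V y)) \<in> carrier (obj M K')"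
      unfolding p_def[symmetric] by (intro pD(1) \<iota>D(1))
  qed
  finally show ?thesis .
qed

text \<open>After passing through [t]_* the operator is expanded by \<open>hecke_sum_\<iota>\<close>
  at the conjugate level, and [\<gamma>(j)]_* followed by [t]_* is the push by the product of the
  two elements. The new translate agrees with t away from v, so only the factor at v
  changes.\<close>

lemma hecke_place_twisted:
  assumes x: "x \<in> rf (hcomp t \<nu>)"
  shows "hecke_at (lvl \<nu>) v (twisted t \<nu> x) = (\<Oplus>\<^bsub>obj M (lvl \<nu>)\<^esub>j\<in>J. twisted (place v (\<gamma> j) \<otimes>\<^bsub>GG\<^esub> t) \<nu>
      (x(v := hecke_fun_push (Hl v) R (Nl v) (U v) (H v \<inter> conj_by (G v) (\<gamma> j) (K v))
        (\<lambda>h. \<HH> v (h \<otimes>\<^bsub>G v\<^esub> \<gamma> j)) (x v))))"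
proof -
  interpret Nv: ric_functor "Hl v" "THl v" "\<Upsilon>l v" R "Nl v" by (rule Nl[OF v])
  note \<nu>' = \<nu>(1,2)
  define k where "k = lvl \<nu>"
  define K' where "K' = conj_by GG t k"
  define W where "W = hcomp t \<nu>"
  define V where "V = Pi\<^sub>E I W"
  define y where "y = ptensor W x"
  define K1 where "K1 j = conj_by GG (place v (\<gamma> j)) K'" for j
  define s where "s j = place v (\<gamma> j) \<otimes>\<^bsub>GG\<^esub> t" for j
  define x' where "x' j = x(v := hecke_fun_push (Hl v) R (Nl v) (U v) (H v \<inter> conj_by (G v) (\<gamma> j) (K v))
        (\<lambda>h. \<HH> v (h \<otimes>\<^bsub>G v\<^esub> \<gamma> j)) (x v))" for j
  have kl: "k \<in> \<Upsilon>\<^sub>G" unfolding k_def by (rule levels_G[OF \<nu>'])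
  have K'l: "K' \<in> \<Upsilon>\<^sub>G" unfolding K'_def k_def by (rule conj_level_mem[OF t(1) \<nu>'])
  have W: "W \<in> PL" unfolding W_def by (rule hcomp_PL[OF t(1) \<nu>'])
  have V: "V \<in> \<Upsilon>\<^sub>H" using PL_D(3)[OF W] by (simp add: V_def)
  have VK: "V = carrier HH \<inter> K'"
    unfolding V_def W_def K'_def k_def by (rule PiE_hcomp[OF t(1) \<nu>'])
  have xW: "x \<in> rf W" using x by (simp add: W_def)
  have y: "y \<in> carrier (obj N V)" unfolding y_def V_def by (rule ptensor_closed[OF W xW])
  have homt: "t \<in> Hom_P GG K' k" using F.M.level_Hom_P_iff[OF K'l kl] t by (simp add: K'_def)
  note pt = F.M.push_hom[OF K'l kl homt]
  interpret Mk: Module.module R "obj M k" by (rule F.M.module_obj[OF kl])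
  interpret MK': Module.module R "obj M K'" by (rule F.M.module_obj[OF K'l])
  note gc = \<gamma>_closed
  have sc: "s j \<in> carrier GG" if "j \<in> J" for j
    unfolding s_def by (rule place_mult_closed[OF v gc[OF that] t(1)])
  have main: "x' j \<in> rf (hcomp (s j) \<nu>)"
    "\<iota> (carrier HH \<inter> K1 j) (K1 j) (fibre_sum (\<gamma> j) V (carrier HH \<inter> K1 j) y) =
      \<iota> (Pi\<^sub>E I (hcomp (s j) \<nu>)) (K1 j) (ptensor (hcomp (s j) \<nu>) (x' j))"
    "place v (\<gamma> j) \<in> Hom_P GG (K1 j) K'" "K1 j \<in> \<Upsilon>\<^sub>G" "K1 j = conj_by GG (s j) k"
    "\<iota> (Pi\<^sub>E I (hcomp (s j) \<nu>)) (K1 j) (ptensor (hcomp (s j) \<nu>) (x' j)) \<in> carrier (obj M (K1 j))"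
    if j: "j \<in> J" for j
  proof -
    let ?F = "fibre_reps v (\<gamma> j)"
    note pg = GG.place_closed[OF v gc[OF j]]
    show K1: "K1 j \<in> \<Upsilon>\<^sub>G" unfolding K1_def by (rule F.M.T1[OF K'l pg])
    show hom: "place v (\<gamma> j) \<in> Hom_P GG (K1 j) K'"
      using F.M.level_Hom_P_iff[OF K1 K'l] pg by (simp add: K1_def)
    show K1s: "K1 j = conj_by GG (s j) k"
      unfolding K1_def K'_def s_def by (rule GG.P.conj_by_conj_by[OF pg t(1) F.M.level_subset[OF kl]])
    define W' where "W' = hcomp (s j) \<nu>"
    have W': "W' \<in> PL" unfolding W'_def by (rule hcomp_PL[OF sc[OF j] \<nu>'])
    have V': "carrier HH \<inter> K1 j = Pi\<^sub>E I (hcomp (s j) \<nu>)"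
      unfolding K1s k_def by (rule PiE_hcomp[OF sc[OF j] \<nu>', symmetric])
    have "s j v = \<gamma> j" using v gc[OF j] t(2) by (simp add: s_def GG.P_mult GG.place_apply)
    then have W'v: "W' v = H v \<inter> conj_by (G v) (\<gamma> j) (K v)"
      using v \<nu>(3) by (simp add: W'_def hcomp_def gcomp_def)
    have Wv: "W v = U v" unfolding W_def by (rule hcomp_v)
    have WW: "W w = W' w" if w: "w \<in> I" "w \<noteq> v" for w
    proof -
      interpret Gw: Group.group "G w" by (rule group_G[OF w(1)])
      have "s j w = t w" using w GG.P_closed[OF t(1) w(1)] by (simp add: s_def GG.P_mult GG.place_apply)
      then show ?thesis by (simp add: W_def W'_def hcomp_def gcomp_def)
    qed
    have lv: "W v \<in> \<Upsilon>l v" "W' v \<in> \<Upsilon>l v" using PL_D(1)[OF W v] PL_D(1)[OF W' v] by auto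
    interpret Av: Module.module R "obj (Nl v) (W' v)" by (rule Nv.module_obj[OF lv(2)])
    define b where "b h = hecke_push (Hl v) (Nl v) (W v) h (W' v) (x v)" for h
    define c where "c h = \<HH> v (h \<otimes>\<^bsub>G v\<^esub> \<gamma> j)" for h
    have Fh: "h \<in> H v" if "h \<in> ?F" for h using fibre_reps_subset[OF j] that by blast
    have b: "b h \<in> carrier (obj (Nl v) (W' v))" if "h \<in> ?F" for h
      unfolding b_def using Fh[OF that] by (intro Nv.hecke_push_closed lv rf_D(1)[OF xW v]) (simp add: Hl_carrier)
    have c: "c h \<in> carrier R" if "h \<in> ?F" for h
      unfolding c_def using \<HH>_closed[OF v] gc[OF j] subgroup.mem_carrier[OF H[OF v] Fh[OF that]] by simp
    have x'j: "x' j = x(v := \<Oplus>\<^bsub>obj (Nl v) (W' v)\<^esub>h\<in>?F. c h \<odot>\<^bsub>obj (Nl v) (W' v)\<^esub> b h)"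
      unfolding x'_def hecke_fun_push_def b_def c_def W'v Wv by simp
    have upd: "x(v := a) \<in> rf W'" if a: "a \<in> carrier (obj (Nl v) (W' v))" for a
    proof -
      have "{w\<in>I. (x(v := a)) w \<noteq> e w} \<subseteq> insert v {w\<in>I. x w \<noteq> e w}" by auto
      then have "finite {w\<in>I. (x(v := a)) w \<noteq> e w}" using rf_D(2)[OF xW] by (meson finite_insert finite_subset)
      moreover have "x w \<in> carrier (obj (Nl w) (W' w))" if "w \<in> I" "w \<noteq> v" for w
        using rf_D(1)[OF xW that(1)] WW[OF that] by simp
      ultimately show ?thesis using a rf_D(3)[OF xW] v by (auto simp: rfam_def PiE_iff extensional_def)
    qed
    have sumc: "(\<Oplus>\<^bsub>obj (Nl v) (W' v)\<^esub>h\<in>?F. c h \<odot>\<^bsub>obj (Nl v) (W' v)\<^esub> b h) \<in> carrier (obj (Nl v) (W' v))"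
      using b c by (intro Av.M.finsum_closed) auto
    show x'rf: "x' j \<in> rf (hcomp (s j) \<nu>)"
      using upd[OF sumc] unfolding x'j W'_def .
    \<comment> \<open>The factor of \<open>x\<close> at v belongs to the level \<open>W v\<close>,
      not \<open>W' v\<close>, so \<open>x\<close> itself is no family for \<open>W'\<close>.
      Overwriting that factor by zero gives one, and the value is overwritten again by a.\<close>
    have \<psi>: "(\<lambda>a. ptensor W' (x(v := a))) \<in> mod_hom R (obj (Nl v) (W' v)) (obj N (Pi\<^sub>E I W'))"
      using ptensor_mod_hom[OF W' upd[OF Av.M.zero_closed] v] by simp
    interpret NV: Module.module R "obj N (Pi\<^sub>E I W')" by (rule NH.module_obj[OF PL_D(3)[OF W']])
    have "ptensor W' (x' j) = (\<Oplus>\<^bsub>obj N (Pi\<^sub>E I W')\<^esub>h\<in>?F. ptensor W' (x(v := c h \<odot>\<^bsub>obj (Nl v) (W' v)\<^esub> b h)))"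
      unfolding x'j
      by (rule mod_hom_finsum[OF Nv.module_obj[OF lv(2)] NH.module_obj[OF PL_D(3)[OF W']] \<psi>]) (use b c in auto)
    also have "\<dots> = (\<Oplus>\<^bsub>obj N (Pi\<^sub>E I W')\<^esub>h\<in>?F. c h \<odot>\<^bsub>obj N (Pi\<^sub>E I W')\<^esub> hecke_push HH N V (place v h) (Pi\<^sub>E I W') y)"
    proof (rule NV.M.finsum_cong'[OF refl])
      fix h assume h: "h \<in> ?F"
      have "hecke_push HH N V (place v h) (Pi\<^sub>E I W') y = ptensor W' (x(v := b h))"
        unfolding V_def y_def b_def by (rule hecke_push_ptensor[OF v Fh[OF h] W W' WW xW])
      then show "ptensor W' (x(v := c h \<odot>\<^bsub>obj (Nl v) (W' v)\<^esub> b h)) =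
          c h \<odot>\<^bsub>obj N (Pi\<^sub>E I W')\<^esub> hecke_push HH N V (place v h) (Pi\<^sub>E I W') y"
        using mod_homD(3)[OF \<psi> c[OF h] b[OF h]] by simp
    next
      show "(\<lambda>h. c h \<odot>\<^bsub>obj N (Pi\<^sub>E I W')\<^esub> hecke_push HH N V (place v h) (Pi\<^sub>E I W') y)
          \<in> ?F \<rightarrow> carrier (obj N (Pi\<^sub>E I W'))"
        using c NH.hecke_push_closed[OF V PL_D(3)[OF W'] place_HH[OF v Fh] y] by auto
    qed
    finally have "fibre_sum (\<gamma> j) V (Pi\<^sub>E I (hcomp (s j) \<nu>)) y = ptensor (hcomp (s j) \<nu>) (x' j)"
      unfolding fibre_sum_def c_def by (simp add: W'_def)
    then show "\<iota> (carrier HH \<inter> K1 j) (K1 j) (fibre_sum (\<gamma> j) V (carrier HH \<inter> K1 j) y) =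
        \<iota> (Pi\<^sub>E I (hcomp (s j) \<nu>)) (K1 j) (ptensor (hcomp (s j) \<nu>) (x' j))"
      by (simp only: V')
    show "\<iota> (Pi\<^sub>E I (hcomp (s j) \<nu>)) (K1 j) (ptensor (hcomp (s j) \<nu>) (x' j)) \<in> carrier (obj M (K1 j))"
      unfolding K1s k_def by (rule twisted_closed(1)[OF sc[OF j] \<nu>' x'rf])
  qed
  have "hecke_at k v (twisted t \<nu> x) = hecke_at k v (push M K' k t (\<iota> V K' y))"
    by (simp add: twisted_def k_def K'_def V_def W_def y_def)
  also have "\<dots> = push M K' k t (hecke_at K' v (\<iota> V K' y))"
    using hecke_at_push_commute[OF v kl t, folded K'_def, of "\<iota> V K' y"] F.\<iota>_closed[OF V K'l _ y] VK by simp
  also have "hecke_at K' v (\<iota> V K' y) = (\<Oplus>\<^bsub>obj M K'\<^esub>j\<in>J. push M (K1 j) K' (place v (\<gamma> j))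
      (\<iota> (Pi\<^sub>E I (hcomp (s j) \<nu>)) (K1 j) (ptensor (hcomp (s j) \<nu>) (x' j))))"
    using hecke_sum_\<iota>[OF y[unfolded V_def W_def], folded k_def, folded K'_def, folded K1_def W_def, folded V_def]
      main(2) F.M.push_closed[OF main(4) K'l main(3,6)]
    by (auto simp: K1_def[symmetric] intro!: MK'.M.finsum_cong')
  also have "push M K' k t \<dots> = (\<Oplus>\<^bsub>obj M k\<^esub>j\<in>J. twisted (s j) \<nu> (x' j))"
  proof (subst mod_hom_finsum[OF F.M.module_obj[OF K'l] F.M.module_obj[OF kl] pt])
    show "push M (K1 j) K' (place v (\<gamma> j)) (\<iota> (Pi\<^sub>E I (hcomp (s j) \<nu>)) (K1 j) (ptensor (hcomp (s j) \<nu>) (x' j)))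
        \<in> carrier (obj M K')" if "j \<in> J" for j
      by (rule F.M.push_closed[OF main(4)[OF that] K'l main(3,6)[OF that]])
    have "push M K' k t (push M (K1 j) K' (place v (\<gamma> j))
        (\<iota> (Pi\<^sub>E I (hcomp (s j) \<nu>)) (K1 j) (ptensor (hcomp (s j) \<nu>) (x' j)))) = twisted (s j) \<nu> (x' j)" if j: "j \<in> J" for j
      using F.M.push_comp[OF main(4)[OF j] K'l kl main(3)[OF j] homt main(6)[OF j]] main(5)[OF j]
      by (simp add: twisted_def k_def s_def)
    then show "(\<Oplus>\<^bsub>obj M k\<^esub>j\<in>J. push M K' k t (push M (K1 j) K' (place v (\<gamma> j))
        (\<iota> (Pi\<^sub>E I (hcomp (s j) \<nu>)) (K1 j) (ptensor (hcomp (s j) \<nu>) (x' j))))) =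
        (\<Oplus>\<^bsub>obj M k\<^esub>j\<in>J. twisted (s j) \<nu> (x' j))"
      using twisted_closed(2)[OF sc \<nu>' main(1)] by (intro Mk.M.finsum_cong') (auto simp: k_def)
  qed
  finally show ?thesis
    by (simp add: k_def s_def x'_def)
qed

end

end

section \<open>Sums over families of indices and the final classes\<close>

context
  fixes r :: "'v \<Rightarrow> nat" and g :: "'v \<Rightarrow> nat \<Rightarrow> 'g" and Hr Vr :: "'v \<Rightarrow> nat \<Rightarrow> 'g set" and x :: "'v \<Rightarrow> nat \<Rightarrow> 'a"
  assumes reps: "\<And>v. v \<in> I \<Longrightarrow> inj_on (g v) {1..r v}"
      "\<And>v. v \<in> I \<Longrightarrow> dcoset_reps (G v) (H v) (H v <#>\<^bsub>G v\<^esub> hsupp v) (K v) (g v ` {1..r v})"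
    and Hr: "Hr = (\<lambda>v i. H v \<inter> conj_by (G v) (g v i) (K v))"
    and Vr: "Vr = (\<lambda>v i. H v \<inter> conj_by (G v) (g v i) (L v))"
    and x: "\<And>v i. v \<in> I \<Longrightarrow> i \<in> {1..r v} \<Longrightarrow> x v i \<in> carrier (obj (Nl v) (Vr v i))"
      "\<And>v i. v \<in> I \<Longrightarrow> i \<in> {1..r v} \<Longrightarrow>
        hecke_fun_push (Hl v) R (Nl v) (U v) (Hr v i) (\<lambda>h. \<HH> v (h \<otimes>\<^bsub>G v\<^esub> g v i)) (e v) =
        push (Nl v) (Vr v i) (Hr v i) \<one>\<^bsub>Hl v\<^esub> (x v i)"
begin

abbreviation indices :: "'v set \<Rightarrow> ('v \<Rightarrow> nat) set" where
  "indices \<kappa> \<equiv> \<Pi>\<^sub>E v\<in>\<kappa>. {1..r v}"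

definition trans_el :: "'v set \<Rightarrow> ('v \<Rightarrow> nat) \<Rightarrow> 'v \<Rightarrow> 'g" where
  "trans_el \<kappa> i = (\<lambda>v\<in>I. if v \<in> \<kappa> then g v (i v) else \<one>\<^bsub>G v\<^esub>)"

text \<open>The factor at v has to live on the component at v of the twisted level, which is
  \<open>Vr\<close> on \<nu>, \<open>Hr\<close> on \<kappa> - \<nu> and \<open>U v\<close>
  elsewhere; see \<open>hcomp_trans_el\<close>.\<close>

definition xfam :: "'v set \<Rightarrow> 'v set \<Rightarrow> ('v \<Rightarrow> nat) \<Rightarrow> 'v \<Rightarrow> 'a" where
  "xfam \<nu> \<kappa> i = (\<lambda>v\<in>I. if v \<in> \<nu> then x v (i v)
     else if v \<in> \<kappa> then push (Nl v) (Vr v (i v)) (Hr v (i v)) \<one>\<^bsub>Hl v\<^esub> (x v (i v)) else e v)"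

text \<open>The sums \<open>zsum \<nu> \<kappa>\<close>, \<open>\<nu> \<subseteq> \<kappa>\<close>, interpolate between the two sides of the norm relation: \<open>y \<nu>\<close> is
  \<open>zsum \<nu> \<nu>\<close>, the Hecke operator at \<open>v\<close> adds \<open>v\<close> to \<open>\<kappa>\<close>, and \<open>zsum \<nu> \<mu>\<close> is the image of \<open>y \<mu>\<close>.\<close>

definition zsum :: "'v set \<Rightarrow> 'v set \<Rightarrow> 'm" where
  "zsum \<nu> \<kappa> = (\<Oplus>\<^bsub>obj M (lvl \<nu>)\<^esub>i\<in>indices \<kappa>. twisted (trans_el \<kappa> i) \<nu> (xfam \<nu> \<kappa> i))"

lemma g_closed: "v \<in> I \<Longrightarrow> i \<in> {1..r v} \<Longrightarrow> g v i \<in> carrier (G v)"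
  using \<gamma>_closed[OF _ _ reps(1,2)] by simp

lemma trans_el_closed:
  assumes \<kappa>: "finite \<kappa>" "\<kappa> \<subseteq> I" and i: "i \<in> indices \<kappa>"
  shows "trans_el \<kappa> i \<in> carrier GG"
proof -
  have "{v\<in>I. trans_el \<kappa> i v \<notin> K v} \<subseteq> \<kappa>"
    using subgroup.one_closed[OF K_subgroup] by (auto simp: trans_el_def)
  then have "finite {v\<in>I. trans_el \<kappa> i v \<notin> K v}" using \<kappa>(1) by (rule finite_subset)
  moreover have "trans_el \<kappa> i v \<in> carrier (G v)" if "v \<in> I" for v
  proof (cases "v \<in> \<kappa>")
    case True
    then have "i v \<in> {1..r v}" using i by auto
    then show ?thesis using g_closed[OF that] that True by (simp add: trans_el_def)
  next
    case False
    then show ?thesis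
      using that monoid.one_closed[OF group.is_monoid[OF group_G[OF that]]] by (simp add: trans_el_def)
  qed
  ultimately show ?thesis by (auto simp: GG.P_carrier trans_el_def)
qed

lemma hcomp_trans_el:
  assumes "v \<in> I" "\<nu> \<subseteq> \<kappa>"
  shows "hcomp (trans_el \<kappa> i) \<nu> v = (if v \<in> \<nu> then Vr v (i v) else if v \<in> \<kappa> then Hr v (i v) else U v)"
  using assms group.conj_by_one[OF group_G subgroup.subset[OF K_subgroup]]
  by (auto simp: hcomp_def gcomp_def trans_el_def Hr Vr U_def)

lemma push_x:
  assumes v: "v \<in> I" and i: "i \<in> {1..r v}"
  shows "Vr v i \<in> \<Upsilon>l v" "Hr v i \<in> \<Upsilon>l v" "push (Nl v) (Vr v i) (Hr v i) \<one>\<^bsub>Hl v\<^esub> (x v i) \<in> carrier (obj (Nl v) (Hr v i))"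
proof -
  interpret Nv: ric_functor "Hl v" "THl v" "\<Upsilon>l v" R "Nl v" by (rule Nl[OF v])
  \<comment> \<open>A family on the single place v exhibits \<open>Vr v i\<close> and
    \<open>Hr v i\<close> as components at v of product levels, which puts them into
    \<open>\<Upsilon>l v\<close>.\<close>
  define i' where "i' = (\<lambda>w\<in>{v}. i)"
  have i': "i' \<in> indices {v}" "i' v = i" using i by (auto simp: i'_def)
  have t: "trans_el {v} i' \<in> carrier GG" using v i' by (intro trans_el_closed) auto
  show V: "Vr v i \<in> \<Upsilon>l v"
    using PL_D(1)[OF hcomp_PL[OF t, of "{v}"] v] hcomp_trans_el[OF v, of "{v}" "{v}" i'] v i' by simp
  show H: "Hr v i \<in> \<Upsilon>l v"
    using PL_D(1)[OF hcomp_PL[OF t, of "{}"] v] hcomp_trans_el[OF v, of "{}" "{v}" i'] v i' by simp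
  have "Vr v i \<subseteq> Hr v i"
    unfolding Vr Hr using conj_by_mono[OF LK[OF v]] by blast
  then show "push (Nl v) (Vr v i) (Hr v i) \<one>\<^bsub>Hl v\<^esub> (x v i) \<in> carrier (obj (Nl v) (Hr v i))"
    using Nv.push_closed[OF V H Nv.level_Hom_P_one[OF V H]] x(1)[OF v i] by blast
qed

lemma xfam_rf:
  assumes \<kappa>: "finite \<kappa>" "\<kappa> \<subseteq> I" and i: "i \<in> indices \<kappa>" and \<nu>: "\<nu> \<subseteq> \<kappa>"
  shows "xfam \<nu> \<kappa> i \<in> rf (hcomp (trans_el \<kappa> i) \<nu>)"
proof -
  have "xfam \<nu> \<kappa> i v \<in> carrier (obj (Nl v) (hcomp (trans_el \<kappa> i) \<nu> v))" if v: "v \<in> I" for v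
  proof (cases "v \<in> \<kappa>")
    case True
    then have "i v \<in> {1..r v}" using i by auto
    then show ?thesis using x(1)[OF v] push_x(3)[OF v] v True by (simp add: xfam_def hcomp_trans_el \<nu>)
  next
    case False
    then have "v \<notin> \<nu>" using \<nu> by blast
    then show ?thesis using False v tensor.vectors[OF v] by (simp add: xfam_def hcomp_trans_el \<nu>)
  qed
  moreover have "{v\<in>I. xfam \<nu> \<kappa> i v \<noteq> e v} \<subseteq> \<kappa>" using \<nu> by (auto simp: xfam_def)
  then have "finite {v\<in>I. xfam \<nu> \<kappa> i v \<noteq> e v}" using \<kappa>(1) by (rule finite_subset)
  ultimately show ?thesis by (auto simp: rfam_def xfam_def)
qed

lemma twisted_xfam_closed:
  assumes "finite \<kappa>" "\<kappa> \<subseteq> I" "i \<in> indices \<kappa>" "\<nu> \<subseteq> \<kappa>"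
  shows "twisted (trans_el \<kappa> i) \<nu> (xfam \<nu> \<kappa> i) \<in> carrier (obj M (lvl \<nu>))"
  using assms finite_subset by (intro twisted_closed(2) trans_el_closed xfam_rf) auto

lemma zsum_closed:
  assumes \<kappa>: "finite \<kappa>" "\<kappa> \<subseteq> I" "\<nu> \<subseteq> \<kappa>"
  shows "zsum \<nu> \<kappa> \<in> carrier (obj M (lvl \<nu>))"
proof -
  have \<nu>: "finite \<nu>" "\<nu> \<subseteq> I" using \<kappa> finite_subset by auto
  interpret Mk: Module.module R "obj M (lvl \<nu>)" by (rule F.M.module_obj[OF levels_G[OF \<nu>]])
  show ?thesis
    unfolding zsum_def using twisted_xfam_closed[OF \<kappa>(1,2) _ \<kappa>(3)] by (intro Mk.M.finsum_closed) auto
qed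

text \<open>The levels for \<mu> and \<nu> differ only at places of \<mu> - \<nu>, where the
  projection yields the second case of \<open>xfam\<close>. At all other places the push by 1 is the
  identity.\<close>

lemma push_zsum:
  assumes \<mu>: "finite \<mu>" "\<mu> \<subseteq> I" and \<nu>: "\<nu> \<subseteq> \<mu>"
  shows "push M (lvl \<mu>) (lvl \<nu>) \<one>\<^bsub>GG\<^esub> (zsum \<mu> \<mu>) = zsum \<nu> \<mu>"
proof -
  have \<nu>': "finite \<nu>" "\<nu> \<subseteq> I" using \<mu> \<nu> finite_subset by auto
  note l = levels_G[OF \<mu>] levels_G[OF \<nu>']
  interpret Mk: Module.module R "obj M (lvl \<nu>)" by (rule F.M.module_obj[OF l(2)])
  have "lvl \<mu> \<subseteq> lvl \<nu>"
    unfolding level_def by (rule PiE_mono) (use \<nu> LK in auto)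
  then have hom: "\<one>\<^bsub>GG\<^esub> \<in> Hom_P GG (lvl \<mu>) (lvl \<nu>)"
    by (rule F.M.level_Hom_P_one[OF l])
  have "push M (lvl \<mu>) (lvl \<nu>) \<one>\<^bsub>GG\<^esub> (zsum \<mu> \<mu>) =
      (\<Oplus>\<^bsub>obj M (lvl \<nu>)\<^esub>i\<in>indices \<mu>.
        push M (lvl \<mu>) (lvl \<nu>) \<one>\<^bsub>GG\<^esub> (twisted (trans_el \<mu> i) \<mu> (xfam \<mu> \<mu> i)))"
    unfolding zsum_def
    by (rule mod_hom_finsum[OF F.M.module_obj[OF l(1)] F.M.module_obj[OF l(2)] F.M.push_hom[OF l hom]])
      (use twisted_xfam_closed[OF \<mu>] in auto)
  also have "\<dots> = zsum \<nu> \<mu>"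
    unfolding zsum_def
  proof (rule Mk.M.finsum_cong'[OF refl])
    fix i assume i: "i \<in> indices \<mu>"
    have "(\<lambda>v\<in>I. push (Nl v) (hcomp (trans_el \<mu> i) \<mu> v) (hcomp (trans_el \<mu> i) \<nu> v) \<one>\<^bsub>Hl v\<^esub> (xfam \<mu> \<mu> i v)) = xfam \<nu> \<mu> i"
      unfolding xfam_def[of \<nu>]
    proof (rule restrict_ext)
      fix v assume v: "v \<in> I"
      interpret Nv: ric_functor "Hl v" "THl v" "\<Upsilon>l v" R "Nl v" by (rule Nl[OF v])
      have iv: "v \<in> \<mu> \<Longrightarrow> i v \<in> {1..r v}" using i by auto
      \<comment> \<open>Off \<mu> the component of the level is \<open>U v\<close> itself, so its
        membership comes from \<open>hcomp_PL\<close>.\<close>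
      have U: "U v \<in> \<Upsilon>l v" if "v \<notin> \<mu>"
      proof -
        have "v \<notin> \<nu>" using that \<nu> by blast
        then show ?thesis
          using PL_D(1)[OF hcomp_PL[OF trans_el_closed[OF \<mu> i] \<nu>'] v] hcomp_trans_el[OF v \<nu>, of i] that by simp
      qed
      show "push (Nl v) (hcomp (trans_el \<mu> i) \<mu> v) (hcomp (trans_el \<mu> i) \<nu> v) \<one>\<^bsub>Hl v\<^esub> (xfam \<mu> \<mu> i v) =
        (if v \<in> \<nu> then x v (i v) else if v \<in> \<mu>
          then push (Nl v) (Vr v (i v)) (Hr v (i v)) \<one>\<^bsub>Hl v\<^esub> (x v (i v)) else e v)"
        unfolding hcomp_trans_el[OF v \<nu>] hcomp_trans_el[OF v subset_refl]
        using v \<nu> Nv.push_one[OF push_x(1)[OF v iv] x(1)[OF v iv]] Nv.push_one[OF U tensor.vectors[OF v]]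
        by (auto simp: xfam_def)
    qed
    then show "push M (lvl \<mu>) (lvl \<nu>) \<one>\<^bsub>GG\<^esub> (twisted (trans_el \<mu> i) \<mu> (xfam \<mu> \<mu> i)) =
        twisted (trans_el \<mu> i) \<nu> (xfam \<nu> \<mu> i)"
      using push_twisted[OF trans_el_closed[OF \<mu> i] \<mu> \<nu> xfam_rf[OF \<mu> i subset_refl]] by simp
  qed (use twisted_xfam_closed[OF \<mu> _ \<nu>] in auto)
  finally show ?thesis .
qed

text \<open>As v is not in \<kappa>, every summand has translate 1 and vector \<open>e v\<close> at
  v. The operator therefore produces the local operators applied to \<open>e v\<close>, and the
  hypothesis turns these into projections of the \<open>x v j\<close>. A family on \<kappa> together
  with j is a family on the enlarged set.\<close>

lemma hecke_place_zsum:
  assumes \<kappa>: "finite \<kappa>" "\<kappa> \<subseteq> I" and \<nu>: "\<nu> \<subseteq> \<kappa>" and v: "v \<in> I" "v \<notin> \<kappa>"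
  shows "hecke_at (lvl \<nu>) v (zsum \<nu> \<kappa>) = zsum \<nu> (insert v \<kappa>)"
proof -
  have \<nu>': "finite \<nu>" "\<nu> \<subseteq> I" "v \<notin> \<nu>" using \<kappa> \<nu> v finite_subset by auto
  have \<kappa>v: "finite (insert v \<kappa>)" "insert v \<kappa> \<subseteq> I" "\<nu> \<subseteq> insert v \<kappa>" using \<kappa> v \<nu> by auto
  define k where "k = lvl \<nu>"
  define f where "f i = twisted (trans_el (insert v \<kappa>) i) \<nu> (xfam \<nu> (insert v \<kappa>) i)" for i
  have l: "k \<in> \<Upsilon>\<^sub>G" unfolding k_def by (rule levels_G[OF \<nu>'(1,2)])
  interpret Mk: Module.module R "obj M k" by (rule F.M.module_obj[OF l])
  have cl: "f (i(v := j)) \<in> carrier (obj M k)" if "i \<in> indices \<kappa>" "j \<in> {1..r v}" for i j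
    unfolding f_def k_def
    by (rule twisted_xfam_closed[OF \<kappa>v(1,2) _ \<kappa>v(3)]) (use that in \<open>auto simp: PiE_iff extensional_def\<close>)
  have main: "hecke_at k v (twisted (trans_el \<kappa> i) \<nu> (xfam \<nu> \<kappa> i)) = (\<Oplus>\<^bsub>obj M k\<^esub>j\<in>{1..r v}. f (i(v := j)))"
    if i: "i \<in> indices \<kappa>" for i
  proof -
    have tv: "trans_el \<kappa> i v = \<one>\<^bsub>G v\<^esub>" using v by (simp add: trans_el_def)
    have fv: "xfam \<nu> \<kappa> i v = e v" using v \<nu>'(3) by (simp add: xfam_def)
    have "hecke_at k v (twisted (trans_el \<kappa> i) \<nu> (xfam \<nu> \<kappa> i)) =
      (\<Oplus>\<^bsub>obj M k\<^esub>j\<in>{1..r v}. twisted (place v (g v j) \<otimes>\<^bsub>GG\<^esub> trans_el \<kappa> i) \<nu>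
        ((xfam \<nu> \<kappa> i)(v := hecke_fun_push (Hl v) R (Nl v) (U v) (Hr v j)
          (\<lambda>h. \<HH> v (h \<otimes>\<^bsub>G v\<^esub> g v j)) (xfam \<nu> \<kappa> i v))))"
      unfolding k_def Hr
      by (rule hecke_place_twisted[OF v(1) _ reps(1,2) trans_el_closed[OF \<kappa> i] tv \<nu>' xfam_rf[OF \<kappa> i \<nu>, unfolded Hr]]) (simp_all add: v)
    also have "\<dots> = (\<Oplus>\<^bsub>obj M k\<^esub>j\<in>{1..r v}. f (i(v := j)))"
    proof (rule Mk.M.finsum_cong'[OF refl])
      show "(\<lambda>j. f (i(v := j))) \<in> {1..r v} \<rightarrow> carrier (obj M k)"
        using cl[OF i] by auto
      fix j assume j: "j \<in> {1..r v}"
      have "place v (g v j) \<otimes>\<^bsub>GG\<^esub> trans_el \<kappa> i = trans_el (insert v \<kappa>) (i(v := j))"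
      proof (rule extensionalityI[OF GG.P_mult_ext])
        fix w assume w: "w \<in> I"
        interpret Gw: Group.group "G w" by (rule group_G[OF w])
        show "(place v (g v j) \<otimes>\<^bsub>GG\<^esub> trans_el \<kappa> i) w = trans_el (insert v \<kappa>) (i(v := j)) w"
          using w v g_closed[OF v(1) j] GG.P_closed[OF trans_el_closed[OF \<kappa> i] w] Gw.l_one Gw.r_one
          by (cases "w = v") (simp_all add: GG.P_mult GG.place_apply trans_el_def)
      qed (simp add: trans_el_def)
      moreover have "(xfam \<nu> \<kappa> i)(v := push (Nl v) (Vr v j) (Hr v j) \<one>\<^bsub>Hl v\<^esub> (x v j)) =
          xfam \<nu> (insert v \<kappa>) (i(v := j))"
        using v \<nu>'(3) by (auto simp: xfam_def fun_eq_iff)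
      ultimately show "twisted (place v (g v j) \<otimes>\<^bsub>GG\<^esub> trans_el \<kappa> i) \<nu>
        ((xfam \<nu> \<kappa> i)(v := hecke_fun_push (Hl v) R (Nl v) (U v) (Hr v j)
          (\<lambda>h. \<HH> v (h \<otimes>\<^bsub>G v\<^esub> g v j)) (xfam \<nu> \<kappa> i v))) = f (i(v := j))"
        unfolding fv x(2)[OF v(1) j] f_def by simp
    qed
    finally show ?thesis .
  qed
  have "hecke_at k v (zsum \<nu> \<kappa>) = (\<Oplus>\<^bsub>obj M k\<^esub>i\<in>indices \<kappa>. hecke_at k v (twisted (trans_el \<kappa> i) \<nu> (xfam \<nu> \<kappa> i)))"
    unfolding zsum_def k_def[symmetric]
    by (rule mod_hom_finsum[OF F.M.module_obj[OF l] F.M.module_obj[OF l] hecke_place_mod_hom[OF v(1) l]])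
      (use twisted_xfam_closed[OF \<kappa> _ \<nu>] in \<open>auto simp: k_def\<close>)
  also have "\<dots> = (\<Oplus>\<^bsub>obj M k\<^esub>i\<in>indices \<kappa>. \<Oplus>\<^bsub>obj M k\<^esub>j\<in>{1..r v}. f (i(v := j)))"
    using cl main by (intro Mk.M.finsum_cong' Pi_I Mk.M.finsum_closed) auto
  also have "\<dots> = (\<Oplus>\<^bsub>obj M k\<^esub>i\<in>(\<Union>i\<in>indices \<kappa>. (\<lambda>j. i(v := j)) ` {1..r v}). f i)"
  proof (rule Mk.M.finsum_image_disjoint[symmetric])
    show "finite (indices \<kappa>)" using \<kappa>(1) by (simp add: finite_PiE)
    show "i = i' \<and> j = j'" if ij: "i \<in> indices \<kappa>" "i' \<in> indices \<kappa>" "i(v := j) = i'(v := j')" for i j i' j'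
    proof
      show "j = j'" using fun_cong[OF ij(3), of v] by simp
      \<comment> \<open>At v itself both families are undefined, since v is outside their domain;
        the update hides nothing else.\<close>
      have "i w = i' w" for w
        using fun_cong[OF ij(3), of w] PiE_arb[OF ij(1) v(2)] PiE_arb[OF ij(2) v(2)] by (cases "w = v") auto
      then show "i = i'" by (rule ext)
    qed
    show "f (i(v := j)) \<in> carrier (obj M k)" if "i \<in> indices \<kappa>" "j \<in> {1..r v}" for i j
      by (rule cl[OF that])
  qed simp
  also have "(\<Union>i\<in>indices \<kappa>. (\<lambda>j. i(v := j)) ` {1..r v}) = indices (insert v \<kappa>)"
    unfolding PiE_insert_eq by force
  finally show ?thesis by (simp add: zsum_def k_def f_def)
qed

text \<open>The right-hand side sees only the set of places, so the order in the list is
  immaterial.\<close>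

lemma foldr_hecke_zsum:
  assumes \<nu>: "finite \<nu>" "\<nu> \<subseteq> I"
  shows "distinct vs \<Longrightarrow> set vs \<subseteq> I - \<nu> \<Longrightarrow>
    foldr (\<lambda>v. hecke_at (lvl \<nu>) v) vs (zsum \<nu> \<nu>) = zsum \<nu> (\<nu> \<union> set vs)"
proof (induction vs)
  case (Cons v vs)
  then have "hecke_at (lvl \<nu>) v (zsum \<nu> (\<nu> \<union> set vs)) = zsum \<nu> (insert v (\<nu> \<union> set vs))"
    using \<nu> by (intro hecke_place_zsum) auto
  with Cons show ?case by simp
qed simp

lemma zsum_empty: "zsum {} {} = \<iota> (Pi\<^sub>E I U) (Pi\<^sub>E I K) (ptensor (restrict U I) (restrict e I))"
proof -
  \<comment> \<open>This is the only family over the empty set of places.\<close>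
  let ?i = "\<lambda>_. undefined :: nat"
  have t: "trans_el {} ?i = \<one>\<^bsub>GG\<^esub>" by (simp add: trans_el_def rprod_def)
  have lv: "hcomp \<one>\<^bsub>GG\<^esub> {} = restrict U I"
    using group.conj_by_one[OF group_G subgroup.subset[OF K_subgroup]]
    by (auto simp: hcomp_def gcomp_def U_def GG.P_one fun_eq_iff)
  have k: "lvl {} = (Pi\<^sub>E I K)" by (simp add: level_def)
  have lk: "lvl {} \<in> \<Upsilon>\<^sub>G" by (rule levels_G) auto
  interpret Mk: Module.module R "obj M (lvl {})" by (rule F.M.module_obj[OF lk])
  have cl: "twisted (trans_el {} ?i) {} (xfam {} {} ?i) \<in> carrier (obj M (lvl {}))"
    by (rule twisted_xfam_closed) auto
  have x: "xfam {} {} ?i = restrict e I" by (simp add: xfam_def)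
  have c: "conj_by GG \<one>\<^bsub>GG\<^esub> (lvl {}) = lvl {}"
    by (rule GG.P.conj_by_one[OF F.M.level_subset[OF lk]])
  have r: "(\<Pi>\<^sub>E v\<in>I. restrict U I v) = (Pi\<^sub>E I U)" by (rule PiE_cong) simp
  have "zsum {} {} = twisted (trans_el {} ?i) {} (xfam {} {} ?i)"
    unfolding zsum_def using cl by simp
  also have "\<dots> = push M (lvl {}) (lvl {}) \<one>\<^bsub>GG\<^esub>
      (\<iota> (Pi\<^sub>E I U) (lvl {}) (ptensor (restrict U I) (restrict e I)))"
    unfolding twisted_def t x lv c r ..
  also have "\<dots> = \<iota> (Pi\<^sub>E I U) (lvl {}) (ptensor (restrict U I) (restrict e I))"
  proof (rule F.M.push_one[OF lk])
    have "restrict e I \<in> rf (hcomp \<one>\<^bsub>GG\<^esub> {})"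
      using xfam_rf[of "{}" ?i "{}"] unfolding t x by simp
    from twisted_closed(1)[OF GG.P.one_closed _ _ this]
    show "\<iota> (Pi\<^sub>E I U) (lvl {}) (ptensor (restrict U I) (restrict e I))
        \<in> carrier (obj M (lvl {}))"
      unfolding lv c r by blast
  qed
  finally show ?thesis by (simp only: k)
qed

theorem norm_relations:
  shows "\<exists>y. (\<forall>\<nu>. finite \<nu> \<and> \<nu> \<subseteq> I \<longrightarrow> y \<nu> \<in> carrier (obj M (lvl \<nu>))) \<and>
      y {} = \<iota> (Pi\<^sub>E I U) (Pi\<^sub>E I K) (ptensor (restrict U I) (restrict e I)) \<and>
      (\<forall>\<nu> \<mu>. finite \<mu> \<and> \<nu> \<subseteq> \<mu> \<and> \<mu> \<subseteq> I \<longrightarrow>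
        (\<forall>vs. distinct vs \<and> set vs = \<mu> - \<nu> \<longrightarrow>
          foldr (\<lambda>v. hecke_at (lvl \<nu>) v) vs (y \<nu>) =
          push M (lvl \<mu>) (lvl \<nu>) \<one>\<^bsub>GG\<^esub> (y \<mu>)))"
proof (intro exI[of _ "\<lambda>\<nu>. zsum \<nu> \<nu>"] conjI allI impI)
  show "zsum \<nu> \<nu> \<in> carrier (obj M (lvl \<nu>))" if "finite \<nu> \<and> \<nu> \<subseteq> I" for \<nu>
    using that by (intro zsum_closed) auto
  show "zsum {} {} = \<iota> (Pi\<^sub>E I U) (Pi\<^sub>E I K) (ptensor (restrict U I) (restrict e I))"
    by (rule zsum_empty)
  fix \<nu> \<mu> vs assume \<mu>: "finite \<mu> \<and> \<nu> \<subseteq> \<mu> \<and> \<mu> \<subseteq> I" and vs: "distinct vs \<and> set vs = \<mu> - \<nu>"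
  then have "finite \<nu>" "\<nu> \<subseteq> I" "\<nu> \<union> set vs = \<mu>" "set vs \<subseteq> I - \<nu>" using finite_subset by auto
  then show "foldr (\<lambda>v. hecke_at (lvl \<nu>) v) vs (zsum \<nu> \<nu>) =
      push M (lvl \<mu>) (lvl \<nu>) \<one>\<^bsub>GG\<^esub> (zsum \<mu> \<mu>)"
    using foldr_hecke_zsum[of \<nu> vs] push_zsum[of \<mu> \<nu>] \<mu> vs by simp
qed

end

end

theorem theorem1:
  fixes p :: nat and I :: "'v set"
    and G\<^sub>l\<^sub>o\<^sub>c :: "'v \<Rightarrow> 'g monoid" and T\<^sub>l\<^sub>o\<^sub>c :: "'v \<Rightarrow> 'g topology"
    and H K L U :: "'v \<Rightarrow> 'g set"
    and H\<^sub>l\<^sub>o\<^sub>c :: "'v \<Rightarrow> 'g monoid" and TH\<^sub>l\<^sub>o\<^sub>c :: "'v \<Rightarrow> 'g topology"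
    and G\<^sub>t\<^sub>o\<^sub>t H\<^sub>t\<^sub>o\<^sub>t :: "('v \<Rightarrow> 'g) monoid" and TG\<^sub>t\<^sub>o\<^sub>t TH\<^sub>t\<^sub>o\<^sub>t :: "('v \<Rightarrow> 'g) topology"
    and \<Upsilon>\<^sub>G \<Upsilon>\<^sub>H :: "('v \<Rightarrow> 'g) set set" and \<Upsilon>\<^sub>l\<^sub>o\<^sub>c :: "'v \<Rightarrow> 'g set set"
    and N :: "('v \<Rightarrow> 'g, nat \<Rightarrow> int, 'n) ric_data"
    and M :: "('v \<Rightarrow> 'g, nat \<Rightarrow> int, 'm) ric_data"
    and \<iota> :: "('v \<Rightarrow> 'g) set \<Rightarrow> ('v \<Rightarrow> 'g) set \<Rightarrow> 'n \<Rightarrow> 'm"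
    and \<HH> :: "'v \<Rightarrow> 'g \<Rightarrow> nat \<Rightarrow> int"
    and r :: "'v \<Rightarrow> nat" and g :: "'v \<Rightarrow> nat \<Rightarrow> 'g"
    and H\<^sub>r V\<^sub>r :: "'v \<Rightarrow> nat \<Rightarrow> 'g set"
    and N\<^sub>l\<^sub>o\<^sub>c :: "'v \<Rightarrow> ('g, nat \<Rightarrow> int, 'a) ric_data" and x\<^sub>l\<^sub>o\<^sub>c :: "'v \<Rightarrow> 'a"
    and \<Theta> :: "('v \<Rightarrow> 'g set) \<Rightarrow> ('v set \<times> (('v \<Rightarrow> 'a) \<Rightarrow> nat \<Rightarrow> int) set) set \<Rightarrow> 'n"
    and x\<^sub>U :: 'n
  assumes prime: "prime p"
    \<comment> \<open>the local groups\<close>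
    and G_loc: "\<And>v. v \<in> I \<Longrightarrow> locally_profinite (G\<^sub>l\<^sub>o\<^sub>c v) (T\<^sub>l\<^sub>o\<^sub>c v) \<and> unimodular (G\<^sub>l\<^sub>o\<^sub>c v) (T\<^sub>l\<^sub>o\<^sub>c v)"
    and H_closed: "\<And>v. v \<in> I \<Longrightarrow> subgroup (H v) (G\<^sub>l\<^sub>o\<^sub>c v) \<and> closedin (T\<^sub>l\<^sub>o\<^sub>c v) (H v)"
    and H_loc_def: "H\<^sub>l\<^sub>o\<^sub>c = (\<lambda>v. (G\<^sub>l\<^sub>o\<^sub>c v)\<lparr>carrier := H v\<rparr>)"
    and TH_loc_def: "TH\<^sub>l\<^sub>o\<^sub>c = (\<lambda>v. subtopology (T\<^sub>l\<^sub>o\<^sub>c v) (H v))"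
    and H_loc: "\<And>v. v \<in> I \<Longrightarrow> locally_profinite (H\<^sub>l\<^sub>o\<^sub>c v) (TH\<^sub>l\<^sub>o\<^sub>c v) \<and> unimodular (H\<^sub>l\<^sub>o\<^sub>c v) (TH\<^sub>l\<^sub>o\<^sub>c v)"
    and K: "\<And>v. v \<in> I \<Longrightarrow> compact_open_subgroup (G\<^sub>l\<^sub>o\<^sub>c v) (T\<^sub>l\<^sub>o\<^sub>c v) (K v)"
    and U_def: "U = (\<lambda>v. H v \<inter> K v)"
    and L: "\<And>v. v \<in> I \<Longrightarrow> compact_open_subgroup (G\<^sub>l\<^sub>o\<^sub>c v) (T\<^sub>l\<^sub>o\<^sub>c v) (L v) \<and>
        L v \<lhd> (G\<^sub>l\<^sub>o\<^sub>c v)\<lparr>carrier := K v\<rparr>"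
    \<comment> \<open>the restricted products\<close>
    and G_def: "G\<^sub>t\<^sub>o\<^sub>t = rprod I G\<^sub>l\<^sub>o\<^sub>c K" and TG_def: "TG\<^sub>t\<^sub>o\<^sub>t = rprod_topology I T\<^sub>l\<^sub>o\<^sub>c K"
    and H_def: "H\<^sub>t\<^sub>o\<^sub>t = rprod I H\<^sub>l\<^sub>o\<^sub>c U" and TH_def: "TH\<^sub>t\<^sub>o\<^sub>t = rprod_topology I TH\<^sub>l\<^sub>o\<^sub>c U"
    and levels_G: "(\<Pi>\<^sub>E v\<in>I. K v) \<in> \<Upsilon>\<^sub>G" "\<And>\<nu>. finite \<nu> \<Longrightarrow> \<nu> \<subseteq> I \<Longrightarrow> level I K L \<nu> \<in> \<Upsilon>\<^sub>G"
    and levels_loc_def: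
      "\<Upsilon>\<^sub>l\<^sub>o\<^sub>c = (\<lambda>v. (\<lambda>K'. K' \<inter> H v) ` local_levels (G\<^sub>l\<^sub>o\<^sub>c v) (K v) (L v))"
    \<comment> \<open>the functors and the pushforward\<close>
    and N: "comack_functor H\<^sub>t\<^sub>o\<^sub>t TH\<^sub>t\<^sub>o\<^sub>t \<Upsilon>\<^sub>H (Zp p) N"
    and M: "comack_functor G\<^sub>t\<^sub>o\<^sub>t TG\<^sub>t\<^sub>o\<^sub>t \<Upsilon>\<^sub>G (Zp p) M"
    and \<iota>: "mackey_pushforward G\<^sub>t\<^sub>o\<^sub>t TG\<^sub>t\<^sub>o\<^sub>t \<Upsilon>\<^sub>G (carrier H\<^sub>t\<^sub>o\<^sub>t) \<Upsilon>\<^sub>H (Zp p) N M \<iota>"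
    \<comment> \<open>the Hecke functions and the representatives\<close>
    and Hecke: "\<And>v. v \<in> I \<Longrightarrow> hecke_fun (G\<^sub>l\<^sub>o\<^sub>c v) (Zp p) (K v) (K v) (\<HH> v)"
    and reps: "\<And>v. v \<in> I \<Longrightarrow> inj_on (g v) {1..r v} \<and>
        dcoset_reps (G\<^sub>l\<^sub>o\<^sub>c v) (H v) (H v <#>\<^bsub>G\<^sub>l\<^sub>o\<^sub>c v\<^esub> supp (G\<^sub>l\<^sub>o\<^sub>c v) (Zp p) (\<HH> v)) (K v) (g v ` {1..r v})"
    and H_r_def: "H\<^sub>r = (\<lambda>v i. H v \<inter> conj_by (G\<^sub>l\<^sub>o\<^sub>c v) (g v i) (K v))"
    and V_r_def: "V\<^sub>r = (\<lambda>v i. H v \<inter> conj_by (G\<^sub>l\<^sub>o\<^sub>c v) (g v i) (L v))"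
    \<comment> \<open>\<open>N\<close> as a restricted tensor product\<close>
    and N_loc: "\<And>v. v \<in> I \<Longrightarrow> comack_functor (H\<^sub>l\<^sub>o\<^sub>c v) (TH\<^sub>l\<^sub>o\<^sub>c v) (\<Upsilon>\<^sub>l\<^sub>o\<^sub>c v) (Zp p) (N\<^sub>l\<^sub>o\<^sub>c v)"
    and N_tensor: "restricted_tensor_functor (Zp p) I H\<^sub>l\<^sub>o\<^sub>c U \<Upsilon>\<^sub>l\<^sub>o\<^sub>c \<Upsilon>\<^sub>H N\<^sub>l\<^sub>o\<^sub>c x\<^sub>l\<^sub>o\<^sub>c N \<Theta>"
    and x_U: "x\<^sub>U = \<Theta> (restrict U I)
        (functor_tensor_pure (Zp p) I U N\<^sub>l\<^sub>o\<^sub>c x\<^sub>l\<^sub>o\<^sub>c (restrict U I) (restrict x\<^sub>l\<^sub>o\<^sub>c I))"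
    and local_condition: "\<And>v i. v \<in> I \<Longrightarrow> i \<in> {1..r v} \<Longrightarrow>
        \<exists>x \<in> carrier (obj (N\<^sub>l\<^sub>o\<^sub>c v) (V\<^sub>r v i)).
          hecke_fun_push (H\<^sub>l\<^sub>o\<^sub>c v) (Zp p) (N\<^sub>l\<^sub>o\<^sub>c v) (U v) (H\<^sub>r v i)
            (\<lambda>h. \<HH> v (h \<otimes>\<^bsub>G\<^sub>l\<^sub>o\<^sub>c v\<^esub> g v i)) (x\<^sub>l\<^sub>o\<^sub>c v)
          = push (N\<^sub>l\<^sub>o\<^sub>c v) (V\<^sub>r v i) (H\<^sub>r v i) \<one>\<^bsub>H\<^sub>l\<^sub>o\<^sub>c v\<^esub> x"
  shows "\<exists>y. (\<forall>\<nu>. finite \<nu> \<and> \<nu> \<subseteq> I \<longrightarrow> y \<nu> \<in> carrier (obj M (level I K L \<nu>))) \<and>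
      y {} = \<iota> (\<Pi>\<^sub>E v\<in>I. U v) (\<Pi>\<^sub>E v\<in>I. K v) x\<^sub>U \<and>
      (\<forall>\<nu> \<mu>. finite \<mu> \<and> \<nu> \<subseteq> \<mu> \<and> \<mu> \<subseteq> I \<longrightarrow>
        \<comment> \<open>the operators commute, and are composed in an arbitrary order\<close>
        (\<forall>vs. distinct vs \<and> set vs = \<mu> - \<nu> \<longrightarrow>
          foldr (\<lambda>v. hecke_place I G\<^sub>l\<^sub>o\<^sub>c K (Zp p) M (level I K L \<nu>) v (\<HH> v)) vs (y \<nu>) =
          push M (level I K L \<mu>) (level I K L \<nu>) \<one>\<^bsub>G\<^sub>t\<^sub>o\<^sub>t\<^esub> (y \<mu>)))"
proof -
  interpret tensor: restricted_tensor_functor "Zp p" I H\<^sub>l\<^sub>o\<^sub>c U \<Upsilon>\<^sub>l\<^sub>o\<^sub>c \<Upsilon>\<^sub>H N\<^sub>l\<^sub>o\<^sub>c x\<^sub>l\<^sub>o\<^sub>c N \<Theta>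
    by (rule N_tensor)
  interpret hecke_tensor "Zp p" I G\<^sub>l\<^sub>o\<^sub>c T\<^sub>l\<^sub>o\<^sub>c H K L U H\<^sub>l\<^sub>o\<^sub>c TH\<^sub>l\<^sub>o\<^sub>c TG\<^sub>t\<^sub>o\<^sub>t TH\<^sub>t\<^sub>o\<^sub>t \<Upsilon>\<^sub>G \<Upsilon>\<^sub>H \<Upsilon>\<^sub>l\<^sub>o\<^sub>c N M \<iota>
    N\<^sub>l\<^sub>o\<^sub>c x\<^sub>l\<^sub>o\<^sub>c \<Theta> \<HH>
  proof (rule hecke_tensor.intro)
    show "cring (Zp p)" using cring_Zp prime prime_gt_0_nat by blast
    show "topological_group (G\<^sub>l\<^sub>o\<^sub>c v) (T\<^sub>l\<^sub>o\<^sub>c v)" if "v \<in> I" for v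
      using G_loc[OF that] by (simp add: locally_profinite_def)
    show "subgroup (L v) (G\<^sub>l\<^sub>o\<^sub>c v)" if "v \<in> I" for v
      using L[OF that] by (simp add: compact_open_subgroup_def)
    show "L v \<subseteq> K v" if "v \<in> I" for v
      using L[OF that] normal_imp_subgroup subgroup.subset by fastforce
    show "ric_functor (rprod I H\<^sub>l\<^sub>o\<^sub>c U) TH\<^sub>t\<^sub>o\<^sub>t \<Upsilon>\<^sub>H (Zp p) N"
      using N unfolding H_def by (rule comack_functor.axioms)
    show "ric_functor (rprod I G\<^sub>l\<^sub>o\<^sub>c K) TG\<^sub>t\<^sub>o\<^sub>t \<Upsilon>\<^sub>G (Zp p) M"
      using M unfolding G_def by (rule comack_functor.axioms)
    show "ric_functor (H\<^sub>l\<^sub>o\<^sub>c v) (TH\<^sub>l\<^sub>o\<^sub>c v) (\<Upsilon>\<^sub>l\<^sub>o\<^sub>c v) (Zp p) (N\<^sub>l\<^sub>o\<^sub>c v)" if "v \<in> I" for v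
      using N_loc[OF that] by (rule comack_functor.axioms)
    show "mackey_pushforward (rprod I G\<^sub>l\<^sub>o\<^sub>c K) TG\<^sub>t\<^sub>o\<^sub>t \<Upsilon>\<^sub>G (carrier (rprod I H\<^sub>l\<^sub>o\<^sub>c U)) \<Upsilon>\<^sub>H (Zp p) N M \<iota>"
      using \<iota> unfolding G_def H_def .
  qed (use H_closed H_loc_def K U_def levels_G(2) levels_loc_def N_tensor Hecke in auto)
  \<comment> \<open>One choice is made for all places and indices at once, since the classes for
    different \<nu> must be built from the same local vectors.\<close>
  obtain x where x: "\<And>v i. v \<in> I \<Longrightarrow> i \<in> {1..r v} \<Longrightarrow> x v i \<in> carrier (obj (N\<^sub>l\<^sub>o\<^sub>c v) (V\<^sub>r v i)) \<and>
      hecke_fun_push (H\<^sub>l\<^sub>o\<^sub>c v) (Zp p) (N\<^sub>l\<^sub>o\<^sub>c v) (U v) (H\<^sub>r v i) (\<lambda>h. \<HH> v (h \<otimes>\<^bsub>G\<^sub>l\<^sub>o\<^sub>c v\<^esub> g v i)) (x\<^sub>l\<^sub>o\<^sub>c v)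
        = push (N\<^sub>l\<^sub>o\<^sub>c v) (V\<^sub>r v i) (H\<^sub>r v i) \<one>\<^bsub>H\<^sub>l\<^sub>o\<^sub>c v\<^esub> (x v i)"
    using local_condition unfolding Bex_def by metis
  show ?thesis
    unfolding x_U ptensor_def[symmetric] G_def
    by (rule norm_relations[where x = x and r = r and g = g, OF _ _ H_r_def V_r_def]) (use reps x in auto)
qed

end
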